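(* Quasi-isometries of proper CAT(0) spaces need not induce homeomorphisms of contracting boundaries with the Gromov product topology. Precisely: there exist proper CAT(0) spaces $X$ and $Y$ with basepoints $o_X\in X$, $o_Y\in Y$, and a quasi-isometry $\phi\colon X\to Y$, such that the induced bijection $\partial_c\phi\colon \partial_c^{Gp}X\to\partial_c^{Gp}Y$ of contracting boundaries, each equipped with the Gromov product topology, is not continuous. Likewise, when the contracting boundaries of $X$ and $Y$ are viewed as subsets of the visual boundaries of $X$ and $Y$ and given the subspace topology, the induced bijection is not a homeomorphism.
   Context: Let $X$ be a proper geodesic metric space. For a geodesic ray $\gamma$ in $X$ (also viewed as the subset of $X$ it traces), the closest point projection is $\pi_\gamma(x):=\{y\in\gamma\mid d(x,y)=d(x,\gamma)\}$, a nonempty subset of $\gamma$ for each $x\in X$. A geodesic ray $\gamma$ is contracting if there is a non-decreasing, eventually non-negative function $\rho\colon[0,\infty)\to\mathbb{R}$ with $\lim_{r\to\infty}\rho(r)/r=0$ such that for all $x,y\in X$, if $d(x,y)\le d(x,\gamma)$ then $\operatorname{diam}(\pi_\gamma(x)\cup\pi_\gamma(y))\le\rho(d(x,\gamma))$. The Gromov product is $(x\cdot y)_z:=\frac12(d(x,z)+d(y,z)-d(x,y))$ for $x,y,z\in X$. Fix a basepoint $o\in X$. On the set of contracting geodesic rays based at $o$, define $\alpha\sim\beta$ if $\lim_{i,j\to\infty}(\alpha(i)\cdot\beta(j))_o=\infty$. This is an equivalence relation, and $\alpha\sim\beta$ if and only if $\alpha$ and $\beta$ are at bounded Hausdorff distance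 from one another. The contracting boundary $\partial_cX$ is the set of equivalence classes. Extend the Gromov product to $\eta,\zeta\in\partial_cX$ by $(\eta\cdot\zeta)_o:=\sup_{\alpha\in\eta,\,\beta\in\zeta}\liminf_{i,j\to\infty}(\alpha(i)\cdot\beta(j))_o$. For $\eta\in\partial_cX$ and $r>0$ let $U(\eta,r):=\{\zeta\in\partial_cX\mid(\eta\cdot\zeta)_o\ge r\}$. The Gromov product topology on $\partial_cX$ is the topology in which a set $U\subset\partial_cX$ is open if and only if for every $\eta\in U$ there exists $r>0$ with $U(\eta,r)\subset U$. Denote $\partial_cX$ with this topology by $\partial_c^{Gp}X$. A quasi-isometry $\phi\colon X\to Y$ between proper geodesic metric spaces with basepoints $o_X,o_Y$ induces a bijection $\partial_c\phi\colon\partial_cX\to\partial_cY$: if $\eta\in\partial_cX$ is represented by a contracting ray $\alpha$ based at $o_X$, then $\partial_c\phi(\eta)$ is the class of contracting geodesic rays based at $o_Y$ that are at bounded Hausdorff distance from $\phi(\alpha)$. When $X$ is a proper CAT(0) space, its visual boundary is the set of geodesic rays based at $o$, with the topology of uniform convergence on compact sets (the cone topology); each class in $\partial_cX$ contains exactly one geodesic ray based at $o$, so $\partial_cX$ is naturally a subset of the visual boundary. *)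

theory Defs
  imports "HOL-Analysis.Analysis"
begin

section \<open>Proper geodesic spaces and CAT(0) spaces\<close>

definition proper_space :: "'a metric \<Rightarrow> bool" where
  "proper_space X \<longleftrightarrow> (\<forall>x\<in>mspace X. \<forall>r. compactin (mtopology_of X) (mcball_of X x r))"

definition isometric_on :: "'a metric \<Rightarrow> real set \<Rightarrow> (real \<Rightarrow> 'a) \<Rightarrow> bool" where
  "isometric_on X I c \<longleftrightarrow>
     c \<in> I \<rightarrow> mspace X \<and> (\<forall>s\<in>I. \<forall>t\<in>I. mdist X (c s) (c t) = \<bar>s - t\<bar>)"

definition geodesic_segment :: "'a metric \<Rightarrow> 'a \<Rightarrow> 'a \<Rightarrow> 'a set \<Rightarrow> bool" where
  "geodesic_segment X a b S \<longleftrightarrow>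
     (\<exists>c. isometric_on X {0..mdist X a b} c \<and> c 0 = a \<and> c (mdist X a b) = b \<and>
          S = c ` {0..mdist X a b})"

definition geodesic_space :: "'a metric \<Rightarrow> bool" where
  "geodesic_space X \<longleftrightarrow> (\<forall>a\<in>mspace X. \<forall>b\<in>mspace X. \<exists>S. geodesic_segment X a b S)"

text \<open>Pairs of a point on the side \<open>S\<close> from \<open>a\<close> to \<open>b\<close> and its comparison point on the
  Euclidean segment from \<open>a'\<close> to \<open>b'\<close>. The Euclidean plane is represented by \<^typ>\<open>complex\<close>.\<close>

definition comparison_pairs ::
  "'a metric \<Rightarrow> 'a \<Rightarrow> 'a set \<Rightarrow> complex \<Rightarrow> complex \<Rightarrow> ('a \<times> complex) set" where
  "comparison_pairs X a S a' b' =
     {(x, x'). x \<in> S \<and> x' \<in> closed_segment a' b' \<and> dist a' x' = mdist X a x}"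

definition cat0_space :: "'a metric \<Rightarrow> bool" where
  "cat0_space X \<longleftrightarrow> geodesic_space X \<and>
     (\<forall>a\<in>mspace X. \<forall>b\<in>mspace X. \<forall>c\<in>mspace X. \<forall>S T R. \<forall>a' b' c'.
        geodesic_segment X a b S \<and> geodesic_segment X b c T \<and> geodesic_segment X c a R \<and>
        dist a' b' = mdist X a b \<and> dist b' c' = mdist X b c \<and> dist c' a' = mdist X c a \<longrightarrow>
        (let P = comparison_pairs X a S a' b' \<union> comparison_pairs X b T b' c' \<union>
                 comparison_pairs X c R c' a'
         in \<forall>(x, x')\<in>P. \<forall>(y, y')\<in>P. mdist X x y \<le> dist x' y'))"

section \<open>Contracting geodesic rays\<close>

text \<open>Rays are taken to be extensional on \<open>[0, \<infinity>)\<close>, so that two rays are equal exactly when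
  they agree on \<open>[0, \<infinity>)\<close>.\<close>

definition geodesic_rays :: "'a metric \<Rightarrow> 'a \<Rightarrow> (real \<Rightarrow> 'a) set" where
  "geodesic_rays X p = {\<gamma> \<in> extensional {0..}. isometric_on X {0..} \<gamma> \<and> \<gamma> 0 = p}"

definition ray_image :: "(real \<Rightarrow> 'a) \<Rightarrow> 'a set" where
  "ray_image \<gamma> = \<gamma> ` {0..}"

definition dist_to_set :: "'a metric \<Rightarrow> 'a \<Rightarrow> 'a set \<Rightarrow> real" where
  "dist_to_set X x A = (INF a\<in>A. mdist X x a)"

definition proj :: "'a metric \<Rightarrow> 'a set \<Rightarrow> 'a \<Rightarrow> 'a set" where
  "proj X A x = {y \<in> A. mdist X x y = dist_to_set X x A}"

text \<open>A real-valued supremum, meaningful for nonempty bounded sets; it is only applied to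
  unions of two closest point projections, which are nonempty and bounded.\<close>

definition mdiam :: "'a metric \<Rightarrow> 'a set \<Rightarrow> real" where
  "mdiam X A = (SUP (a, b)\<in>A \<times> A. mdist X a b)"

definition contracting :: "'a metric \<Rightarrow> (real \<Rightarrow> 'a) \<Rightarrow> bool" where
  "contracting X \<gamma> \<longleftrightarrow>
     (\<exists>\<rho> :: real \<Rightarrow> real. mono_on {0..} \<rho> \<and> (\<forall>\<^sub>F r in at_top. 0 \<le> \<rho> r) \<and>
        ((\<lambda>r. \<rho> r / r) \<longlongrightarrow> 0) at_top \<and>
        (\<forall>x\<in>mspace X. \<forall>y\<in>mspace X.
           mdist X x y \<le> dist_to_set X x (ray_image \<gamma>) \<longrightarrow>
           mdiam X (proj X (ray_image \<gamma>) x \<union> proj X (ray_image \<gamma>) y)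
             \<le> \<rho> (dist_to_set X x (ray_image \<gamma>))))"

definition contracting_rays :: "'a metric \<Rightarrow> 'a \<Rightarrow> (real \<Rightarrow> 'a) set" where
  "contracting_rays X p = {\<gamma> \<in> geodesic_rays X p. contracting X \<gamma>}"

section \<open>The contracting boundary and the Gromov product topology\<close>

definition gromov_product :: "'a metric \<Rightarrow> 'a \<Rightarrow> 'a \<Rightarrow> 'a \<Rightarrow> real" where
  "gromov_product X z x y = (mdist X x z + mdist X y z - mdist X x y) / 2"

definition ray_equiv :: "'a metric \<Rightarrow> 'a \<Rightarrow> ((real \<Rightarrow> 'a) \<times> (real \<Rightarrow> 'a)) set" where
  "ray_equiv X p =
     {(\<alpha>, \<beta>). \<alpha> \<in> contracting_rays X p \<and> \<beta> \<in> contracting_rays X p \<and>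
        filterlim (\<lambda>(i, j). gromov_product X p (\<alpha> i) (\<beta> j)) at_top (at_top \<times>\<^sub>F at_top)}"

definition contracting_boundary :: "'a metric \<Rightarrow> 'a \<Rightarrow> (real \<Rightarrow> 'a) set set" where
  "contracting_boundary X p = contracting_rays X p // ray_equiv X p"

definition boundary_product ::
  "'a metric \<Rightarrow> 'a \<Rightarrow> (real \<Rightarrow> 'a) set \<Rightarrow> (real \<Rightarrow> 'a) set \<Rightarrow> ereal" where
  "boundary_product X p \<eta> \<zeta> =
     (SUP (\<alpha>, \<beta>)\<in>\<eta> \<times> \<zeta>.
        Liminf (at_top \<times>\<^sub>F at_top) (\<lambda>(i, j). ereal (gromov_product X p (\<alpha> i) (\<beta> j))))"

definition boundary_nbhd ::
  "'a metric \<Rightarrow> 'a \<Rightarrow> (real \<Rightarrow> 'a) set \<Rightarrow> real \<Rightarrow> (real \<Rightarrow> 'a) set set" where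
  "boundary_nbhd X p \<eta> r =
     {\<zeta> \<in> contracting_boundary X p. ereal r \<le> boundary_product X p \<eta> \<zeta>}"

definition Gp_topology :: "'a metric \<Rightarrow> 'a \<Rightarrow> (real \<Rightarrow> 'a) set topology" where
  "Gp_topology X p =
     topology (\<lambda>U. U \<subseteq> contracting_boundary X p \<and>
                   (\<forall>\<eta>\<in>U. \<exists>r>0. boundary_nbhd X p \<eta> r \<subseteq> U))"

lemma istopologyI:
  assumes "\<And>S T. P S \<Longrightarrow> P T \<Longrightarrow> P (S \<inter> T)" and "\<And>\<K>. \<forall>K\<in>\<K>. P K \<Longrightarrow> P (\<Union>\<K>)"
  shows "istopology P"
  using assms unfolding istopology_def by blast

lemma openin_Gp_topology:
  "openin (Gp_topology X p) U \<longleftrightarrow>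
     U \<subseteq> contracting_boundary X p \<and> (\<forall>\<eta>\<in>U. \<exists>r>0. boundary_nbhd X p \<eta> r \<subseteq> U)"
proof -
  let ?P = "\<lambda>U. U \<subseteq> contracting_boundary X p \<and> (\<forall>\<eta>\<in>U. \<exists>r>0. boundary_nbhd X p \<eta> r \<subseteq> U)"
  have mono: "boundary_nbhd X p \<eta> (max r s) \<subseteq> boundary_nbhd X p \<eta> r \<inter> boundary_nbhd X p \<eta> s"
    for \<eta> r s
  proof -
    have "ereal r \<le> ereal (max r s)" "ereal s \<le> ereal (max r s)" by simp_all
    then show ?thesis unfolding boundary_nbhd_def by (blast intro: order_trans)
  qed
  have "?P (S \<inter> T)" if S: "?P S" and T: "?P T" for S T
  proof (intro conjI ballI)
    show "S \<inter> T \<subseteq> contracting_boundary X p" using S by blast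
  next
    fix \<eta> assume \<eta>: "\<eta> \<in> S \<inter> T"
    obtain r where r: "r > 0" "boundary_nbhd X p \<eta> r \<subseteq> S" using S \<eta> by blast
    obtain s where s: "s > 0" "boundary_nbhd X p \<eta> s \<subseteq> T" using T \<eta> by blast
    have "max r s > 0" using r by simp
    moreover have "boundary_nbhd X p \<eta> (max r s) \<subseteq> S \<inter> T" using mono[of \<eta> r s] r s by blast
    ultimately show "\<exists>r>0. boundary_nbhd X p \<eta> r \<subseteq> S \<inter> T" by blast
  qed
  moreover have "?P (\<Union>\<K>)" if K: "\<forall>K\<in>\<K>. ?P K" for \<K>
  proof (intro conjI ballI)
    show "\<Union>\<K> \<subseteq> contracting_boundary X p" using K by blast
  next
    fix \<eta> assume "\<eta> \<in> \<Union>\<K>"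
    then obtain K where "K \<in> \<K>" "\<eta> \<in> K" by blast
    with K show "\<exists>r>0. boundary_nbhd X p \<eta> r \<subseteq> \<Union>\<K>" by (meson Union_upper order_trans)
  qed
  ultimately have "istopology ?P" by (rule istopologyI)
  then show ?thesis unfolding Gp_topology_def by (simp add: topology_inverse')
qed

lemma topspace_Gp_topology: "topspace (Gp_topology X p) = contracting_boundary X p"
proof -
  have "openin (Gp_topology X p) (contracting_boundary X p)"
    unfolding openin_Gp_topology boundary_nbhd_def
    by (intro conjI ballI order_refl exI[of _ 1]) auto
  moreover have "topspace (Gp_topology X p) \<subseteq> contracting_boundary X p"
    using openin_topspace[of "Gp_topology X p"] unfolding openin_Gp_topology by blast
  ultimately show ?thesis by (simp add: openin_subset subset_antisym)
qed

section \<open>The visual boundary\<close>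

definition visual_topology :: "'a metric \<Rightarrow> 'a \<Rightarrow> (real \<Rightarrow> 'a) topology" where
  "visual_topology X p =
     topology (\<lambda>U. U \<subseteq> geodesic_rays X p \<and>
       (\<forall>\<alpha>\<in>U. \<exists>K e. compact K \<and> K \<subseteq> {0..} \<and> e > 0 \<and>
          {\<beta> \<in> geodesic_rays X p. \<forall>t\<in>K. mdist X (\<alpha> t) (\<beta> t) < e} \<subseteq> U))"

lemma openin_visual_topology:
  "openin (visual_topology X p) U \<longleftrightarrow>
     U \<subseteq> geodesic_rays X p \<and>
       (\<forall>\<alpha>\<in>U. \<exists>K e. compact K \<and> K \<subseteq> {0..} \<and> e > 0 \<and>
          {\<beta> \<in> geodesic_rays X p. \<forall>t\<in>K. mdist X (\<alpha> t) (\<beta> t) < e} \<subseteq> U)"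
proof -
  let ?B = "\<lambda>\<alpha> K e. {\<beta> \<in> geodesic_rays X p. \<forall>t\<in>K. mdist X (\<alpha> t) (\<beta> t) < e}"
  let ?P = "\<lambda>U. U \<subseteq> geodesic_rays X p \<and>
       (\<forall>\<alpha>\<in>U. \<exists>K e. compact K \<and> K \<subseteq> {0..} \<and> e > 0 \<and> ?B \<alpha> K e \<subseteq> U)"
  have "?P (S \<inter> T)" if S: "?P S" and T: "?P T" for S T
  proof (intro conjI ballI)
    show "S \<inter> T \<subseteq> geodesic_rays X p" using S by blast
  next
    fix \<alpha> assume \<alpha>: "\<alpha> \<in> S \<inter> T"
    obtain K e where K: "compact K" "K \<subseteq> {0..}" "e > 0" "?B \<alpha> K e \<subseteq> S" using S \<alpha> by blast
    obtain L d where L: "compact L" "L \<subseteq> {0..}" "d > 0" "?B \<alpha> L d \<subseteq> T" using T \<alpha> by blast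
    have "?B \<alpha> (K \<union> L) (min e d) \<subseteq> ?B \<alpha> K e \<inter> ?B \<alpha> L d" by auto
    then have "?B \<alpha> (K \<union> L) (min e d) \<subseteq> S \<inter> T" using K(4) L(4) by blast
    moreover have "compact (K \<union> L)" "K \<union> L \<subseteq> {0..}" "min e d > 0" using K L by auto
    ultimately show "\<exists>K e. compact K \<and> K \<subseteq> {0..} \<and> e > 0 \<and> ?B \<alpha> K e \<subseteq> S \<inter> T" by blast
  qed
  moreover have "?P (\<Union>\<K>)" if K: "\<forall>K\<in>\<K>. ?P K" for \<K>
  proof (intro conjI ballI)
    show "\<Union>\<K> \<subseteq> geodesic_rays X p" using K by blast
  next
    fix \<alpha> assume "\<alpha> \<in> \<Union>\<K>"
    then obtain S where S: "S \<in> \<K>" "\<alpha> \<in> S" by blast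
    have "\<exists>K e. compact K \<and> K \<subseteq> {0..} \<and> e > 0 \<and> ?B \<alpha> K e \<subseteq> S"
      using bspec[OF conjunct2[OF bspec[OF K S(1)]] S(2)] .
    then obtain K e where "compact K" "K \<subseteq> {0..}" "e > 0" "?B \<alpha> K e \<subseteq> S" by blast
    moreover have "S \<subseteq> \<Union>\<K>" using S by blast
    ultimately show "\<exists>K e. compact K \<and> K \<subseteq> {0..} \<and> e > 0 \<and> ?B \<alpha> K e \<subseteq> \<Union>\<K>"
      by (meson order_trans)
  qed
  ultimately have "istopology ?P" by (rule istopologyI)
  then show ?thesis unfolding visual_topology_def by (simp add: topology_inverse')
qed

lemma topspace_visual_topology: "topspace (visual_topology X p) = geodesic_rays X p"
proof -
  have "openin (visual_topology X p) (geodesic_rays X p)"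
    unfolding openin_visual_topology
    by (intro conjI ballI order_refl exI[of _ "{}"] exI[of _ 1]) auto
  moreover have "topspace (visual_topology X p) \<subseteq> geodesic_rays X p"
    using openin_topspace[of "visual_topology X p"] unfolding openin_visual_topology by blast
  ultimately show ?thesis by (simp add: openin_subset subset_antisym)
qed

text \<open>In a proper CAT(0) space every class in the contracting boundary is the singleton of one
  geodesic ray, so \<^const>\<open>the_elem\<close> is the inclusion of the contracting boundary in the visual
  boundary, and the subspace topology is the pullback along it.\<close>

definition contracting_visual_topology :: "'a metric \<Rightarrow> 'a \<Rightarrow> (real \<Rightarrow> 'a) set topology" where
  "contracting_visual_topology X p =
     pullback_topology (contracting_boundary X p) the_elem (visual_topology X p)"

section \<open>Quasi-isometries and the induced boundary map\<close>

definition quasi_isometry :: "'a metric \<Rightarrow> 'b metric \<Rightarrow> ('a \<Rightarrow> 'b) \<Rightarrow> bool" where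
  "quasi_isometry X Y \<phi> \<longleftrightarrow> \<phi> \<in> mspace X \<rightarrow> mspace Y \<and>
     (\<exists>K\<ge>1. \<exists>C\<ge>0.
        (\<forall>x\<in>mspace X. \<forall>x'\<in>mspace X.
           mdist X x x' / K - C \<le> mdist Y (\<phi> x) (\<phi> x') \<and>
           mdist Y (\<phi> x) (\<phi> x') \<le> K * mdist X x x' + C) \<and>
        (\<forall>y\<in>mspace Y. \<exists>x\<in>mspace X. mdist Y (\<phi> x) y \<le> C))"

definition bounded_hausdorff_dist :: "'a metric \<Rightarrow> 'a set \<Rightarrow> 'a set \<Rightarrow> bool" where
  "bounded_hausdorff_dist X A B \<longleftrightarrow>
     (\<exists>C. (\<forall>a\<in>A. \<exists>b\<in>B. mdist X a b \<le> C) \<and> (\<forall>b\<in>B. \<exists>a\<in>A. mdist X a b \<le> C))"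

definition boundary_map ::
  "'b metric \<Rightarrow> 'b \<Rightarrow> ('a \<Rightarrow> 'b) \<Rightarrow> (real \<Rightarrow> 'a) set \<Rightarrow> (real \<Rightarrow> 'b) set" where
  "boundary_map Y q \<phi> \<eta> =
     {\<beta> \<in> contracting_rays Y q.
        \<exists>\<alpha>\<in>\<eta>. bounded_hausdorff_dist Y (\<phi> ` ray_image \<alpha>) (ray_image \<beta>)}"

section \<open>The carrier type\<close>

text \<open>A proper metric space is separable and hence has at most continuum many points, so up to
  isometry every proper metric space has its points in any fixed type of the cardinality of the
  continuum, such as this one.\<close>

type_synonym pt = "nat \<times> real \<times> real"

end

theory Submission
  imports Defs
begin

text \<open>Let \<open>F\<close> be the universal cover of the plane without the open unit disc, a proper CAT(0) space
  whose boundary line is contracting. The logarithmic shear \<open>(t, \<theta>) \<mapsto> (t, \<theta> - ln t)\<close> in polar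
  coordinates is bi-Lipschitz and fixes the boundary line. Attach rays to \<open>F\<close> at points \<open>(t\<^sub>n, ln t\<^sub>n)\<close>
  with \<open>t\<^sub>n \<rightarrow> \<infinity>\<close> to get \<open>X\<close>, and at their images \<open>(t\<^sub>n, 0)\<close> to get \<open>Y\<close>. The contracting
  rays are the two halves of the boundary line and the rays through the attached ones; all others
  bound a Euclidean half-plane. The attached rays converge to an end of the boundary line in \<open>X\<close>,
  where their geodesics follow that line for a time \<open>ln t\<^sub>n\<close>, but stay away from it in \<open>Y\<close>.\<close>

section \<open>A criterion for CAT(0)\<close>

text \<open>The maps \<open>L\<close> below play the role of the inverse of the exponential map at \<open>y\<close>: they are
  non-expanding, preserve distances to \<open>y\<close>, and develop \<open>a\<close> and \<open>b\<close> in opposite directions. The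
  case \<open>a = b\<close> yields the triangle inequality, and Stewart's theorem in the plane yields the
  Bruhat-Tits inequality, hence CAT(0).\<close>

locale developing_space =
  fixes M :: "'a set" and d :: "'a \<Rightarrow> 'a \<Rightarrow> real"
  assumes sym: "x \<in> M \<Longrightarrow> y \<in> M \<Longrightarrow> d x y = d y x"
    and zero: "x \<in> M \<Longrightarrow> y \<in> M \<Longrightarrow> d x y = 0 \<longleftrightarrow> x = y"
    and develop: "a \<in> M \<Longrightarrow> b \<in> M \<Longrightarrow> 0 \<le> t \<Longrightarrow> t \<le> 1 \<Longrightarrow>
      \<exists>y\<in>M. \<exists>L :: 'a \<Rightarrow> complex. \<exists>w. (\<forall>x\<in>M. cmod (L x) = d x y) \<and>
        (\<forall>x\<in>M. \<forall>z\<in>M. cmod (L x - L z) \<le> d x z) \<and>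
        cmod w = d a b \<and> L a = of_real t * w \<and> L b = - (of_real (1 - t) * w)"
begin

lemma nonneg: "x \<in> M \<Longrightarrow> y \<in> M \<Longrightarrow> 0 \<le> d x y"
  using develop[of x y 0] by (metis norm_ge_zero order_refl zero_le_one)

lemma develop_at:
  assumes "y \<in> M"
  obtains L :: "'a \<Rightarrow> complex" where "\<forall>x\<in>M. cmod (L x) = d x y"
    "\<forall>x\<in>M. \<forall>z\<in>M. cmod (L x - L z) \<le> d x z"
proof -
  obtain y' and L :: "'a \<Rightarrow> complex" and w where y': "y' \<in> M" and L: "\<forall>x\<in>M. cmod (L x) = d x y'"
    "\<forall>x\<in>M. \<forall>z\<in>M. cmod (L x - L z) \<le> d x z" and w: "cmod w = d y y" "L y = of_real 0 * w"
    using develop[OF assms assms, of 0] by auto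
  have "d y y' = 0" using w L(1) assms by force
  then have "y' = y" using zero assms y' by blast
  then show thesis using that L by blast
qed

lemma triangle:
  assumes "x \<in> M" "y \<in> M" "z \<in> M"
  shows "d x z \<le> d x y + d y z"
proof -
  obtain L :: "'a \<Rightarrow> complex" where L: "\<forall>x\<in>M. cmod (L x) = d x z"
    "\<forall>x\<in>M. \<forall>z\<in>M. cmod (L x - L z) \<le> d x z"
    using develop_at[OF assms(3)] by blast
  have "cmod (L x) \<le> cmod (L x - L y) + cmod (L y)"
    using norm_triangle_ineq[of "L x - L y" "L y"] by simp
  moreover have "cmod (L x - L y) \<le> d x y" using L(2) assms by blast
  moreover have "cmod (L x) = d x z" "cmod (L y) = d y z" using L(1) assms by auto
  ultimately show ?thesis by linarith
qed

end

lemma stewart: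
  fixes z w :: complex
  shows "(1 - t) * (cmod (z - of_real t * w))\<^sup>2 + t * (cmod (z + of_real (1 - t) * w))\<^sup>2
    = (cmod z)\<^sup>2 + t * (1 - t) * (cmod w)\<^sup>2"
  unfolding cmod_power2 by (simp add: algebra_simps power2_eq_square)

lemma stewart_segment:
  fixes z a b :: complex
  shows "(cmod (z - ((1 - t) *\<^sub>R a + t *\<^sub>R b)))\<^sup>2 =
    (1 - t) * (cmod (z - a))\<^sup>2 + t * (cmod (z - b))\<^sup>2 - t * (1 - t) * (cmod (a - b))\<^sup>2"
  unfolding cmod_power2 by (simp add: algebra_simps power2_eq_square)

lemma bruhat_tits_step:
  fixes t :: real
  assumes "0 \<le> t" "t \<le> 1" "A \<le> A'" "B \<le> B'" "0 \<le> A" "0 \<le> B"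
  shows "(1 - t) * A\<^sup>2 + t * B\<^sup>2 \<le> (1 - t) * A'\<^sup>2 + t * B'\<^sup>2"
  using assms by (intro add_mono mult_left_mono power_mono) auto

context developing_space
begin

lemma develop_point:
  assumes "a \<in> M" "b \<in> M" "0 \<le> t" "t \<le> 1"
  obtains y where "y \<in> M" "d a y = t * d a b" "d y b = (1 - t) * d a b"
    "\<And>x. x \<in> M \<Longrightarrow> (d x y)\<^sup>2 \<le> (1 - t) * (d x a)\<^sup>2 + t * (d x b)\<^sup>2 - t * (1 - t) * (d a b)\<^sup>2"
proof -
  obtain y and L :: "'a \<Rightarrow> complex" and w where y: "y \<in> M"
    and L: "\<And>x. x\<in>M \<Longrightarrow> cmod (L x) = d x y"
    "\<And>x z. x\<in>M \<Longrightarrow> z\<in>M \<Longrightarrow> cmod (L x - L z) \<le> d x z"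
    and w: "cmod w = d a b" "L a = of_real t * w" "L b = - (of_real (1 - t) * w)"
    using develop[OF assms] by blast
  show thesis
  proof
    show "y \<in> M" by fact
    show "d a y = t * d a b" using L(1)[OF assms(1)] w assms by (simp add: norm_mult)
    have "d b y = (1 - t) * d a b" using L(1)[OF assms(2)] w assms
      by (simp add: norm_mult del: of_real_diff)
    then show "d y b = (1 - t) * d a b" using sym y assms by simp
    show "(d x y)\<^sup>2 \<le> (1 - t) * (d x a)\<^sup>2 + t * (d x b)\<^sup>2 - t * (1 - t) * (d a b)\<^sup>2"
      if x: "x \<in> M" for x
    proof -
      have "(cmod (L x))\<^sup>2 + t * (1 - t) * (cmod w)\<^sup>2 =
          (1 - t) * (cmod (L x - L a))\<^sup>2 + t * (cmod (L x - L b))\<^sup>2"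
        using stewart[of t "L x" w] w(2,3) by (simp del: of_real_diff)
      also have "\<dots> \<le> (1 - t) * (d x a)\<^sup>2 + t * (d x b)\<^sup>2"
        using assms x L(2) by (intro bruhat_tits_step) auto
      finally show ?thesis using L(1)[OF x] w(1) by simp
    qed
  qed
qed

lemma bruhat_tits:
  assumes "a \<in> M" "b \<in> M" "m \<in> M" "0 \<le> t" "t \<le> 1" and m: "d a m = t * d a b" "d m b = (1 - t) * d a b"
    and x: "x \<in> M"
  shows "(d x m)\<^sup>2 \<le> (1 - t) * (d x a)\<^sup>2 + t * (d x b)\<^sup>2 - t * (1 - t) * (d a b)\<^sup>2"
proof -
  obtain y where y: "y \<in> M" and
    cn: "\<And>x. x \<in> M \<Longrightarrow> (d x y)\<^sup>2 \<le> (1 - t) * (d x a)\<^sup>2 + t * (d x b)\<^sup>2 - t * (1 - t) * (d a b)\<^sup>2"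
    using develop_point[OF assms(1,2,4,5)] by blast
  have "(d m y)\<^sup>2 \<le> (1 - t) * (t * d a b)\<^sup>2 + t * ((1 - t) * d a b)\<^sup>2 - t * (1 - t) * (d a b)\<^sup>2"
    using cn[OF assms(3)] m sym assms(1,3) by simp
  also have "\<dots> = 0" by (simp add: power2_eq_square algebra_simps)
  finally have "m = y" using zero[of m y] assms(3) y by simp
  then show ?thesis using cn x by blast
qed

lemma geodesic_unique:
  assumes "a \<in> M" "b \<in> M" "m \<in> M" "m' \<in> M" "d a m = d a m'" "d m b = d m' b" "d a m + d m b = d a b"
  shows "m = m'"
proof (cases "d a b = 0")
  case True
  then have "d a m = 0" "d a m' = 0" using assms nonneg[of a m] nonneg[of m b] by linarith+
  then show ?thesis using zero[of a m] zero[of a m'] assms by simp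
next
  case False
  define t where "t = d a m / d a b"
  have D: "d a b > 0" using False nonneg assms by fastforce
  have am: "d a m = t * d a b" using D by (simp add: t_def)
  then have m: "d a m = t * d a b" "d m b = (1 - t) * d a b"
    using assms(7) by (simp_all add: left_diff_distrib)
  have t: "0 \<le> t" "t \<le> 1" using D assms(1-3,7) nonneg[of a m] nonneg[of m b] by (auto simp: t_def)
  have "(d m' m)\<^sup>2 \<le> (1 - t) * (d m' a)\<^sup>2 + t * (d m' b)\<^sup>2 - t * (1 - t) * (d a b)\<^sup>2"
    by (rule bruhat_tits) (use assms m t in auto)
  also have "\<dots> = (1 - t) * (t * d a b)\<^sup>2 + t * ((1 - t) * d a b)\<^sup>2 - t * (1 - t) * (d a b)\<^sup>2"
    using m assms sym[of m' a] by simp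
  also have "\<dots> = 0" by (simp add: power2_eq_square algebra_simps)
  finally show ?thesis using zero[of m' m] assms by simp
qed

definition X :: "'a metric" where
  "X = metric (M, \<lambda>x y. if x \<in> M \<and> y \<in> M then d x y else 0)"

lemma Metric_space: "Metric_space M (\<lambda>x y. if x \<in> M \<and> y \<in> M then d x y else 0)"
  using nonneg sym zero triangle by unfold_locales auto

lemma mspace_X [simp]: "mspace X = M"
  unfolding X_def by (rule Metric_space.mspace_metric[OF Metric_space])

lemma mdist_X [simp]: "x \<in> M \<Longrightarrow> y \<in> M \<Longrightarrow> mdist X x y = d x y"
  unfolding X_def by (simp add: Metric_space.mdist_metric[OF Metric_space])

lemma geodesic_segment_exists:
  assumes "a \<in> M" "b \<in> M"
  shows "\<exists>S. geodesic_segment X a b S"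
proof -
  define D where "D = d a b"
  have D0: "D \<ge> 0" using assms nonneg by (simp add: D_def)
  have pt: "\<exists>y\<in>M. d a y = u \<and> d y b = D - u \<and>
      (\<forall>x\<in>M. (d x y)\<^sup>2 \<le> (1 - u / D) * (d x a)\<^sup>2 + (u / D) * (d x b)\<^sup>2 - (u / D) * (1 - u / D) * D\<^sup>2)"
    if u: "u \<in> {0..D}" for u
  proof (cases "D = 0")
    case True
    then have "d a b = 0" "u = 0" using u by (simp_all add: D_def)
    then have "a = b" "u = 0" "d a a = 0" using zero[of a b] zero[of a a] assms by simp_all
    then show ?thesis using assms(1) True by (intro bexI[of _ a]) simp_all
  next
    case False
    have "0 \<le> u / D" "u / D \<le> 1" using u False by auto
    from develop_point[OF assms this, folded D_def] obtain y where y: "y \<in> M"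
      "d a y = u / D * D" "d y b = (1 - u / D) * D"
      "\<And>x. x \<in> M \<Longrightarrow> (d x y)\<^sup>2 \<le> (1 - u / D) * (d x a)\<^sup>2 + (u / D) * (d x b)\<^sup>2 - (u / D) * (1 - u / D) * D\<^sup>2"
      by blast
    have "(1 - u / D) * D = D - u" "u / D * D = u" using False by (simp_all add: left_diff_distrib)
    then have "d a y = u" "d y b = D - u" using y(2,3) by simp_all
    then show ?thesis using y(1,4) by (intro bexI[of _ y] conjI ballI)
  qed
  define c where "c u = (SOME y. y \<in> M \<and> d a y = u \<and> d y b = D - u \<and>
      (\<forall>x\<in>M. (d x y)\<^sup>2 \<le> (1 - u / D) * (d x a)\<^sup>2 + (u / D) * (d x b)\<^sup>2 - (u / D) * (1 - u / D) * D\<^sup>2))" for u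
  have c: "c u \<in> M \<and> d a (c u) = u \<and> d (c u) b = D - u \<and>
      (\<forall>x\<in>M. (d x (c u))\<^sup>2 \<le> (1 - u / D) * (d x a)\<^sup>2 + (u / D) * (d x b)\<^sup>2 - (u / D) * (1 - u / D) * D\<^sup>2)"
    if "u \<in> {0..D}" for u
    unfolding c_def by (rule someI_ex[OF pt[OF that, unfolded Bex_def]])
  have cM: "c u \<in> M" and ac: "d a (c u) = u" and cb: "d (c u) b = D - u" if "u \<in> {0..D}" for u
    using c[OF that] by simp_all
  have le: "d (c v) (c u) \<le> \<bar>v - u\<bar>" if uv: "u \<in> {0..D}" "v \<in> {0..D}" for u v
  proof (cases "D = 0")
    case True
    then have "u = v" using uv by simp
    then show ?thesis using cM[OF uv(1)] zero[of "c u" "c u"] by simp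
  next
    case False
    have va: "d (c v) a = v" using sym[of a "c v"] assms(1) cM ac uv(2) by metis
    have "\<forall>x\<in>M. (d x (c u))\<^sup>2 \<le> (1 - u / D) * (d x a)\<^sup>2 + (u / D) * (d x b)\<^sup>2 - (u / D) * (1 - u / D) * D\<^sup>2"
      using c[OF uv(1)] by simp
    from bspec[OF this cM[OF uv(2)]]
    have "(d (c v) (c u))\<^sup>2 \<le> (1 - u / D) * v\<^sup>2 + (u / D) * (D - v)\<^sup>2 - (u / D) * (1 - u / D) * D\<^sup>2"
      unfolding va cb[OF uv(2)] .
    also have "\<dots> = v\<^sup>2 - 2 * (u / D * D) * v + (u / D * D)\<^sup>2"
      by (simp only: power2_eq_square) algebra
    also have "\<dots> = (v - u)\<^sup>2" using False by (simp add: power2_eq_square algebra_simps)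
    finally show ?thesis using abs_le_square_iff[of "d (c v) (c u)" "v - u"] by linarith
  qed
  have iso: "isometric_on X {0..D} c"
    unfolding isometric_on_def
  proof (intro conjI ballI)
    show "c \<in> {0..D} \<rightarrow> mspace X" using cM by auto
    fix u v assume uv: "u \<in> {0..D}" "v \<in> {0..D}"
    have "d a (c v) \<le> d a (c u) + d (c u) (c v)" using triangle assms cM uv by simp
    moreover have "d a (c u) \<le> d a (c v) + d (c v) (c u)" using triangle assms cM uv by simp
    moreover have "d (c v) (c u) = d (c u) (c v)" using sym cM uv by blast
    ultimately have "\<bar>u - v\<bar> = d (c u) (c v)" using le[OF uv] ac[OF uv(1)] ac[OF uv(2)] by linarith
    then show "mdist X (c u) (c v) = \<bar>u - v\<bar>" using cM uv by simp
  qed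
  have "c 0 = a" using cM[of 0] ac[of 0] D0 zero[of a "c 0"] assms by simp
  moreover have "c D = b" using cM[of D] cb[of D] D0 zero[of "c D" b] assms by simp
  ultimately show ?thesis using iso assms unfolding geodesic_segment_def D_def by auto
qed

lemma geodesic_space_X: "geodesic_space X"
  unfolding geodesic_space_def using geodesic_segment_exists by simp

lemma comparison_step:
  assumes S: "geodesic_segment X a b S" and "a \<in> M" "b \<in> M" "x \<in> M"
    and D: "dist a' b' = d a b"
    and y: "(y, y') \<in> comparison_pairs X a S a' b'"
    and le: "d x a \<le> dist x' a'" "d x b \<le> dist x' b'"
  shows "y \<in> M \<and> d x y \<le> dist x' y'"
proof -
  obtain c where c: "isometric_on X {0..d a b} c" "c 0 = a" "c (d a b) = b" "S = c ` {0..d a b}"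
    using S assms unfolding geodesic_segment_def by auto
  obtain u where u: "u \<in> {0..d a b}" "y = c u"
    using y c(4) unfolding comparison_pairs_def by auto
  have D0: "0 \<in> {0..d a b}" "d a b \<in> {0..d a b}" using u by auto
  have yM: "y \<in> M" using c(1) u unfolding isometric_on_def by auto
  have dist_c: "d (c v) (c w) = \<bar>v - w\<bar>" if "v \<in> {0..d a b}" "w \<in> {0..d a b}" for v w
  proof -
    have "c v \<in> M" "c w \<in> M" "mdist X (c v) (c w) = \<bar>v - w\<bar>"
      using c(1) that unfolding isometric_on_def by auto
    then show ?thesis by simp
  qed
  have ay: "d a y = u" using dist_c[OF D0(1) u(1)] c u by simp
  have yb: "d y b = d a b - u" using dist_c[OF u(1) D0(2)] c u by simp
  have y': "y' \<in> closed_segment a' b'" "dist a' y' = u"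
    using y ay yM assms unfolding comparison_pairs_def by auto
  obtain t where t: "0 \<le> t" "t \<le> 1" "y' = (1 - t) *\<^sub>R a' + t *\<^sub>R b'"
    using y'(1) unfolding in_segment by auto
  have "a' - y' = t *\<^sub>R (a' - b')" using t by (simp add: algebra_simps)
  then have u_eq: "u = t * d a b" using y'(2) D t by (simp add: dist_norm)
  have "(d x y)\<^sup>2 \<le> (1 - t) * (d x a)\<^sup>2 + t * (d x b)\<^sup>2 - t * (1 - t) * (d a b)\<^sup>2"
  proof (rule bruhat_tits[OF assms(2,3) yM t(1,2) _ _ assms(4)])
    show "d a y = t * d a b" using ay u_eq by simp
    show "d y b = (1 - t) * d a b" using yb u_eq by (simp add: left_diff_distrib)
  qed
  also have "\<dots> \<le> (1 - t) * (dist x' a')\<^sup>2 + t * (dist x' b')\<^sup>2 - t * (1 - t) * (dist a' b')\<^sup>2"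
    using bruhat_tits_step[OF t(1,2) le nonneg nonneg] assms(2-4) D by simp
  also have "\<dots> = (dist x' y')\<^sup>2"
    using stewart_segment[of x' t a' b'] unfolding t(3) dist_norm by simp
  finally show ?thesis using yM by (auto intro: power2_le_imp_le)
qed

lemma cat0_space_X: "cat0_space X"
  unfolding cat0_space_def
proof (intro conjI ballI allI impI geodesic_space_X)
  fix a b c S T R and a' b' c' :: complex
  assume M: "a \<in> mspace X" "b \<in> mspace X" "c \<in> mspace X"
  assume *: "geodesic_segment X a b S \<and> geodesic_segment X b c T \<and> geodesic_segment X c a R \<and>
    dist a' b' = mdist X a b \<and> dist b' c' = mdist X b c \<and> dist c' a' = mdist X c a"
  have abc: "a \<in> M" "b \<in> M" "c \<in> M" using M by auto
  have dist: "dist a' b' = d a b" "dist b' c' = d b c" "dist c' a' = d c a"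
    "dist b' a' = d b a" "dist c' b' = d c b" "dist a' c' = d a c"
    "dist a' a' = d a a" "dist b' b' = d b b" "dist c' c' = d c c"
    using * abc sym[of b a] sym[of c b] sym[of a c] zero[of a a] zero[of b b] zero[of c c]
    by (simp_all add: dist_commute)
  let ?P = "comparison_pairs X a S a' b' \<union> comparison_pairs X b T b' c' \<union> comparison_pairs X c R c' a'"
  have step: "y \<in> M \<and> d x y \<le> dist x' y'"
    if y: "(y, y') \<in> ?P" and x: "x \<in> M" and le: "d x a \<le> dist x' a'" "d x b \<le> dist x' b'"
      "d x c \<le> dist x' c'" for x x' y y'
  proof -
    have "geodesic_segment X a b S" "geodesic_segment X b c T" "geodesic_segment X c a R"
      using * by auto
    note steps = comparison_step[OF this(1) abc(1,2) x dist(1) _ le(1,2)]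
      comparison_step[OF this(2) abc(2,3) x dist(2) _ le(2,3)]
      comparison_step[OF this(3) abc(3,1) x dist(3) _ le(3,1)]
    show ?thesis using y steps by (elim UnE) blast+
  qed
  have P: "y \<in> M \<and> d a y \<le> dist a' y' \<and> d b y \<le> dist b' y' \<and> d c y \<le> dist c' y'"
    if "(y, y') \<in> ?P" for y y'
    using step[OF that, of a a'] step[OF that, of b b'] step[OF that, of c c'] abc dist by simp
  have "mdist X x y \<le> dist x' y'" if "(x, x') \<in> ?P" "(y, y') \<in> ?P" for x x' y y'
  proof -
    have x: "x \<in> M" "d x a \<le> dist x' a'" "d x b \<le> dist x' b'" "d x c \<le> dist x' c'"
      using P[OF that(1)] sym abc by (auto simp: dist_commute)
    show ?thesis using step[OF that(2) x] x by simp
  qed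
  then show "let P = ?P in \<forall>(x, x')\<in>P. \<forall>(y, y')\<in>P. mdist X x y \<le> dist x' y'"
    by (auto simp: Let_def)
qed

end

section \<open>The universal cover of the complement of a disc\<close>

text \<open>The universal cover of the plane without the open unit disc. The pair \<open>(s, \<theta>)\<close> is the point
  with angle \<open>\<theta>\<close> at distance \<open>sqrt (1 + s\<^sup>2)\<close> from the centre, so that \<open>s\<close> is the length of its two
  tangents to the disc; they touch the disc at the angles \<open>lo\<close> and \<open>hi\<close>. Two points see each other
  if and only if their intervals \<open>[lo, hi]\<close> meet.\<close>

definition sheet :: "(real \<times> real) set" where
  "sheet = {x. 0 \<le> fst x}"

definition lo :: "real \<times> real \<Rightarrow> real" where
  "lo x = snd x - arctan (fst x)"

definition hi :: "real \<times> real \<Rightarrow> real" where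
  "hi x = snd x + arctan (fst x)"

definition plane :: "real \<times> real \<Rightarrow> complex" where
  "plane x = of_real (sqrt (1 + (fst x)\<^sup>2)) * cis (snd x)"

definition visible :: "real \<times> real \<Rightarrow> real \<times> real \<Rightarrow> bool" where
  "visible x z \<longleftrightarrow> lo x \<le> hi z \<and> lo z \<le> hi x"

definition sdist :: "real \<times> real \<Rightarrow> real \<times> real \<Rightarrow> real" where
  "sdist x z =
     (if visible x z then cmod (plane x - plane z)
      else if hi x < lo z then fst x + fst z + (lo z - hi x)
      else fst x + fst z + (lo x - hi z))"

lemma lo_le_hi: "x \<in> sheet \<Longrightarrow> lo x \<le> hi x"
  by (simp add: sheet_def lo_def hi_def)

lemma cis_arctan: "of_real (sqrt (1 + s\<^sup>2)) * cis (arctan s) = Complex 1 s"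
proof -
  have "sqrt (1 + s\<^sup>2) \<noteq> 0" by (smt (verit) real_sqrt_eq_zero_cancel_iff zero_le_power2)
  then show ?thesis by (simp add: complex_eq_iff cos_arctan sin_arctan)
qed

lemma plane_lo: "plane x = Complex 1 (fst x) * cis (lo x)"
  by (simp add: plane_def lo_def cis_arctan[symmetric] cis_mult mult.assoc)

lemma plane_hi: "plane x = Complex 1 (- fst x) * cis (hi x)"
  using cis_arctan[of "- fst x"]
  by (simp add: plane_def hi_def cis_mult mult.assoc arctan_minus flip: cis_arctan)

lemma cmod_Complex_one_mult_cis: 
  "cmod (Complex 1 a * cis k - Complex 1 b * cis k) = \<bar>a - b\<bar>"
proof -
  have "Complex 1 a * cis k - Complex 1 b * cis k = Complex 0 (a - b) * cis k"
    by (simp add: complex_eq_iff algebra_simps)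
  also have "cmod \<dots> = \<bar>a - b\<bar>" unfolding norm_mult by (simp add: cmod_def)
  finally show ?thesis .
qed

lemma cmod_mult_cis_diff: "cmod (v * cis k - w * cis k) = cmod (v - w)"
  by (simp add: norm_mult flip: left_diff_distrib)

lemma sqrt_cos_ge_one:
  assumes "\<bar>\<theta>\<bar> \<le> arctan s"
  shows "sqrt (1 + s\<^sup>2) * cos \<theta> \<ge> 1"
proof -
  have s: "sqrt (1 + s\<^sup>2) > 0" by (simp add: add_pos_nonneg)
  have "cos (arctan s) \<le> cos \<bar>\<theta>\<bar>"
    using assms arctan_ubound[of s] by (intro cos_monotone_0_pi_le) auto
  then have "1 / sqrt (1 + s\<^sup>2) \<le> cos \<theta>" by (simp add: cos_arctan)
  then show ?thesis using s by (simp add: field_simps)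
qed

text \<open>The points that see the boundary point at angle \<open>k\<close> form a half-plane.\<close>

definition chart :: "real \<Rightarrow> complex \<Rightarrow> real \<times> real" where
  "chart k w = (sqrt ((cmod w)\<^sup>2 - 1), k + arctan (Im w / Re w))"

lemma
  assumes "Re w \<ge> 1"
  shows chart_in_sheet: "chart k w \<in> sheet"
    and plane_chart: "plane (chart k w) = w * cis k"
    and lo_chart: "lo (chart k w) \<le> k"
    and hi_chart: "k \<le> hi (chart k w)"
proof -
  have w2: "(cmod w)\<^sup>2 = (Re w)\<^sup>2 + (Im w)\<^sup>2" by (rule cmod_power2)
  have re: "1 \<le> (Re w)\<^sup>2" using assms by simp
  have pos: "0 \<le> (cmod w)\<^sup>2 - 1" using w2 re zero_le_power2[of "Im w"] by linarith
  then have s: "(sqrt ((cmod w)\<^sup>2 - 1))\<^sup>2 = (cmod w)\<^sup>2 - 1" by simp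
  show "chart k w \<in> sheet" using pos by (simp add: sheet_def chart_def)
  have "of_real (sqrt (1 + (Im w / Re w)\<^sup>2)) * cis (arctan (Im w / Re w)) * of_real (Re w) = w"
    unfolding cis_arctan using assms by (simp add: complex_eq_iff)
  moreover have "sqrt (1 + (Im w / Re w)\<^sup>2) * Re w = cmod w"
  proof -
    have "1 + (Im w / Re w)\<^sup>2 = (cmod w)\<^sup>2 / (Re w)\<^sup>2"
      using assms w2 by (simp add: field_simps)
    then show ?thesis using assms by (simp add: real_sqrt_divide)
  qed
  ultimately have "of_real (cmod w) * cis (arctan (Im w / Re w)) = w"
    by (metis mult.assoc mult.commute of_real_mult)
  then show "plane (chart k w) = w * cis k"
    by (simp add: plane_def chart_def s cis_mult[symmetric] add.commute[of k] mult.assoc[symmetric])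
  have "(Im w / Re w)\<^sup>2 \<le> (Im w)\<^sup>2"
    using assms re by (simp add: power_divide divide_le_eq mult_le_cancel_left1)
  then have "(Im w / Re w)\<^sup>2 \<le> (sqrt ((cmod w)\<^sup>2 - 1))\<^sup>2" using re w2 unfolding s by linarith
  moreover have "0 \<le> sqrt ((cmod w)\<^sup>2 - 1)" using pos by simp
  ultimately have "\<bar>Im w / Re w\<bar> \<le> sqrt ((cmod w)\<^sup>2 - 1)"
    using abs_le_square_iff[of "Im w / Re w" "sqrt ((cmod w)\<^sup>2 - 1)"] by linarith
  then have "arctan (Im w / Re w) \<le> arctan (sqrt ((cmod w)\<^sup>2 - 1))"
    "arctan (- (Im w / Re w)) \<le> arctan (sqrt ((cmod w)\<^sup>2 - 1))"
    unfolding arctan_le_iff by linarith+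
  then show "lo (chart k w) \<le> k" "k \<le> hi (chart k w)"
    by (simp_all add: lo_def hi_def chart_def arctan_minus)
qed

lemma chart_plane:
  assumes "x \<in> sheet" "lo x \<le> k" "k \<le> hi x"
  obtains w where "Re w \<ge> 1" "x = chart k w"
proof
  define a where "a = snd x - k"
  let ?w = "of_real (sqrt (1 + (fst x)\<^sup>2)) * cis a"
  have a: "\<bar>a\<bar> \<le> arctan (fst x)" using assms by (auto simp: a_def lo_def hi_def)
  then have a2: "- (pi/2) < a" "a < pi/2" using arctan_ubound[of "fst x"] by linarith+
  show "Re ?w \<ge> 1" using sqrt_cos_ge_one[OF a] by simp
  have "cmod ?w = sqrt (1 + (fst x)\<^sup>2)" by (simp add: norm_mult)
  moreover have "Im ?w / Re ?w = tan a"
  proof -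
    have "1 + (fst x)\<^sup>2 > 0" by (simp add: add_pos_nonneg)
    then show ?thesis by (simp add: tan_def)
  qed
  ultimately show "x = chart k ?w" 
    using a2 assms(1) by (simp add: chart_def prod_eq_iff arctan_tan sheet_def) (simp add: a_def)
qed

lemma visible_chart: "Re v \<ge> 1 \<Longrightarrow> Re w \<ge> 1 \<Longrightarrow> visible (chart k v) (chart k w)"
  unfolding visible_def using lo_chart hi_chart order_trans by blast

lemma sdist_chart: "Re v \<ge> 1 \<Longrightarrow> Re w \<ge> 1 \<Longrightarrow> sdist (chart k v) (chart k w) = cmod (v - w)"
  by (simp add: sdist_def visible_chart plane_chart cmod_mult_cis_diff)

lemma visible_charts:
  assumes "x \<in> sheet" "z \<in> sheet" "visible x z"
  obtains k v w where "Re v \<ge> 1" "Re w \<ge> 1" "x = chart k v" "z = chart k w"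
proof -
  let ?k = "max (lo x) (lo z)"
  have "lo x \<le> ?k" "?k \<le> hi x" "lo z \<le> ?k" "?k \<le> hi z"
    using assms lo_le_hi unfolding visible_def by auto
  then show thesis using that chart_plane assms by metis
qed

lemma visible_sym: "visible x z \<longleftrightarrow> visible z x"
  by (auto simp: visible_def)

lemma sdist_sym: 
  assumes "x \<in> sheet" "z \<in> sheet"
  shows "sdist x z = sdist z x"
  using assms[THEN lo_le_hi] visible_sym[of x z] norm_minus_commute[of "plane x" "plane z"]
  by (auto simp: sdist_def visible_def)

lemma sdist_shadow:
  assumes "x \<in> sheet" "z \<in> sheet" "hi x \<le> lo z"
  shows "sdist x z = fst x + fst z + (lo z - hi x)"
proof (cases "hi x < lo z")
  case True
  then show ?thesis by (simp add: sdist_def visible_def)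
next
  case False
  then have eq: "hi x = lo z" using assms(3) by simp
  then have "visible x z" using assms(1,2)[THEN lo_le_hi] by (auto simp: visible_def)
  moreover have "cmod (plane x - plane z) = fst x + fst z"
    unfolding plane_hi[of x] plane_lo[of z] eq cmod_Complex_one_mult_cis
    using assms by (simp add: sheet_def)
  ultimately show ?thesis by (simp add: sdist_def eq)
qed

lemma sdist_zero_iff:
  assumes "x \<in> sheet" "z \<in> sheet"
  shows "sdist x z = 0 \<longleftrightarrow> x = z"
proof (cases "visible x z")
  case True
  then obtain k v w where *: "Re v \<ge> 1" "Re w \<ge> 1" "x = chart k v" "z = chart k w"
    using visible_charts assms by metis
  then have "sdist x z = cmod (v - w)" by (simp add: sdist_chart)
  moreover have "x = z \<Longrightarrow> v = w" using * plane_chart by (metis cis_neq_zero mult_right_cancel)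
  ultimately show ?thesis using * by auto
next
  case False
  then have "x \<noteq> z" using assms[THEN lo_le_hi] by (auto simp: visible_def)
  moreover have "sdist x z > 0" using False assms by (auto simp: sdist_def visible_def sheet_def)
  ultimately show ?thesis by simp
qed

lemma cmod_cis_diff_le: "cmod (cis a - cis b) \<le> \<bar>a - b\<bar>"
proof -
  have "(cmod (cis a - cis b))\<^sup>2 = (cos a)\<^sup>2 + (sin a)\<^sup>2 + ((cos b)\<^sup>2 + (sin b)\<^sup>2)
      - 2 * (cos a * cos b + sin a * sin b)"
    unfolding cmod_power2 by (simp add: power2_eq_square algebra_simps)
  also have "\<dots> = 2 - 2 * cos (a - b)" by (simp add: cos_diff)
  also have "a - b = 2 * ((a - b) / 2)" by simp
  also have "2 - 2 * cos (2 * ((a - b) / 2)) = 4 * (sin ((a - b) / 2))\<^sup>2" by (simp only: cos_double_sin) simp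
  also have "\<dots> \<le> 4 * ((a - b) / 2)\<^sup>2"
    using abs_sin_x_le_abs_x[of "(a - b) / 2"] unfolding abs_le_square_iff by simp
  also have "\<dots> = \<bar>a - b\<bar>\<^sup>2" by (simp add: power2_eq_square)
  finally show ?thesis by (rule power2_le_imp_le) simp
qed

lemma plane_lipschitz:
  assumes "x \<in> sheet" "z \<in> sheet"
  shows "cmod (plane x - plane z) \<le> sdist x z"
proof -
  have shadow: "cmod (plane x - plane z) \<le> sdist x z"
    if "x \<in> sheet" "z \<in> sheet" "hi x < lo z" for x z
  proof -
    have "plane x - plane z = (Complex 1 (- fst x) * cis (hi x) - Complex 1 0 * cis (hi x)) +
        (cis (hi x) - cis (lo z)) + (Complex 1 0 * cis (lo z) - Complex 1 (fst z) * cis (lo z))"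
      by (simp add: plane_hi[of x] plane_lo[of z] complex_eq_iff)
    also have "cmod \<dots> \<le> \<bar>- fst x - 0\<bar> + \<bar>hi x - lo z\<bar> + \<bar>0 - fst z\<bar>"
      by (intro norm_triangle_mono cmod_cis_diff_le) (simp_all only: cmod_Complex_one_mult_cis order_refl)
    also have "\<dots> = sdist x z" using that by (simp add: sdist_shadow sheet_def)
    finally show ?thesis .
  qed
  show ?thesis
  proof (cases "visible x z")
    case False
    then show ?thesis using shadow[of x z] shadow[of z x] assms sdist_sym[of x z]
        norm_minus_commute[of "plane x" "plane z"] by (auto simp: visible_def)
  qed (simp add: sdist_def)
qed

text \<open>The Busemann function of the end \<open>\<theta> \<rightarrow> - \<infinity>\<close> of the boundary line.\<close>

definition bus :: "real \<times> real \<Rightarrow> real" where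
  "bus x = lo x + fst x"

lemma bus_lipschitz_planar:
  assumes s: "0 \<le> s" "0 \<le> s'" and \<delta>: "0 \<le> \<delta>" "\<delta> \<le> 2 * arctan s"
  shows "\<bar>s' - s + \<delta>\<bar> \<le> cmod (Complex 1 s' * cis \<delta> - Complex 1 s)"
proof -
  define A where "A = s' - s + \<delta>"
  define E where "E = s * (1 - cos \<delta>) - (\<delta> - sin \<delta>)"
  define G where "G = 1 - cos \<delta> - s * sin \<delta>"
  have sc: "(sin \<delta>)\<^sup>2 + (cos \<delta>)\<^sup>2 = 1" by simp
  have "(cmod (Complex 1 s' * cis \<delta> - Complex 1 s))\<^sup>2
      = (cos \<delta> - s' * sin \<delta> - 1)\<^sup>2 + (sin \<delta> + s' * cos \<delta> - s)\<^sup>2"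
    by (simp add: cmod_power2)
  also have "\<dots> = (s' - s * cos \<delta> + sin \<delta>)\<^sup>2 + (1 - cos \<delta> - s * sin \<delta>)\<^sup>2"
    using sc by algebra
  also have "\<dots> = (A + E)\<^sup>2 + G\<^sup>2"
    by (simp add: A_def E_def G_def algebra_simps)
  finally have eq: "(cmod (Complex 1 s' * cis \<delta> - Complex 1 s))\<^sup>2 = (A + E)\<^sup>2 + G\<^sup>2" .
  have sin: "sin \<delta> \<le> \<delta>" using sin_x_le_x \<delta>(1) by simp
  have E: "0 \<le> E"
  proof -
    define h where "h = \<delta> / 2"
    have h: "0 \<le> h" "h \<le> arctan s" "h < pi / 2"
      using \<delta> arctan_ubound[of s] by (auto simp: h_def)
    define u where "u = tan h"
    have "u \<le> s"
    proof -
      have "tan h \<le> tan (arctan s)" using h arctan_ubound[of s] by (intro tan_mono_le) auto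
      then show ?thesis by (simp add: tan_arctan u_def)
    qed
    have "0 \<le> u" using h tan_gt_zero[of h] by (cases "h = 0") (auto simp: u_def)
    have hu: "h = arctan u" using h by (simp add: u_def arctan_tan)
    have ch: "cos h \<noteq> 0" using h cos_gt_zero_pi[of h] by auto
    have "u * (1 - cos \<delta>) + sin \<delta> = 2 * u * ((sin h)\<^sup>2 + (cos h)\<^sup>2)"
    proof -
      have "\<delta> = 2 * h" by (simp add: h_def)
      then have "1 - cos \<delta> = 2 * (sin h)\<^sup>2" "sin \<delta> = 2 * sin h * cos h"
        by (simp_all add: cos_double_sin sin_double)
      moreover have "sin h = u * cos h" using ch by (simp add: u_def tan_def)
      ultimately show ?thesis by algebra
    qed
    then have "u * (1 - cos \<delta>) + sin \<delta> = 2 * u" by simp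
    moreover have "2 * u \<ge> \<delta>" using arctan_le_self[OF \<open>0 \<le> u\<close>] hu by (simp add: h_def)
    moreover have "u * (1 - cos \<delta>) \<le> s * (1 - cos \<delta>)"
      using \<open>u \<le> s\<close> by (intro mult_right_mono) auto
    ultimately show ?thesis by (simp add: E_def)
  qed
  have "A\<^sup>2 \<le> (A + E)\<^sup>2 + G\<^sup>2"
  proof (cases "A \<ge> 0")
    case True
    then have "A\<^sup>2 \<le> (A + E)\<^sup>2" using E by (intro power_mono) auto
    then show ?thesis by (simp add: add_increasing2)
  next
    case False
    have "(\<delta> - s) * E \<le> A * E" using E s by (intro mult_right_mono) (auto simp: A_def)
    have "(\<delta> - s + E)\<^sup>2 + G\<^sup>2 - (\<delta> - s)\<^sup>2 = 2 - 2 * cos \<delta> - \<delta>\<^sup>2 + 2 * s * (\<delta> - sin \<delta>)"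
      using sc unfolding E_def G_def by algebra
    also have "\<dots> \<ge> 2 - 2 * cos \<delta> - \<delta>\<^sup>2 + 2 * \<delta> * (\<delta> - sin \<delta>)"
      using False s sin by (auto simp: A_def intro!: mult_right_mono)
    also have "2 - 2 * cos \<delta> - \<delta>\<^sup>2 + 2 * \<delta> * (\<delta> - sin \<delta>) = (\<delta> - sin \<delta>)\<^sup>2 + (1 - cos \<delta>)\<^sup>2"
      using sc by algebra
    finally have "0 \<le> (\<delta> - s + E)\<^sup>2 + G\<^sup>2 - (\<delta> - s)\<^sup>2"
      using order_trans[OF sum_power2_ge_zero] by blast
    then have "0 \<le> 2 * ((\<delta> - s) * E) + E\<^sup>2 + G\<^sup>2" by (simp add: power2_eq_square algebra_simps)
    then have "0 \<le> 2 * (A * E) + E\<^sup>2 + G\<^sup>2" using \<open>(\<delta> - s) * E \<le> A * E\<close> by linarith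
    then show ?thesis by (simp add: power2_eq_square algebra_simps)
  qed
  then show ?thesis unfolding eq[symmetric] A_def[symmetric]
    using abs_le_square_iff[of A "cmod (Complex 1 s' * cis \<delta> - Complex 1 s)"] by simp
qed

lemma bus_lipschitz:
  assumes "x \<in> sheet" "z \<in> sheet"
  shows "\<bar>bus x - bus z\<bar> \<le> sdist x z"
proof -
  have vis: "\<bar>bus x - bus z\<bar> \<le> sdist x z"
    if xz: "x \<in> sheet" "z \<in> sheet" "visible x z" "lo x \<le> lo z" for x z
  proof -
    have "plane z - plane x = (Complex 1 (fst z) * cis (lo z - lo x) - Complex 1 (fst x)) * cis (lo x)"
      by (simp add: plane_lo left_diff_distrib mult.assoc cis_mult)
    then have "cmod (plane x - plane z) = cmod (Complex 1 (fst z) * cis (lo z - lo x) - Complex 1 (fst x))"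
      by (metis mult.right_neutral norm_cis norm_minus_commute norm_mult)
    moreover have "lo z - lo x \<le> 2 * arctan (fst x)" 
      using xz(3) by (simp add: visible_def lo_def hi_def)
    ultimately show ?thesis
      using bus_lipschitz_planar[of "fst x" "fst z" "lo z - lo x"] xz
      by (auto simp: sheet_def bus_def sdist_def)
  qed
  have shadow: "\<bar>bus x - bus z\<bar> \<le> sdist x z"
    if xz: "x \<in> sheet" "z \<in> sheet" "hi x < lo z" for x z
    using xz arctan_le_self[of "fst x"] arctan_le_self[of "fst z"] zero_le_arctan_iff[of "fst x"]
    unfolding sdist_shadow[OF xz(1,2) less_imp_le[OF xz(3)]] bus_def lo_def hi_def sheet_def mem_Collect_eq
    by linarith
  show ?thesis
  proof (cases "visible x z")
    case True
    then show ?thesis using vis[of x z] vis[of z x] assms sdist_sym[of x z] visible_sym[of x z] by linarith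
  next
    case False
    then show ?thesis using shadow[of x z] shadow[of z x] assms sdist_sym[of x z]
      by (auto simp: visible_def)
  qed
qed

text \<open>The points \<open>Complex 1 (B - q) * cis q\<close> form an involute of the circle, whose velocity points
  away from every point that sees the foot \<open>cis q\<close> of the tangent.\<close>

lemma involute_mono:
  assumes "x \<in> sheet" "lo x \<le> q" "q \<le> q1" "q1 \<le> hi x" "q1 \<le> B"
  shows "cmod (plane x - Complex 1 (B - q) * cis q) \<le> cmod (plane x - Complex 1 (B - q1) * cis q1)"
proof -
  define t where "t = sqrt (1 + (fst x)\<^sup>2)"
  define \<theta> where "\<theta> = snd x"
  define f where "f p = t\<^sup>2 + 1 + (B - p)\<^sup>2 - 2 * (t * cos (\<theta> - p) + (B - p) * (t * sin (\<theta> - p)))" for p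
  have f: "(cmod (plane x - Complex 1 (B - p) * cis p))\<^sup>2 = f p" for p
  proof -
    have "(cmod (plane x - Complex 1 (B - p) * cis p))\<^sup>2 =
        t\<^sup>2 * ((sin \<theta>)\<^sup>2 + (cos \<theta>)\<^sup>2) + (1 + (B - p)\<^sup>2) * ((sin p)\<^sup>2 + (cos p)\<^sup>2) -
        2 * (t * (cos \<theta> * cos p + sin \<theta> * sin p) + (B - p) * (t * (sin \<theta> * cos p - cos \<theta> * sin p)))"
      unfolding cmod_power2 plane_def t_def[symmetric] \<theta>_def[symmetric]
      by (simp add: power2_eq_square) algebra
    then show ?thesis by (simp add: f_def cos_diff sin_diff)
  qed
  have "f q \<le> f q1"
  proof (rule DERIV_nonneg_imp_nondecreasing[OF assms(3)])
    fix p assume p: "q \<le> p" "p \<le> q1"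
    have "(f has_real_derivative 2 * (B - p) * (t * cos (\<theta> - p) - 1)) (at p)"
      unfolding f_def by (auto intro!: derivative_eq_intros simp: algebra_simps)
    moreover have "t * cos (\<theta> - p) \<ge> 1"
      unfolding t_def using p assms by (intro sqrt_cos_ge_one) (auto simp: \<theta>_def lo_def hi_def)
    then have "2 * (B - p) * (t * cos (\<theta> - p) - 1) \<ge> 0" using p assms by simp
    ultimately show "\<exists>y. (f has_real_derivative y) (at p) \<and> 0 \<le> y" by blast
  qed
  then have "(cmod (plane x - Complex 1 (B - q) * cis q))\<^sup>2 \<le> (cmod (plane x - Complex 1 (B - q1) * cis q1))\<^sup>2"
    unfolding f .
  then show ?thesis by (rule power2_le_imp_le) simp
qed

definition mirror :: "real \<times> real \<Rightarrow> real \<times> real" where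
  "mirror x = (fst x, - snd x)"

lemma mirror_simps [simp]: "mirror (mirror x) = x" "mirror x \<in> sheet \<longleftrightarrow> x \<in> sheet" "fst (mirror x) = fst x"
  "lo (mirror x) = - hi x" "hi (mirror x) = - lo x" "plane (mirror x) = cnj (plane x)"
  "visible (mirror x) (mirror z) \<longleftrightarrow> visible x z"
  by (auto simp: mirror_def sheet_def lo_def hi_def plane_def cis_cnj visible_def)

lemma sdist_mirror [simp]: 
  assumes "x \<in> sheet" "z \<in> sheet"
  shows "sdist (mirror x) (mirror z) = sdist x z"
proof -
  have "cmod (cnj (plane x) - cnj (plane z)) = cmod (plane x - plane z)"
    by (metis complex_cnj_diff complex_mod_cnj)
  then show ?thesis using assms[THEN lo_le_hi] by (auto simp: sdist_def visible_def)
qed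

text \<open>\<open>develop_from y\<close> develops the visible part into the plane and unrolls everything else onto
  the two tangents at \<open>y\<close>.\<close>

definition develop_from :: "real \<times> real \<Rightarrow> real \<times> real \<Rightarrow> complex" where
  "develop_from y x =
     (if visible x y then plane x - plane y
      else if hi y < lo x then of_real (sdist x y) * (\<i> * cis (hi y))
      else of_real (sdist x y) * (- \<i> * cis (lo y)))"

lemma sdist_nonneg: "x \<in> sheet \<Longrightarrow> y \<in> sheet \<Longrightarrow> 0 \<le> sdist x y"
  using bus_lipschitz[of x y] by linarith

lemma cmod_develop_from:
  assumes "x \<in> sheet" "y \<in> sheet"
  shows "cmod (develop_from y x) = sdist x y"
proof -
  have "visible x y \<Longrightarrow> sdist x y = cmod (plane x - plane y)" by (simp add: sdist_def)
  then show ?thesis using sdist_nonneg[OF assms] by (auto simp: develop_from_def norm_mult)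
qed

lemma Complex_one_diff: "Complex 1 a * cis k - Complex 1 b * cis k = of_real (a - b) * (\<i> * cis k)"
  by (simp add: complex_eq_iff algebra_simps)

lemma develop_from_right:
  assumes "x \<in> sheet" "y \<in> sheet" "hi y \<le> lo x"
  shows "develop_from y x = of_real (sdist x y) * (\<i> * cis (hi y))"
proof (cases "visible x y")
  case True
  then have eq: "lo x = hi y" using assms(3) by (simp add: visible_def)
  have "sdist x y = fst x + fst y"
    using sdist_shadow[OF assms(2,1)] sdist_sym[of x y] assms eq by simp
  moreover have "plane x - plane y = of_real (fst x + fst y) * (\<i> * cis (hi y))"
    unfolding plane_lo[of x] plane_hi[of y] eq Complex_one_diff by simp
  ultimately show ?thesis using True by (simp add: develop_from_def)
next
  case False
  moreover from this have "hi y < lo x" using assms lo_le_hi[of x] lo_le_hi[of y] by (auto simp: visible_def)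
  ultimately show ?thesis by (simp add: develop_from_def)
qed

lemma develop_from_mirror:
  assumes "x \<in> sheet" "y \<in> sheet"
  shows "develop_from (mirror y) (mirror x) = cnj (develop_from y x)"
  using assms[THEN lo_le_hi] assms by (auto simp: develop_from_def visible_def cis_cnj)

lemma develop_from_left:
  assumes "x \<in> sheet" "y \<in> sheet" "hi x \<le> lo y"
  shows "develop_from y x = of_real (sdist x y) * (- \<i> * cis (lo y))"
proof -
  have "cnj (develop_from y x) = of_real (sdist x y) * (\<i> * cis (- lo y))"
    using develop_from_right[of "mirror x" "mirror y"] develop_from_mirror[of x y] assms by simp
  then have "cnj (cnj (develop_from y x)) = cnj (of_real (sdist x y) * (\<i> * cis (- lo y)))" by simp
  then show ?thesis by (simp add: cis_cnj)
qed

lemma develop_from_lipschitz_visible_right: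
  assumes "x \<in> sheet" "y \<in> sheet" "z \<in> sheet" "visible x y" "hi y < lo z"
  shows "cmod (develop_from y x - develop_from y z) \<le> sdist x z"
proof -
  define q where "q = hi y"
  have qx: "lo x \<le> q" using assms(4) by (simp add: q_def visible_def)
  have qz: "q < lo z" using assms(5) by (simp add: q_def)
  have zs: "0 \<le> fst z" "lo z \<le> hi z" using assms(3) lo_le_hi by (auto simp: sheet_def)
  have "sdist z y = fst y + (bus z - q)"
    using sdist_shadow[of y z] sdist_sym[of y z] assms by (simp add: q_def bus_def)
  then have "develop_from y z = of_real (fst y + (bus z - q)) * (\<i> * cis q)"
    using develop_from_right[of z y] assms by (simp add: q_def)
  also have "\<dots> = Complex 1 (bus z - q) * cis q - plane y"
    unfolding plane_hi q_def[symmetric] Complex_one_diff by (simp add: algebra_simps)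
  finally have eq: "develop_from y x - develop_from y z = plane x - Complex 1 (bus z - q) * cis q"
    using assms(4) by (simp add: develop_from_def)
  have "cmod (plane x - Complex 1 (bus z - q) * cis q) \<le> sdist x z"
  proof (cases "hi x \<le> q")
    case True
    define v where "v = (bus z - q, q + arctan (bus z - q))"
    have v: "lo v = q" "fst v = bus z - q" "v \<in> sheet"
      using qz zs by (auto simp: v_def lo_def sheet_def bus_def)
    have "cmod (plane x - plane v) \<le> sdist x v" using plane_lipschitz assms v by blast
    also have "sdist x v = fst x + fst v + (lo v - hi x)"
      using sdist_shadow[of x v] assms v True by simp
    also have "\<dots> = fst x + fst z + (lo z - hi x)" using v by (simp add: bus_def)
    also have "\<dots> = sdist x z"
      using sdist_shadow[of x z] assms True qz by simp
    finally show ?thesis using plane_lo[of v] v by simp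
  next
    case False
    define q1 where "q1 = min (hi x) (lo z)"
    have "cmod (plane x - Complex 1 (bus z - q) * cis q) \<le> cmod (plane x - Complex 1 (bus z - q1) * cis q1)"
      using assms qx qz zs False by (intro involute_mono) (auto simp: q1_def bus_def)
    also have "\<dots> = sdist x z"
    proof (cases "hi x \<le> lo z")
      case True
      then have "q1 = hi x" by (simp add: q1_def)
      then have "cmod (plane x - Complex 1 (bus z - q1) * cis q1) = \<bar>- fst x - (bus z - hi x)\<bar>"
        unfolding plane_hi by (simp only: cmod_Complex_one_mult_cis)
      also have "\<dots> = sdist x z" 
        using sdist_shadow[of x z] True assms zs by (simp add: bus_def sheet_def)
      finally show ?thesis .
    next
      case False
      then have "q1 = lo z" by (simp add: q1_def)
      moreover have "visible x z" using False qx qz zs by (simp add: visible_def)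
      ultimately show ?thesis using plane_lo[of z] by (simp add: sdist_def bus_def)
    qed
    finally show ?thesis .
  qed
  then show ?thesis unfolding eq .
qed

lemma develop_from_lipschitz_left_right:
  assumes "x \<in> sheet" "y \<in> sheet" "z \<in> sheet" "hi x < lo y" "hi y < lo z"
  shows "cmod (develop_from y x - develop_from y z) \<le> sdist x z"
proof -
  have y: "lo y \<le> hi y" using assms lo_le_hi by blast
  have "sdist x y = fst x + fst y + (lo y - hi x)" using sdist_shadow assms by simp
  then have x: "develop_from y x = Complex 1 (hi x - lo y - fst x) * cis (lo y) - plane y"
    unfolding develop_from_left[OF assms(1,2) less_imp_le[OF assms(4)]] plane_lo[of y] Complex_one_diff
    by (simp del: of_real_diff of_real_add) (simp add: algebra_simps)
  have "sdist z y = fst y + fst z + (lo z - hi y)" using sdist_shadow[of y z] sdist_sym[of y z] assms by simp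
  then have z: "develop_from y z = Complex 1 (lo z - hi y + fst z) * cis (hi y) - plane y"
    unfolding develop_from_right[OF assms(3,2) less_imp_le[OF assms(5)]] plane_hi[of y] Complex_one_diff
    by (simp del: of_real_diff of_real_add)
  have "develop_from y x - develop_from y z =
      (Complex 1 (hi x - lo y - fst x) * cis (lo y) - Complex 1 0 * cis (lo y)) + (cis (lo y) - cis (hi y)) +
      (Complex 1 0 * cis (hi y) - Complex 1 (lo z - hi y + fst z) * cis (hi y))"
    unfolding x z by (simp add: complex_eq_iff)
  also have "cmod \<dots> \<le> \<bar>hi x - lo y - fst x - 0\<bar> + \<bar>lo y - hi y\<bar> + \<bar>0 - (lo z - hi y + fst z)\<bar>"
    by (intro norm_triangle_mono cmod_cis_diff_le) (simp_all only: cmod_Complex_one_mult_cis order_refl)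
  also have "\<dots> = sdist x z"
    using assms y sdist_shadow[of x z] by (simp add: sheet_def)
  finally show ?thesis .
qed

lemma develop_from_lipschitz_right:
  assumes "x \<in> sheet" "y \<in> sheet" "z \<in> sheet" "hi y < lo z"
  shows "cmod (develop_from y x - develop_from y z) \<le> sdist x z"
proof -
  consider "visible x y" | "hi x < lo y" | "hi y < lo x"
    using assms(1-3)[THEN lo_le_hi] unfolding visible_def by linarith
  then show ?thesis
  proof cases
    case 3
    have "sdist x y - sdist z y = bus x - bus z"
      using sdist_shadow[of y z] sdist_shadow[of y x] sdist_sym[of y] assms 3 by (simp add: bus_def)
    moreover have "develop_from y x - develop_from y z = of_real (sdist x y - sdist z y) * (\<i> * cis (hi y))"
      using develop_from_right[of z y] develop_from_right[of x y] assms 3 by (simp add: algebra_simps)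
    ultimately show ?thesis using bus_lipschitz[of x z] assms
      by (simp add: norm_mult del: of_real_diff)
  qed (use assms develop_from_lipschitz_visible_right develop_from_lipschitz_left_right in auto)
qed

lemma develop_from_lipschitz:
  assumes "x \<in> sheet" "y \<in> sheet" "z \<in> sheet"
  shows "cmod (develop_from y x - develop_from y z) \<le> sdist x z"
proof -
  have right: "cmod (develop_from y x - develop_from y z) \<le> sdist x z"
    if "x \<in> sheet" "y \<in> sheet" "z \<in> sheet" "hi y < lo z \<or> hi y < lo x" for x y z
    using that develop_from_lipschitz_right[of x y z] develop_from_lipschitz_right[of z y x]
      sdist_sym[of x z] norm_minus_commute[of "develop_from y x"] by auto
  consider "visible x y" "visible z y" | "hi y < lo z \<or> hi y < lo x" | "hi x < lo y \<or> hi z < lo y"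
    using assms[THEN lo_le_hi] unfolding visible_def by linarith
  then show ?thesis
  proof cases
    case 1
    then show ?thesis using plane_lipschitz[of x z] assms by (simp add: develop_from_def)
  next
    case 2
    then show ?thesis using right assms by blast
  next
    case 3
    then have "cmod (develop_from (mirror y) (mirror x) - develop_from (mirror y) (mirror z)) \<le> sdist (mirror x) (mirror z)"
      using assms by (intro right) auto
    then have "cmod (cnj (develop_from y x - develop_from y z)) \<le> sdist x z"
      using assms by (simp add: develop_from_mirror)
    then show ?thesis by (simp only: complex_mod_cnj)
  qed
qed

lemma foot_points:
  assumes "0 \<le> s"
  shows "(s, k + arctan s) \<in> sheet" "lo (s, k + arctan s) = k"
    "(s, k - arctan s) \<in> sheet" "hi (s, k - arctan s) = k"
  using assms by (auto simp: sheet_def lo_def hi_def)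

lemma sheet_geodesic_point:
  assumes "a \<in> sheet" "b \<in> sheet" "0 \<le> t" "t \<le> 1"
  shows "\<exists>y\<in>sheet. \<exists>w. cmod w = sdist a b \<and>
    develop_from y a = of_real t * w \<and> develop_from y b = - (of_real (1 - t) * w)"
proof -
  have shadow: "\<exists>y\<in>sheet. \<exists>w. cmod w = sdist a b \<and>
      develop_from y a = of_real t * w \<and> develop_from y b = - (of_real (1 - t) * w)"
    if ab: "a \<in> sheet" "b \<in> sheet" "0 \<le> t" "t \<le> 1" "hi a < lo b" for a b t
  proof -
    define D where "D = sdist a b"
    have D: "D = fst a + fst b + (lo b - hi a)" using sdist_shadow[of a b] ab by (simp add: D_def)
    have pos: "0 \<le> fst a" "0 \<le> fst b" using ab by (auto simp: sheet_def)
    have D0: "0 \<le> D" using D pos ab by simp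
    define \<tau> where "\<tau> = t * D"
    have \<tau>: "0 \<le> \<tau>" "\<tau> \<le> D" using D0 ab by (auto simp: \<tau>_def mult_left_le_one_le)
    have t: "t * D = \<tau>" "(1 - t) * D = D - \<tau>" by (auto simp: \<tau>_def left_diff_distrib)
    have suff: ?thesis if y: "y \<in> sheet" and c: "cmod c = 1" and "develop_from y a = - (of_real \<tau> * c)"
      "develop_from y b = of_real (D - \<tau>) * c" for y c
    proof (intro bexI[of _ y] exI[of _ "- (of_real D * c)"] conjI)
      show "cmod (- (of_real D * c)) = sdist a b" using c D0 by (simp add: norm_mult D_def)
      show "develop_from y a = of_real t * - (of_real D * c)"
        using that(3) t(1) by (simp add: mult.assoc[symmetric] flip: of_real_mult)
      show "develop_from y b = - (of_real (1 - t) * - (of_real D * c))"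
        using that(4) t(2) by (simp add: mult.assoc[symmetric] del: of_real_diff flip: of_real_mult)
    qed (rule y)
    consider "\<tau> \<le> fst a" | "fst a \<le> \<tau>" "\<tau> \<le> D - fst b" | "D - fst b \<le> \<tau>" by linarith
    then show ?thesis
    proof cases
      case 1
      define y where "y = (fst a - \<tau>, hi a - arctan (fst a - \<tau>))"
      have y: "y \<in> sheet" "hi y = hi a" "fst y = fst a - \<tau>"
        using foot_points(3,4)[of "fst a - \<tau>" "hi a"] 1 by (auto simp: y_def)
      show ?thesis
      proof (rule suff[OF y(1)])
        show "cmod (\<i> * cis (hi a)) = 1" by (simp add: norm_mult)
        have "visible a y" using lo_le_hi[OF ab(1)] lo_le_hi[OF y(1)] y(2) by (simp add: visible_def)
        then show "develop_from y a = - (of_real \<tau> * (\<i> * cis (hi a)))"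
          unfolding develop_from_def plane_hi y Complex_one_diff by simp
        show "develop_from y b = of_real (D - \<tau>) * (\<i> * cis (hi a))"
          using develop_from_right[of b y] sdist_shadow[of y b] sdist_sym[of y b] ab y D by simp
      qed
    next
      case 2
      define y where "y = (0::real, hi a + (\<tau> - fst a))"
      have y: "y \<in> sheet" "hi y = hi a + (\<tau> - fst a)" "lo y = hi y" "fst y = 0"
        by (auto simp: y_def sheet_def lo_def hi_def)
      show ?thesis
      proof (rule suff[OF y(1)])
        show "cmod (\<i> * cis (hi y)) = 1" by (simp add: norm_mult)
        show "develop_from y a = - (of_real \<tau> * (\<i> * cis (hi y)))"
          using develop_from_left[of a y] sdist_shadow[of a y] ab y 2 by simp
        show "develop_from y b = of_real (D - \<tau>) * (\<i> * cis (hi y))"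
          using develop_from_right[of b y] sdist_shadow[of y b] sdist_sym[of y b] ab y D 2 by simp
      qed
    next
      case 3
      define s where "s = \<tau> - (D - fst b)"
      define y where "y = (s, lo b + arctan s)"
      have y: "y \<in> sheet" "lo y = lo b" "fst y = s"
        using foot_points(1,2)[of s "lo b"] 3 by (auto simp: y_def s_def)
      show ?thesis
      proof (rule suff[OF y(1)])
        show "cmod (\<i> * cis (lo b)) = 1" by (simp add: norm_mult)
        have "visible b y" using lo_le_hi[OF ab(2)] lo_le_hi[OF y(1)] y(2) by (simp add: visible_def)
        then show "develop_from y b = of_real (D - \<tau>) * (\<i> * cis (lo b))"
          unfolding develop_from_def plane_lo y Complex_one_diff by (simp add: s_def algebra_simps)
        show "develop_from y a = - (of_real \<tau> * (\<i> * cis (lo b)))"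
          using develop_from_left[of a y] sdist_shadow[of a y] ab y D by (simp add: s_def)
      qed
    qed
  qed
  consider "visible a b" | "hi a < lo b" | "hi b < lo a" using assms unfolding visible_def by linarith
  then show ?thesis
  proof cases
    case 1
    then obtain k v w where *: "Re v \<ge> 1" "Re w \<ge> 1" "a = chart k v" "b = chart k w"
      using visible_charts assms by metis
    define u where "u = of_real (1 - t) * v + of_real t * w"
    have "(1 - t) * 1 + t * 1 \<le> (1 - t) * Re v + t * Re w"
      using assms * by (intro add_mono mult_left_mono) auto
    then have u: "Re u \<ge> 1" by (simp add: u_def del: of_real_diff)
    show ?thesis
    proof (intro bexI[of _ "chart k u"] exI[of _ "(v - w) * cis k"] conjI)
      show "cmod ((v - w) * cis k) = sdist a b" using * by (simp add: sdist_chart norm_mult)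
      show "develop_from (chart k u) a = of_real t * ((v - w) * cis k)"
        "develop_from (chart k u) b = - (of_real (1 - t) * ((v - w) * cis k))"
        using * u by (simp_all add: develop_from_def visible_chart plane_chart u_def algebra_simps)
    qed (use u chart_in_sheet in auto)
  next
    case 2
    then show ?thesis using shadow assms by blast
  next
    case 3
    then obtain y w where yw: "y \<in> sheet" "cmod w = sdist b a"
        "develop_from y b = of_real (1 - t) * w" "develop_from y a = - (of_real (1 - (1 - t)) * w)"
      using shadow[of b a "1 - t"] assms by auto
    show ?thesis
    proof (intro bexI[of _ y] exI[of _ "- w"] conjI)
      show "cmod (- w) = sdist a b" using yw sdist_sym assms by simp
    qed (use yw in auto)
  qed
qed

interpretation sheet: developing_space sheet sdist
proof
  fix a b :: "real \<times> real" and t :: real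
  assume ab: "a \<in> sheet" "b \<in> sheet" and t: "0 \<le> t" "t \<le> 1"
  obtain y w where "y \<in> sheet" "cmod w = sdist a b"
    "develop_from y a = of_real t * w" "develop_from y b = - (of_real (1 - t) * w)"
    using sheet_geodesic_point[OF ab t] by blast
  then show "\<exists>y\<in>sheet. \<exists>L :: real \<times> real \<Rightarrow> complex. \<exists>w. (\<forall>x\<in>sheet. cmod (L x) = sdist x y) \<and>
      (\<forall>x\<in>sheet. \<forall>z\<in>sheet. cmod (L x - L z) \<le> sdist x z) \<and>
      cmod w = sdist a b \<and> L a = of_real t * w \<and> L b = - (of_real (1 - t) * w)"
    using cmod_develop_from develop_from_lipschitz by (intro bexI[of _ y] exI[of _ "develop_from y"] exI[of _ w]) auto
qed (use sdist_sym sdist_zero_iff in auto)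

section \<open>Attaching rays\<close>

locale hairy = developing_space M d for M :: "(real \<times> real) set" and d +
  fixes p :: "nat \<Rightarrow> real \<times> real"
  assumes p_in: "p n \<in> M"
begin

text \<open>Points \<open>(0, x)\<close> belong to \<open>M\<close>; the point \<open>(Suc n, h, 0)\<close> lies at height \<open>h > 0\<close> on the ray
  attached at \<open>p n\<close>.\<close>

definition H :: "pt set" where
  "H = {x. if fst x = 0 then snd x \<in> M else 0 < fst (snd x) \<and> snd (snd x) = 0}"

definition base :: "pt \<Rightarrow> real \<times> real" where
  "base x = (if fst x = 0 then snd x else p (fst x - 1))"

definition height :: "pt \<Rightarrow> real" where
  "height x = (if fst x = 0 then 0 else fst (snd x))"

definition hdist :: "pt \<Rightarrow> pt \<Rightarrow> real" where
  "hdist x y = (if fst x = fst y \<and> fst x \<noteq> 0 then \<bar>height x - height y\<bar>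
     else height x + height y + d (base x) (base y))"

lemma base_in: "x \<in> H \<Longrightarrow> base x \<in> M"
  by (simp add: H_def base_def p_in split: if_splits)

lemma height_nonneg: "x \<in> H \<Longrightarrow> 0 \<le> height x"
  by (auto simp: H_def height_def split: if_splits)

lemma height_pos_iff: "x \<in> H \<Longrightarrow> 0 < height x \<longleftrightarrow> fst x \<noteq> 0"
  by (auto simp: H_def height_def split: if_splits)

lemma base_zero [simp]: "base (0, x) = x" "height (0, x) = 0"
  and base_Suc [simp]: "base (Suc n, h, c) = p n" "height (Suc n, h, c) = h"
  and in_H [simp]: "(0, x) \<in> H \<longleftrightarrow> x \<in> M" "(Suc n, h, c) \<in> H \<longleftrightarrow> 0 < h \<and> c = 0"
  by (auto simp: base_def height_def H_def)

lemma same_base: "fst x = fst y \<Longrightarrow> fst x \<noteq> 0 \<Longrightarrow> base x = base y"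
  by (simp add: base_def)

lemma hdist_nonneg:
  assumes "x \<in> H" "y \<in> H"
  shows "0 \<le> hdist x y"
  using nonneg[OF assms[THEN base_in]] height_nonneg[OF assms(1)] height_nonneg[OF assms(2)]
  by (simp add: hdist_def)

lemma hdist_sym: "x \<in> H \<Longrightarrow> y \<in> H \<Longrightarrow> hdist x y = hdist y x"
  using sym base_in by (auto simp: hdist_def)

lemma hdist_zero_iff:
  assumes "x \<in> H" "y \<in> H"
  shows "hdist x y = 0 \<longleftrightarrow> x = y"
proof (cases "fst x = fst y \<and> fst x \<noteq> 0")
  case True
  then show ?thesis using assms by (auto simp: hdist_def height_def H_def prod_eq_iff)
next
  case False
  have d: "0 \<le> d (base x) (base y)" "d (base x) (base y) = 0 \<longleftrightarrow> base x = base y"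
    using nonneg zero assms base_in by auto
  have "hdist x y = 0 \<longleftrightarrow> height x = 0 \<and> height y = 0 \<and> base x = base y"
    using False d height_nonneg[OF assms(1)] height_nonneg[OF assms(2)] by (auto simp: hdist_def)
  also have "\<dots> \<longleftrightarrow> x = y"
    using False assms by (auto simp: height_def base_def H_def prod_eq_iff split: if_splits)
  finally show ?thesis .
qed

lemma develop_hair:
  assumes "y \<in> H" "fst y \<noteq> 0"
  obtains L :: "pt \<Rightarrow> complex" where "\<forall>x\<in>H. cmod (L x) = hdist x y"
    "\<forall>x\<in>H. \<forall>z\<in>H. cmod (L x - L z) \<le> hdist x z"
    "\<And>x. L x = of_real (if fst x = fst y then height x - height y else - hdist x y)"
proof
  let ?l = "\<lambda>x. if fst x = fst y then height x - height y else - hdist x y"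
  have y: "base y \<in> M" "0 \<le> height y" using assms base_in height_nonneg by auto
  show "\<forall>x\<in>H. cmod (of_real (?l x)) = hdist x y"
  proof
    fix x assume x: "x \<in> H"
    show "cmod (of_real (?l x)) = hdist x y"
      unfolding norm_of_real using assms(2) hdist_nonneg[OF x assms(1)] by (cases "fst x = fst y") (simp_all add: hdist_def)
  qed
  have "\<bar>?l x - ?l z\<bar> \<le> hdist x z" if xz: "x \<in> H" "z \<in> H" for x z
  proof -
    have b: "base x \<in> M" "base z \<in> M" "0 \<le> height x" "0 \<le> height z"
      using xz base_in height_nonneg by auto
    have tri: "d (base x) (base y) \<le> d (base x) (base z) + d (base z) (base y)"
      "d (base z) (base y) \<le> d (base x) (base z) + d (base x) (base y)"
      using triangle[of "base x" "base z" "base y"] triangle[of "base z" "base x" "base y"]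
        sym[of "base x" "base z"] y b by simp_all
    have "0 \<le> d (base x) (base y)" "0 \<le> d (base z) (base y)" "d (base y) (base z) = d (base z) (base y)"
      "d (base y) (base x) = d (base x) (base y)"
      using nonneg sym y b by auto
    moreover have "base x = base y" if "fst x = fst y" using same_base that assms by metis
    moreover have "base z = base y" if "fst z = fst y" using same_base that assms by metis
    moreover have "base x = base z" if "fst x = fst z" "fst z \<noteq> 0" using same_base that by metis
    ultimately show ?thesis using tri b y assms(2) by (auto simp: hdist_def)
  qed
  then show "\<forall>x\<in>H. \<forall>z\<in>H. cmod (of_real (?l x) - of_real (?l z)) \<le> hdist x z"
    by (simp del: of_real_diff of_real_minus flip: of_real_diff)
qed simp

lemma (in -) norm_diff_triangle3: "norm (a - d) \<le> norm (a - b) + norm (b - c) + norm (c - d)"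
  for a b c d :: "'a :: real_normed_vector"
  using norm_triangle_ineq[of "a - b" "b - c"] norm_triangle_ineq[of "a - c" "c - d"] by simp

lemma develop_base:
  fixes L0 :: "real \<times> real \<Rightarrow> complex"
  assumes y: "y \<in> M" and L0: "\<forall>x\<in>M. cmod (L0 x) = d x y" "\<forall>x\<in>M. \<forall>z\<in>M. cmod (L0 x - L0 z) \<le> d x z"
    and e: "cmod e = 1"
  obtains L :: "pt \<Rightarrow> complex" where "\<forall>x\<in>H. cmod (L x) = hdist x (0, y)"
    "\<forall>x\<in>H. \<forall>z\<in>H. cmod (L x - L z) \<le> hdist x z"
    "\<And>x. x \<in> H \<Longrightarrow> base x \<noteq> y \<Longrightarrow> L x = of_real (1 + height x / d (base x) y) * L0 (base x)"
    "\<And>x. base x = y \<Longrightarrow> L x = of_real (if fst x = k then height x else - height x) * e"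
proof
  let ?L = "\<lambda>x. if base x = y then of_real (if fst x = k then height x else - height x) * e
    else of_real (1 + height x / d (base x) y) * L0 (base x)"
  have L0y: "L0 y = 0" using L0(1) y zero[of y y] by auto
  have pos: "0 < d (base x) y" if "x \<in> H" "base x \<noteq> y" for x
    using nonneg[of "base x" y] zero[of "base x" y] base_in[OF that(1)] y that(2) by linarith
  show "\<forall>x\<in>H. cmod (?L x) = hdist x (0, y)"
  proof
    fix x assume x: "x \<in> H"
    have h: "0 \<le> height x" using x height_nonneg by blast
    show "cmod (?L x) = hdist x (0, y)"
    proof (cases "base x = y")
      case True
      then show ?thesis using h e zero[of y y] y by (simp add: norm_mult hdist_def del: of_real_minus)
    next
      case False
      have "cmod (?L x) = (1 + height x / d (base x) y) * d (base x) y"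
        using False h pos[OF x False] L0(1) base_in[OF x]
        by (simp add: norm_mult del: of_real_add of_real_divide)
      also have "\<dots> = hdist x (0, y)" using pos[OF x False] by (simp add: hdist_def field_simps)
      finally show ?thesis .
    qed
  qed
  have off: "cmod (?L x - L0 (base x)) = height x" if x: "x \<in> H" for x
  proof (cases "base x = y")
    case True
    then show ?thesis using e L0y height_nonneg[OF x] by (simp add: norm_mult del: of_real_minus)
  next
    case False
    have "?L x - L0 (base x) = of_real (height x / d (base x) y) * L0 (base x)"
      using False by (simp add: algebra_simps)
    then show ?thesis
      using pos[OF x False] L0(1) base_in[OF x] height_nonneg[OF x]
      by (simp add: norm_mult del: of_real_divide)
  qed
  have "cmod (?L x - ?L z) \<le> hdist x z" if xz: "x \<in> H" "z \<in> H" for x z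
  proof (cases "fst x = fst z \<and> fst x \<noteq> 0")
    case True
    then have b: "base x = base z" using same_base by blast
    show ?thesis
    proof (cases "base x = y")
      case True': True
      have "?L x - ?L z = of_real (if fst x = k then height x - height z else height z - height x) * e"
        using True True' b by (simp add: algebra_simps)
      then show ?thesis using True e abs_minus_commute[of "height x" "height z"]
        by (simp add: norm_mult hdist_def del: of_real_diff)
    next
      case False
      have "?L x - ?L z = of_real ((height x - height z) / d (base x) y) * L0 (base x)"
        using False b by (simp add: algebra_simps diff_divide_distrib)
      then have "cmod (?L x - ?L z) = \<bar>height x - height z\<bar>"
        using pos[OF xz(1) False] L0(1) base_in[OF xz(1)] by (simp add: norm_mult del: of_real_diff of_real_divide)
      then show ?thesis using True by (simp add: hdist_def)
    qed
  next
    case False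
    have "cmod (?L x - ?L z) \<le> cmod (?L x - L0 (base x)) + cmod (L0 (base x) - L0 (base z)) + cmod (L0 (base z) - ?L z)"
      by (rule norm_diff_triangle3)
    also have "cmod (L0 (base z) - ?L z) = height z" using off[OF xz(2)] by (simp only: norm_minus_commute)
    also have "cmod (?L x - L0 (base x)) = height x" by (rule off[OF xz(1)])
    also have "height x + cmod (L0 (base x) - L0 (base z)) + height z \<le> height x + d (base x) (base z) + height z"
      using L0(2) base_in xz by (intro add_mono order_refl) blast
    also have "height x + d (base x) (base z) + height z = hdist x z" using False by (auto simp: hdist_def)
    finally show ?thesis .
  qed
  then show "\<forall>x\<in>H. \<forall>z\<in>H. cmod (?L x - ?L z) \<le> hdist x z" by blast
  show "base x \<noteq> y \<Longrightarrow> ?L x = of_real (1 + height x / d (base x) y) * L0 (base x)" for x by simp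
  show "base x = y \<Longrightarrow> ?L x = of_real (if fst x = k then height x else - height x) * e" for x by simp
qed

abbreviation develops :: "pt \<Rightarrow> pt \<Rightarrow> real \<Rightarrow> pt \<Rightarrow> (pt \<Rightarrow> complex) \<Rightarrow> complex \<Rightarrow> bool" where
  "develops a b t y L w \<equiv> (\<forall>x\<in>H. cmod (L x) = hdist x y) \<and>
        (\<forall>x\<in>H. \<forall>z\<in>H. cmod (L x - L z) \<le> hdist x z) \<and>
        cmod w = hdist a b \<and> L a = of_real t * w \<and> L b = - (of_real (1 - t) * w)"

lemma hairy_develop_same:
  assumes ab: "a \<in> H" "b \<in> H" "fst a = fst b" "fst a \<noteq> 0" and t: "0 \<le> t" "t \<le> 1"
  shows "\<exists>y\<in>H. \<exists>L w. develops a b t y L w"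
proof -
  define h where "h = (1 - t) * height a + t * height b"
  define y where "y = (fst a, h, 0::real)"
  have pos: "0 < height a" "0 < height b" using ab height_pos_iff by auto
  have "0 < h"
  proof (cases "t = 0")
    case False
    then have "0 < t * height b" "0 \<le> (1 - t) * height a" using pos t by auto
    then show ?thesis by (simp add: h_def)
  qed (use pos in \<open>simp add: h_def\<close>)
  then have y: "y \<in> H" "fst y \<noteq> 0" "height y = h" using ab(4) by (auto simp: y_def H_def height_def)
  obtain L :: "pt \<Rightarrow> complex" where L: "\<forall>x\<in>H. cmod (L x) = hdist x y"
    "\<forall>x\<in>H. \<forall>z\<in>H. cmod (L x - L z) \<le> hdist x z"
    "\<And>x. L x = of_real (if fst x = fst y then height x - height y else - hdist x y)"
    using develop_hair[OF y(1,2)] by blast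
  have "L a = of_real (height a - h)" "L b = of_real (height b - h)"
    using L(3)[of a] L(3)[of b] ab y by (simp_all add: y_def)
  then have "L a = of_real t * of_real (height a - height b)"
    "L b = - (of_real (1 - t) * of_real (height a - height b))"
    by (simp_all add: h_def algebra_simps)
  moreover have "cmod (of_real (height a - height b)) = hdist a b"
    using ab by (simp add: hdist_def del: of_real_diff)
  ultimately show ?thesis using L y(1) by blast
qed

lemma hairy_develop_hair:
  assumes ab: "a \<in> H" "b \<in> H" "\<not> (fst a = fst b \<and> fst a \<noteq> 0)" and t: "0 \<le> t" "t * hdist a b < height a"
  shows "\<exists>y\<in>H. \<exists>L w. develops a b t y L w"
proof -
  define D where "D = hdist a b"
  have D: "D = height a + height b + d (base a) (base b)" using ab by (auto simp: D_def hdist_def)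
  have D0: "0 \<le> D" using D nonneg base_in height_nonneg ab by simp
  define y where "y = (fst a, height a - t * D, 0::real)"
  have "0 < height a" using t D0 unfolding D_def[symmetric]
    by (meson le_less_trans mult_nonneg_nonneg)
  then have fa: "fst a \<noteq> 0" using ab height_pos_iff by blast
  have y: "y \<in> H" "fst y = fst a" "height y = height a - t * D"
    using t fa by (auto simp: y_def H_def height_def D_def)
  obtain L :: "pt \<Rightarrow> complex" where L: "\<forall>x\<in>H. cmod (L x) = hdist x y"
    "\<forall>x\<in>H. \<forall>z\<in>H. cmod (L x - L z) \<le> hdist x z"
    "\<And>x. L x = of_real (if fst x = fst y then height x - height y else - hdist x y)"
    using develop_hair[OF y(1)] y(2) fa by metis
  have "L a = of_real (t * D)" using L(3)[of a] y by simp
  moreover have "hdist b y = D - t * D"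
    using ab fa y same_base[of a y] sym[of "base a" "base b"] base_in by (auto simp: hdist_def D)
  then have "L b = of_real (- (D - t * D))" using L(3)[of b] ab fa y by auto
  moreover have "cmod (of_real D) = hdist a b" using D0 by (simp add: D_def)
  ultimately have "develops a b t y L (of_real D)" using L(1,2) by (simp add: algebra_simps)
  then show ?thesis using y(1) by blast
qed

lemma hairy_develop_base:
  assumes ab: "a \<in> H" "b \<in> H" "\<not> (fst a = fst b \<and> fst a \<noteq> 0)"
    and t: "height a \<le> t * hdist a b" "height b \<le> (1 - t) * hdist a b"
  shows "\<exists>y\<in>H. \<exists>L w. develops a b t y L w"
proof -
  define D where "D = hdist a b"
  define d0 where "d0 = d (base a) (base b)"
  have D: "D = height a + height b + d0" using ab by (auto simp: D_def d0_def hdist_def)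
  have d0: "0 \<le> d0" using nonneg base_in ab by (simp add: d0_def)
  have h: "0 \<le> height a" "0 \<le> height b" using height_nonneg ab by auto
  define t' where "t' = (if d0 = 0 then 0 else (t * D - height a) / d0)"
  have bounds: "0 \<le> t * D - height a" "t * D - height a \<le> d0"
    using t D unfolding D_def[symmetric] by (simp_all add: left_diff_distrib)
  have t': "0 \<le> t'" "t' \<le> 1" "t' * d0 = t * D - height a"
    using bounds d0 by (auto simp: t'_def)
  obtain y and L0 :: "real \<times> real \<Rightarrow> complex" and w0 where y: "y \<in> M"
    and L0: "\<forall>x\<in>M. cmod (L0 x) = d x y" "\<forall>x\<in>M. \<forall>z\<in>M. cmod (L0 x - L0 z) \<le> d x z"
    and w0: "cmod w0 = d0" "L0 (base a) = of_real t' * w0" "L0 (base b) = - (of_real (1 - t') * w0)"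
    using develop[OF base_in base_in t'(1,2), OF ab(1,2)] unfolding d0_def by blast
  define e where "e = (if d0 = 0 then 1 else w0 / of_real d0)"
  have e: "cmod e = 1" "w0 = of_real d0 * e" using w0(1) d0 by (auto simp: e_def norm_divide)
  have da: "d (base a) y = t' * d0" using L0(1) base_in[OF ab(1)] w0 t' by (metis abs_of_nonneg norm_mult norm_of_real)
  have db: "d (base b) y = (1 - t') * d0" 
  proof -
    have "cmod (L0 (base b)) = (1 - t') * d0" using w0 t' by (simp add: norm_mult del: of_real_diff)
    then show ?thesis using L0(1) base_in[OF ab(2)] by simp
  qed
  obtain L :: "pt \<Rightarrow> complex" where L: "\<forall>x\<in>H. cmod (L x) = hdist x (0, y)"
    "\<forall>x\<in>H. \<forall>z\<in>H. cmod (L x - L z) \<le> hdist x z"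
    "\<And>x. x \<in> H \<Longrightarrow> base x \<noteq> y \<Longrightarrow> L x = of_real (1 + height x / d (base x) y) * L0 (base x)"
    "\<And>x. base x = y \<Longrightarrow> L x = of_real (if fst x = fst a then height x else - height x) * e"
    using develop_base[OF y L0 e(1), of "fst a"] by blast
  have "L a = of_real (t * D) * e"
  proof (cases "base a = y")
    case True
    then have "t' * d0 = 0" using da zero[of y y] y by simp
    then show ?thesis using L(4)[OF True] t'(3) by simp
  next
    case False
    then have "t' * d0 \<noteq> 0" using da zero[of "base a" y] y base_in ab by simp
    then have "(1 + height a / (t' * d0)) * (t' * d0) = t * D" using t'(3) by (simp add: field_simps)
    moreover have "L a = of_real ((1 + height a / (t' * d0)) * (t' * d0)) * e"
      unfolding L(3)[OF ab(1) False] da w0(2) e(2) by (simp only: of_real_mult mult.assoc)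
    ultimately show ?thesis by simp
  qed
  moreover have "L b = - (of_real (D - t * D) * e)"
  proof -
    have eq: "(1 - t') * d0 + height b = D - t * D" using t'(3) D by (simp add: left_diff_distrib)
    show ?thesis
    proof (cases "base b = y")
      case True
      then have "(1 - t') * d0 = 0" using db zero[of y y] y by simp
      then have "height b = D - t * D" using eq by linarith
      moreover have "fst b = fst a \<Longrightarrow> height b = 0" using ab(3) by (auto simp: height_def)
      ultimately have "L b = of_real (- height b) * e" using L(4)[OF True] by auto
      then show ?thesis unfolding \<open>height b = D - t * D\<close> by (simp only: of_real_minus mult_minus_left)
    next
      case False
      then have nz: "(1 - t') * d0 \<noteq> 0" using db zero[of "base b" y] y base_in ab by simp
      then have "(1 + height b / ((1 - t') * d0)) * ((1 - t') * d0) = D - t * D"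
        using eq by (simp add: add_divide_distrib distrib_right)
      moreover have "L b = - (of_real ((1 + height b / ((1 - t') * d0)) * ((1 - t') * d0)) * e)"
        unfolding L(3)[OF ab(2) False] db w0(3) e(2) by (simp only: of_real_mult mult.assoc mult_minus_right)
      ultimately show ?thesis by simp
    qed
  qed
  moreover have "0 \<le> D" using D d0 h by simp
  then have "cmod (of_real D * e) = hdist a b" using e by (simp add: norm_mult D_def)
  ultimately have "develops a b t (0, y) L (of_real D * e)" using L(1,2) by (simp add: algebra_simps)
  moreover have "(0, y) \<in> H" using y by simp
  ultimately show ?thesis by blast
qed

lemma hairy_develop:
  assumes ab: "a \<in> H" "b \<in> H" and t: "0 \<le> t" "t \<le> 1"
  shows "\<exists>y\<in>H. \<exists>L w. develops a b t y L w"
proof (cases "fst a = fst b \<and> fst a \<noteq> 0")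
  case True
  then show ?thesis using hairy_develop_same assms by blast
next
  case False
  consider "t * hdist a b < height a" | "(1 - t) * hdist b a < height b"
    | "height a \<le> t * hdist a b" "height b \<le> (1 - t) * hdist a b"
    using hdist_sym[OF ab] by fastforce
  then show ?thesis
  proof cases
    case 1
    then show ?thesis using hairy_develop_hair[OF ab False t(1)] by blast
  next
    case 2
    have "\<not> (fst b = fst a \<and> fst b \<noteq> 0)" "0 \<le> 1 - t" using False t by auto
    then obtain y L w where *: "y \<in> H" "develops b a (1 - t) y L w"
      using hairy_develop_hair[OF ab(2,1) _ _ 2] by blast
    then have "develops a b t y L (- w)" using hdist_sym[OF ab] by simp
    then show ?thesis using *(1) by blast
  next
    case 3
    then show ?thesis using hairy_develop_base[OF ab False] by blast
  qed
qed

sublocale hairs: developing_space H hdist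
  using hdist_sym hdist_zero_iff hairy_develop by unfold_locales auto

end

section \<open>Estimates for the distance\<close>

definition radius :: "real \<times> real \<Rightarrow> real" where
  "radius x = sqrt (1 + (fst x)\<^sup>2)"

lemma radius_ge_one: "1 \<le> radius x"
  by (simp add: radius_def)

lemma radius_le: "x \<in> sheet \<Longrightarrow> radius x \<le> 1 + fst x"
  by (auto simp: radius_def sheet_def power2_eq_square algebra_simps intro!: real_le_lsqrt)

lemma le_radius: "fst x \<le> radius x"
  by (auto simp: radius_def intro!: real_le_rsqrt)

lemma cmod_plane: "cmod (plane x) = radius x"
  by (simp add: plane_def radius_def norm_mult)

lemma sdist_ge_radius: "x \<in> sheet \<Longrightarrow> z \<in> sheet \<Longrightarrow> \<bar>radius x - radius z\<bar> \<le> sdist x z"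
  using plane_lipschitz[of x z] norm_triangle_ineq3[of "plane x" "plane z"] by (simp add: cmod_plane)

lemma sdist_ge_bus:
  assumes "x \<in> sheet" "z \<in> sheet"
  shows "\<bar>snd x - snd z\<bar> + \<bar>(fst x - arctan (fst x)) - (fst z - arctan (fst z))\<bar> \<le> sdist x z"
proof -
  have "\<bar>bus x - bus z\<bar> \<le> sdist x z" "\<bar>bus (mirror x) - bus (mirror z)\<bar> \<le> sdist x z"
    using bus_lipschitz[of x z] bus_lipschitz[of "mirror x" "mirror z"] assms by auto
  then show ?thesis unfolding bus_def mirror_simps(3,4) unfolding lo_def hi_def by linarith
qed

lemma sdist_not_visible:
  assumes "x \<in> sheet" "z \<in> sheet" "\<not> visible x z"
  shows "sdist x z = fst x - arctan (fst x) + (fst z - arctan (fst z)) + \<bar>snd x - snd z\<bar>"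
proof -
  have a: "0 \<le> arctan (fst x)" "0 \<le> arctan (fst z)" using assms by (auto simp: sheet_def)
  consider "hi x < lo z" | "hi z < lo x" using assms(3) unfolding visible_def by linarith
  then show ?thesis
  proof cases
    case 1
    then have "sdist x z = fst x + fst z + (lo z - hi x)" using sdist_shadow assms by simp
    then show ?thesis using a 1 unfolding lo_def hi_def by linarith
  next
    case 2
    then have "sdist x z = fst x + fst z + (lo x - hi z)"
      using sdist_shadow[of z x] sdist_sym[of x z] assms by simp
    then show ?thesis using a 2 unfolding lo_def hi_def by linarith
  qed
qed

lemma visible_iff_angle: 
  "x \<in> sheet \<Longrightarrow> z \<in> sheet \<Longrightarrow> visible x z \<longleftrightarrow> \<bar>snd x - snd z\<bar> \<le> arctan (fst x) + arctan (fst z)"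
  unfolding visible_def lo_def hi_def by linarith

lemma sdist_not_visible_ge:
  assumes "x \<in> sheet" "z \<in> sheet" "\<not> visible x z"
  shows "fst x + fst z \<le> sdist x z"
  using sdist_not_visible[OF assms] visible_iff_angle[of x z] assms by simp

lemma sdist_visible_sq:
  assumes "visible x z"
  shows "(sdist x z)\<^sup>2 = (radius x - radius z)\<^sup>2 + 4 * radius x * radius z * (sin ((snd x - snd z) / 2))\<^sup>2"
proof -
  have "(sdist x z)\<^sup>2 = (cmod (plane x - plane z))\<^sup>2" using assms by (simp add: sdist_def)
  also have "\<dots> = (radius x * cos (snd x) - radius z * cos (snd z))\<^sup>2 + (radius x * sin (snd x) - radius z * sin (snd z))\<^sup>2"
    unfolding plane_def radius_def[symmetric] by (simp add: cmod_power2)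
  also have "\<dots> = (radius x)\<^sup>2 * ((sin (snd x))\<^sup>2 + (cos (snd x))\<^sup>2) + (radius z)\<^sup>2 * ((sin (snd z))\<^sup>2 + (cos (snd z))\<^sup>2)
      - 2 * radius x * radius z * (cos (snd x) * cos (snd z) + sin (snd x) * sin (snd z))"
    by algebra
  also have "\<dots> = (radius x)\<^sup>2 + (radius z)\<^sup>2 - 2 * radius x * radius z * cos (snd x - snd z)"
    by (simp add: cos_diff)
  also have "snd x - snd z = 2 * ((snd x - snd z) / 2)" by simp
  also have "cos (2 * ((snd x - snd z) / 2)) = 1 - 2 * (sin ((snd x - snd z) / 2))\<^sup>2"
    by (rule cos_double_sin)
  finally show ?thesis by (simp add: power2_eq_square algebra_simps)
qed

lemma half_le_sin:
  fixes x :: real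
  assumes "0 \<le> x" "x \<le> pi / 2"
  shows "x / 2 \<le> sin x"
proof -
  define y where "y = x / 2"
  have y: "0 \<le> y" "y \<le> pi / 4" using assms by (auto simp: y_def)
  have y2: "- (pi / 2) < y" "y < pi / 2" using y pi_gt_zero by linarith+
  have c: "cos y > 0" using cos_gt_zero_pi[OF y2] .
  have "y = arctan (tan y)" using y2 by (simp add: arctan_tan)
  also have "\<dots> \<le> tan y" 
    using y tan_gt_zero[of y] by (cases "y = 0") (auto intro!: arctan_le_self)
  finally have "y * cos y \<le> sin y" using c by (simp add: tan_def field_simps)
  then have "y * cos y * (2 * cos y) \<le> sin y * (2 * cos y)" using c by (intro mult_right_mono) auto
  also have "\<dots> = sin x" using sin_double[of y] by (simp add: y_def)
  finally have *: "y * (2 * (cos y)\<^sup>2) \<le> sin x" by (simp add: power2_eq_square algebra_simps)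
  have "0 \<le> cos (2 * y)" using y by (intro cos_ge_zero) auto
  then have "1 \<le> 2 * (cos y)\<^sup>2" by (simp only: cos_double_cos)
  then have "y * 1 \<le> y * (2 * (cos y)\<^sup>2)" using y by (intro mult_left_mono) auto
  then show ?thesis using * by (simp add: y_def)
qed

lemma sdist_visible_ge:
  assumes "x \<in> sheet" "z \<in> sheet" "visible x z"
  shows "min (radius x) (radius z) * \<bar>snd x - snd z\<bar> \<le> 2 * sdist x z"
proof -
  define m where "m = min (radius x) (radius z)"
  define h where "h = \<bar>snd x - snd z\<bar> / 2"
  have m: "1 \<le> m" "m \<le> radius x" "m \<le> radius z" using radius_ge_one by (auto simp: m_def)
  have h: "0 \<le> h" "h \<le> pi / 2"
    using visible_iff_angle[OF assms(1,2)] assms(3) arctan_ubound[of "fst x"] arctan_ubound[of "fst z"]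
    by (auto simp: h_def)
  have "h = (snd x - snd z) / 2 \<or> h = - ((snd x - snd z) / 2)" unfolding h_def by linarith
  then have "(sin ((snd x - snd z) / 2))\<^sup>2 = (sin h)\<^sup>2"
    by (elim disjE) (simp_all only: sin_minus power2_minus)
  then have sq: "(sdist x z)\<^sup>2 = (radius x - radius z)\<^sup>2 + 4 * (radius x * radius z) * (sin h)\<^sup>2"
    using sdist_visible_sq[OF assms(3)] by (simp add: mult.assoc)
  have "m * m \<le> radius x * radius z" using m by (intro mult_mono) auto
  then have "4 * (m * m) * (sin h)\<^sup>2 \<le> 4 * (radius x * radius z) * (sin h)\<^sup>2" by (intro mult_right_mono) auto
  also have "\<dots> \<le> (sdist x z)\<^sup>2" using sq by simp
  finally have "(2 * m * sin h)\<^sup>2 \<le> (sdist x z)\<^sup>2" by (simp add: power2_eq_square algebra_simps)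
  then have "2 * m * sin h \<le> sdist x z" using power2_le_imp_le sdist_nonneg assms by blast
  moreover have "2 * m * (h / 2) \<le> 2 * m * sin h" using half_le_sin[OF h] m by (intro mult_left_mono) auto
  ultimately have "2 * m * (h / 2) \<le> sdist x z" by linarith
  then show ?thesis by (simp add: m_def[symmetric] h_def)
qed

lemma sdist_le_sum:
  assumes "x \<in> sheet" "z \<in> sheet"
  shows "sdist x z \<le> fst x + fst z + \<bar>snd x - snd z\<bar>"
proof (cases "visible x z")
  case False
  moreover have "0 \<le> arctan (fst x)" "0 \<le> arctan (fst z)" using assms by (auto simp: sheet_def)
  ultimately show ?thesis using sdist_not_visible[OF assms] by linarith
next
  case True
  have r: "cmod (plane u - cis (snd u)) \<le> fst u" if "u \<in> sheet" for u
  proof -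
    have "plane u - cis (snd u) = of_real (radius u - 1) * cis (snd u)"
      by (simp add: plane_def radius_def algebra_simps)
    then have "cmod (plane u - cis (snd u)) = \<bar>radius u - 1\<bar>" by (simp add: norm_mult del: of_real_diff)
    then show ?thesis using radius_le[OF that] radius_ge_one[of u] by simp
  qed
  have "cmod (plane x - plane z) \<le> cmod (plane x - cis (snd x)) + cmod (cis (snd x) - cis (snd z)) + cmod (cis (snd z) - plane z)"
    using norm_triangle_ineq[of "plane x - cis (snd x)" "cis (snd x) - cis (snd z)"]
      norm_triangle_ineq[of "plane x - cis (snd z)" "cis (snd z) - plane z"] by simp
  then show ?thesis 
    using r[OF assms(1)] r[OF assms(2)] cmod_cis_diff_le[of "snd x" "snd z"] True norm_minus_commute[of "plane z"]
    by (simp add: sdist_def)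
qed

lemma sdist_radial: 
  assumes "0 \<le> s" "0 \<le> s'"
  shows "sdist (s, \<theta>) (s', \<theta>) = \<bar>radius (s, \<theta>) - radius (s', \<theta>)\<bar>"
proof -
  have "visible (s, \<theta>) (s', \<theta>)"
  proof -
    have "0 \<le> arctan s" "0 \<le> arctan s'" using assms by simp_all
    then show ?thesis unfolding visible_def lo_def hi_def fst_conv snd_conv by linarith
  qed
  then have "(sdist (s, \<theta>) (s', \<theta>))\<^sup>2 = (radius (s, \<theta>) - radius (s', \<theta>))\<^sup>2"
    using sdist_visible_sq by force
  moreover have "0 \<le> sdist (s, \<theta>) (s', \<theta>)" using assms by (intro sdist_nonneg) (auto simp: sheet_def)
  ultimately show ?thesis unfolding power2_eq_iff by linarith
qed

lemma sdist_tangential: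
  assumes "0 \<le> s"
  shows "sdist (s, \<theta>) (s, \<theta>') \<le> radius (s, \<theta>) * \<bar>\<theta> - \<theta>'\<bar>"
proof -
  have xs: "(s, \<theta>) \<in> sheet" "(s, \<theta>') \<in> sheet" using assms by (auto simp: sheet_def)
  have r: "radius (s, \<theta>') = radius (s, \<theta>)" by (simp add: radius_def)
  have r1: "1 \<le> radius (s, \<theta>)" by (rule radius_ge_one)
  show ?thesis
  proof (cases "visible (s, \<theta>) (s, \<theta>')")
    case True
    have "plane (s, \<theta>) - plane (s, \<theta>') = of_real (radius (s, \<theta>)) * (cis \<theta> - cis \<theta>')"
      by (simp add: plane_def radius_def algebra_simps)
    then have "sdist (s, \<theta>) (s, \<theta>') = radius (s, \<theta>) * cmod (cis \<theta> - cis \<theta>')"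
      using True r1 by (simp add: sdist_def norm_mult)
    also have "\<dots> \<le> radius (s, \<theta>) * \<bar>\<theta> - \<theta>'\<bar>"
      using cmod_cis_diff_le r1 by (intro mult_left_mono) auto
    finally show ?thesis .
  next
    case False
    define \<rho> where "\<rho> = radius (s, \<theta>)"
    have a: "0 \<le> arctan s" using assms by simp
    have ang: "2 * arctan s < \<bar>\<theta> - \<theta>'\<bar>" using visible_iff_angle[OF xs] False by simp
    have "sin (arctan s) \<le> arctan s" using sin_x_le_x a by blast
    then have "s / \<rho> \<le> arctan s" by (simp add: sin_arctan \<rho>_def radius_def)
    then have "s \<le> \<rho> * arctan s" using r1 by (simp add: \<rho>_def field_simps)
    moreover have "(\<rho> - 1) * (2 * arctan s) \<le> (\<rho> - 1) * \<bar>\<theta> - \<theta>'\<bar>"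
      using ang r1 by (intro mult_left_mono) (auto simp: \<rho>_def)
    ultimately have "2 * (s - arctan s) + \<bar>\<theta> - \<theta>'\<bar> \<le> \<rho> * \<bar>\<theta> - \<theta>'\<bar>"
      by (simp add: algebra_simps)
    then show ?thesis using sdist_not_visible[OF xs False] by (simp add: \<rho>_def)
  qed
qed

lemma sdist_le_polar:
  assumes "x \<in> sheet" "z \<in> sheet"
  shows "sdist x z \<le> \<bar>radius x - radius z\<bar> + min (radius x) (radius z) * \<bar>snd x - snd z\<bar>"
proof -
  have *: "sdist x z \<le> \<bar>radius x - radius z\<bar> + min (radius x) (radius z) * \<bar>snd x - snd z\<bar>"
    if xz: "x \<in> sheet" "z \<in> sheet" "radius z \<le> radius x" for x z
  proof -
    let ?y = "(fst z, snd x)"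
    have y: "?y \<in> sheet" "radius ?y = radius z" "radius (fst z, snd z) = radius z"
      using xz by (auto simp: sheet_def radius_def)
    have "sdist x z \<le> sdist x ?y + sdist ?y z" using sheet.triangle xz y by blast
    also have "sdist x ?y = \<bar>radius x - radius z\<bar>"
      using sdist_radial[of "fst x" "fst z" "snd x"] xz y by (simp add: sheet_def)
    also have "sdist ?y z \<le> radius z * \<bar>snd x - snd z\<bar>"
      using sdist_tangential[of "fst z" "snd x" "snd z"] xz y by (simp add: sheet_def)
    finally show ?thesis using xz by simp
  qed
  show ?thesis
  proof (cases "radius z \<le> radius x")
    case False
    then show ?thesis using *[of z x] sdist_sym[of x z] assms
      by (simp add: abs_minus_commute min.commute)
  qed (use * assms in blast)
qed

definition shear :: "real \<Rightarrow> real \<times> real \<Rightarrow> real \<times> real" where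
  "shear c x = (fst x, snd x + c * ln (radius x))"

lemma shear_simps [simp]: "fst (shear c x) = fst x" "shear c x \<in> sheet \<longleftrightarrow> x \<in> sheet"
  "radius (shear c x) = radius x" "shear (- c) (shear c x) = x" "shear c (shear (- c) x) = x"
  by (auto simp: shear_def sheet_def radius_def)

lemma abs_ln_diff_le:
  fixes a b :: real
  assumes "1 \<le> a" "1 \<le> b"
  shows "min a b * \<bar>ln a - ln b\<bar> \<le> \<bar>a - b\<bar>"
proof -
  have *: "b * \<bar>ln a - ln b\<bar> \<le> a - b" if "1 \<le> b" "b \<le> a" for a b :: real
  proof -
    have "ln (a / b) \<le> a / b - 1" using that by (intro ln_le_minus_one) auto
    then have "b * (ln a - ln b) \<le> b * (a / b - 1)" using that by (intro mult_left_mono) (auto simp: ln_div)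
    then show ?thesis using that by (simp add: algebra_simps)
  qed
  show ?thesis using *[of b a] *[of a b] assms by (cases "a \<le> b") (auto simp: abs_minus_commute)
qed

lemma shear_lipschitz:
  assumes x: "x \<in> sheet" and z: "z \<in> sheet" and c: "\<bar>c\<bar> \<le> 1"
  shows "sdist (shear c x) (shear c z) \<le> 4 * sdist x z"
proof -
  define m where "m = min (radius x) (radius z)"
  define l where "l = \<bar>ln (radius x) - ln (radius z)\<bar>"
  have m: "1 \<le> m" using radius_ge_one by (simp add: m_def)
  have l: "m * l \<le> \<bar>radius x - radius z\<bar>"
    unfolding m_def l_def by (rule abs_ln_diff_le[OF radius_ge_one radius_ge_one])
  have r: "\<bar>radius x - radius z\<bar> \<le> sdist x z" by (rule sdist_ge_radius[OF x z])
  have "snd (shear c x) - snd (shear c z) = (snd x - snd z) + c * (ln (radius x) - ln (radius z))"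
    by (simp add: shear_def algebra_simps)
  moreover have "\<bar>c * (ln (radius x) - ln (radius z))\<bar> \<le> l"
    using c by (auto simp: l_def abs_mult intro: mult_left_le_one_le)
  ultimately have ang: "\<bar>snd (shear c x) - snd (shear c z)\<bar> \<le> \<bar>snd x - snd z\<bar> + l" by linarith
  show ?thesis
  proof (cases "visible x z")
    case True
    have "sdist (shear c x) (shear c z) \<le> \<bar>radius x - radius z\<bar> + m * \<bar>snd (shear c x) - snd (shear c z)\<bar>"
      using sdist_le_polar[of "shear c x" "shear c z"] x z by (simp add: m_def)
    also have "m * \<bar>snd (shear c x) - snd (shear c z)\<bar> \<le> m * (\<bar>snd x - snd z\<bar> + l)"
      using ang m by (intro mult_left_mono) auto
    also have "m * \<bar>snd x - snd z\<bar> \<le> 2 * sdist x z" unfolding m_def by (rule sdist_visible_ge[OF x z True])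
    then have "\<bar>radius x - radius z\<bar> + m * (\<bar>snd x - snd z\<bar> + l) \<le> 4 * sdist x z"
      using l r by (simp add: algebra_simps)
    finally show ?thesis by simp
  next
    case False
    have "0 \<le> l" by (simp add: l_def)
    then have "1 * l \<le> m * l" using m by (intro mult_right_mono)
    then have "l \<le> sdist x z" using l r by linarith
    moreover have "\<bar>snd x - snd z\<bar> \<le> sdist x z" using sdist_ge_bus[OF x z] by linarith
    ultimately show ?thesis 
      using sdist_le_sum[of "shear c x" "shear c z"] x z ang sdist_not_visible_ge[OF x z False] by simp
  qed
qed

section \<open>Contraction\<close>

lemma mdiam_le:
  assumes "A \<noteq> {}" "\<And>a b. a \<in> A \<Longrightarrow> b \<in> A \<Longrightarrow> mdist X a b \<le> C"
  shows "mdiam X A \<le> C"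
  unfolding mdiam_def using assms by (intro cSUP_least) auto

context developing_space
begin

lemma dist_to_set_le:
  assumes "A \<subseteq> M" "x \<in> M" "a \<in> A"
  shows "dist_to_set X x A \<le> d x a"
proof -
  have "bdd_below ((\<lambda>a. mdist X x a) ` A)" by (rule bdd_belowI[of _ 0]) auto
  then have "dist_to_set X x A \<le> mdist X x a" unfolding dist_to_set_def by (rule cINF_lower) (rule assms)
  then show ?thesis using assms by auto
qed

lemma dist_to_set_eqI:
  assumes "A \<subseteq> M" "x \<in> M" "a \<in> A" "\<And>b. b \<in> A \<Longrightarrow> d x a \<le> d x b"
  shows "dist_to_set X x A = d x a"
proof (rule antisym)
  show "d x a \<le> dist_to_set X x A" unfolding dist_to_set_def
    using assms by (intro cINF_greatest) (auto simp: subset_iff)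
qed (use assms dist_to_set_le in auto)

lemma in_projD:
  assumes "y \<in> proj X A x" "A \<subseteq> M" "x \<in> M"
  shows "y \<in> A" "\<And>b. b \<in> A \<Longrightarrow> d x y \<le> d x b"
  using assms dist_to_set_le[OF assms(2,3)] by (auto simp: proj_def subset_iff)

lemma proj_eq_singleton:
  assumes "A \<subseteq> M" "x \<in> M" "a \<in> A" "\<And>b. b \<in> A \<Longrightarrow> b \<noteq> a \<Longrightarrow> d x a < d x b"
  shows "proj X A x = {a}" "dist_to_set X x A = d x a"
proof -
  show *: "dist_to_set X x A = d x a"
    using assms by (intro dist_to_set_eqI) (auto intro: less_imp_le)
  show "proj X A x = {a}"
  proof
    show "proj X A x \<subseteq> {a}"
    proof
      fix y assume y: "y \<in> proj X A x"
      have "y \<in> A" "d x y \<le> d x a" using in_projD[OF y assms(1,2)] assms(3) by auto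
      then show "y \<in> {a}" using assms(4)[of y] by (cases "y = a") auto
    qed
    show "{a} \<subseteq> proj X A x" using * assms by (auto simp: proj_def)
  qed
qed

text \<open>The constant \<open>\<bar>Sup {}\<bar>\<close> covers the junk value of the diameter of the empty set.\<close>

lemma contractingI:
  assumes \<gamma>: "ray_image \<gamma> \<subseteq> M"
    and C: "\<And>x y a b. x \<in> M \<Longrightarrow> y \<in> M \<Longrightarrow> d x y \<le> dist_to_set X x (ray_image \<gamma>) \<Longrightarrow>
      a \<in> proj X (ray_image \<gamma>) x \<union> proj X (ray_image \<gamma>) y \<Longrightarrow>
      b \<in> proj X (ray_image \<gamma>) x \<union> proj X (ray_image \<gamma>) y \<Longrightarrow> d a b \<le> C"
  shows "contracting X \<gamma>"
  unfolding contracting_def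
proof (intro exI[of _ "\<lambda>r. max C \<bar>Sup {}\<bar>"] conjI ballI impI)
  show "mono_on {0..} (\<lambda>r. max C \<bar>Sup {}\<bar>)" by (simp add: mono_on_def)
  show "\<forall>\<^sub>F r in at_top. 0 \<le> max C \<bar>Sup {}\<bar>" by (simp add: le_max_iff_disj)
  show "((\<lambda>r. max C \<bar>Sup {}\<bar> / r) \<longlongrightarrow> 0) at_top"
    by (intro tendsto_divide_0[OF tendsto_const] filterlim_at_top_imp_at_infinity filterlim_ident)
  fix x y assume xy: "x \<in> mspace X" "y \<in> mspace X" "mdist X x y \<le> dist_to_set X x (ray_image \<gamma>)"
  let ?P = "proj X (ray_image \<gamma>) x \<union> proj X (ray_image \<gamma>) y"
  have P: "?P \<subseteq> M" using \<gamma> by (auto simp: proj_def)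
  show "mdiam X ?P \<le> max C \<bar>Sup {}\<bar>"
  proof (cases "?P = {}")
    case True
    then show ?thesis unfolding mdiam_def by simp
  next
    case False
    have M: "x \<in> M" "y \<in> M" using xy by simp_all
    then have le: "d x y \<le> dist_to_set X x (ray_image \<gamma>)" using xy by simp
    have "mdist X a b \<le> max C \<bar>Sup {}\<bar>" if ab: "a \<in> ?P" "b \<in> ?P" for a b
    proof -
      have "a \<in> M" "b \<in> M" using ab P by blast+
      then have "mdist X a b = d a b" by simp
      also have "\<dots> \<le> C" by (rule C[OF M le ab])
      finally show ?thesis by simp
    qed
    then show ?thesis by (rule mdiam_le[OF False])
  qed
qed

lemma not_contractingI:
  assumes *: "\<And>r. r > 0 \<Longrightarrow> \<exists>x y a b. x \<in> M \<and> y \<in> M \<and> a \<in> M \<and> b \<in> M \<and> d x y \<le> r \<and> dist_to_set X x (ray_image \<gamma>) = r \<and>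
      proj X (ray_image \<gamma>) x = {a} \<and> proj X (ray_image \<gamma>) y = {b} \<and> r \<le> d a b"
  shows "\<not> contracting X \<gamma>"
proof
  assume "contracting X \<gamma>"
  then obtain \<rho> :: "real \<Rightarrow> real" where lim: "((\<lambda>r. \<rho> r / r) \<longlongrightarrow> 0) at_top"
    and \<rho>: "\<forall>x\<in>mspace X. \<forall>y\<in>mspace X. mdist X x y \<le> dist_to_set X x (ray_image \<gamma>) \<longrightarrow>
           mdiam X (proj X (ray_image \<gamma>) x \<union> proj X (ray_image \<gamma>) y) \<le> \<rho> (dist_to_set X x (ray_image \<gamma>))"
    unfolding contracting_def by blast
  have "r \<le> \<rho> r" if r: "r > 0" for r
  proof -
    obtain x y a b where xy: "x \<in> M" "y \<in> M" "a \<in> M" "b \<in> M" "d x y \<le> r" "dist_to_set X x (ray_image \<gamma>) = r"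
      "proj X (ray_image \<gamma>) x = {a}" "proj X (ray_image \<gamma>) y = {b}" "r \<le> d a b" using *[OF r] by blast
    have "r \<le> mdist X a b" using xy(3,4,9) by simp
    also have "mdist X a b \<le> mdiam X ({a} \<union> {b})"
      unfolding mdiam_def by (rule cSUP_upper2[of _ _ "(a, b)"]) auto
    also have "\<dots> \<le> \<rho> r"
    proof -
      have "mdist X x y \<le> dist_to_set X x (ray_image \<gamma>)" using xy(1,2,5,6) by simp
      with \<rho> xy(1,2) have "mdiam X (proj X (ray_image \<gamma>) x \<union> proj X (ray_image \<gamma>) y) \<le> \<rho> (dist_to_set X x (ray_image \<gamma>))"
        unfolding mspace_X by blast
      then show ?thesis unfolding xy(6,7,8) .
    qed
    finally show ?thesis .
  qed
  then have "\<forall>\<^sub>F r in at_top. 1 \<le> \<rho> r / r"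
    by (intro eventually_mono[OF eventually_gt_at_top[of 0]]) (simp add: field_simps)
  from tendsto_lowerbound[OF lim this] show False by simp
qed

end

section \<open>Geodesic rays in the cover\<close>

lemma sdist_circle: "sdist (0, a) (0, b) = \<bar>a - b\<bar>"
  using sdist_ge_bus[of "(0, a)" "(0, b)"] sdist_le_sum[of "(0, a)" "(0, b)"] by (auto simp: sheet_def)

lemma chart_lo: "x \<in> sheet \<Longrightarrow> chart (lo x) (Complex 1 (fst x)) = x"
  by (simp add: chart_def cmod_power2 lo_def sheet_def prod_eq_iff)

locale sheet_ray =
  fixes z :: "real \<Rightarrow> real \<times> real"
  assumes z_in: "0 \<le> u \<Longrightarrow> z u \<in> sheet"
    and z_iso: "0 \<le> u \<Longrightarrow> 0 \<le> v \<Longrightarrow> sdist (z u) (z v) = \<bar>u - v\<bar>"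
    and z_0: "z 0 = (0, 0)"
begin

lemma dist_0: "0 \<le> u \<Longrightarrow> sdist (0, 0) (z u) = u"
  using z_iso[of 0 u] z_0 by simp

lemma eqI:
  assumes "0 \<le> u0" "u0 \<le> u" "y \<in> sheet" "sdist (0, 0) y = u0" "sdist y (z u) = u - u0"
  shows "z u0 = y"
proof (rule sheet.geodesic_unique[of "(0,0)" "z u"])
  show "sdist (0, 0) (z u0) = sdist (0, 0) y" "sdist (z u0) (z u) = sdist y (z u)"
    "sdist (0, 0) (z u0) + sdist (z u0) (z u) = sdist (0, 0) (z u)"
    using assms dist_0[of u0] dist_0[of u] z_iso[of u0 u] by simp_all
qed (use assms z_in in \<open>auto simp: sheet_def\<close>)

lemma right:
  assumes u: "0 < u0" "u0 \<le> u" and pos: "0 < fst (z u0)" and lo: "0 < lo (z u)"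
  shows "lo (z u0) = lo (z u)" "z u = chart (lo (z u)) (1 + of_real (u - lo (z u)) * \<i>)" "lo (z u) \<le> u0"
proof -
  have zu: "z u \<in> sheet" using z_in u by simp
  have o: "(0, 0) \<in> sheet" "hi (0, 0) = 0" by (auto simp: sheet_def hi_def)
  define k where "k = lo (z u)"
  have fst: "fst (z u) = u - k"
    using sdist_shadow[OF o(1) zu] o(2) lo dist_0[of u] u by (simp add: k_def)
  have "k < u0"
  proof (rule ccontr)
    assume "\<not> k < u0"
    then have le: "u0 \<le> k" by simp
    have y: "(0, u0) \<in> sheet" "hi (0, u0) = u0" by (auto simp: sheet_def hi_def)
    have "z u0 = (0, u0)"
    proof (rule eqI[OF _ u(2) y(1)])
      show "sdist (0, 0) (0, u0) = u0" using u by (simp add: sdist_circle)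
      show "sdist (0, u0) (z u) = u - u0" using sdist_shadow[OF y(1) zu] y(2) le fst by (simp add: k_def)
    qed (use u in simp)
    then show False using pos by simp
  qed
  define y where "y = chart k (Complex 1 (u0 - k))"
  have y: "y \<in> sheet" by (simp add: y_def chart_in_sheet)
  have y_eq: "y = (u0 - k, k + arctan (u0 - k))" using \<open>k < u0\<close> by (simp add: y_def chart_def cmod_power2)
  have loy: "lo y = k" "fst y = u0 - k" by (simp_all add: y_eq lo_def)
  have zk: "z u = chart k (Complex 1 (u - k))" using chart_lo[OF zu] fst by (simp add: k_def)
  have "z u0 = y"
  proof (rule eqI[OF _ u(2) y])
    show "sdist (0, 0) y = u0" using sdist_shadow[OF o(1) y] o(2) loy lo by (simp add: k_def)
    have "sdist y (z u) = cmod (Complex 1 (u0 - k) - Complex 1 (u - k))"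
      unfolding y_def zk by (rule sdist_chart) auto
    then show "sdist y (z u) = u - u0" using u by (simp add: cmod_def)
  qed (use u in simp)
  then show "lo (z u0) = lo (z u)" using loy by (simp add: k_def)
  have "Complex 1 (u - k) = 1 + of_real (u - k) * \<i>" by (simp add: complex_eq_iff)
  from zk[unfolded this] show "z u = chart (lo (z u)) (1 + of_real (u - lo (z u)) * \<i>)" unfolding k_def .
  show "lo (z u) \<le> u0" using \<open>k < u0\<close> by (simp add: k_def)
qed

lemma centre:
  assumes u: "0 < u0" "u0 \<le> u" and vis: "lo (z u) \<le> 0" "0 \<le> hi (z u)"
  shows "lo (z u0) \<le> 0" "0 \<le> hi (z u0)"
    "z u = chart 0 (1 + of_real u * ((plane (z u0) - 1) / of_real u0))"
    "cmod ((plane (z u0) - 1) / of_real u0) = 1" "0 \<le> Re ((plane (z u0) - 1) / of_real u0)"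
proof -
  have zu: "z u \<in> sheet" using z_in u by simp
  obtain W where W: "Re W \<ge> 1" "z u = chart 0 W" using chart_plane[OF zu vis] by blast
  have o: "(0, 0) = chart 0 1" by (simp add: chart_def)
  have norm: "cmod (W - 1) = u"
  proof -
    have "u = sdist (chart 0 1) (chart 0 W)" using dist_0[of u] u unfolding o W(2) by simp
    also have "\<dots> = cmod (1 - W)" using W by (intro sdist_chart) auto
    finally show ?thesis by (simp only: norm_minus_commute)
  qed
  define V where "V = 1 + of_real (u0 / u) * (W - 1)"
  have q: "0 < u0 / u" "u0 / u \<le> 1" using u by auto
  have "0 \<le> (u0 / u) * (Re W - 1)" using q W by (intro mult_nonneg_nonneg) auto
  then have V: "Re V \<ge> 1" by (simp add: V_def del: of_real_divide)
  have "z u0 = chart 0 V"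
  proof (rule eqI[OF _ u(2) chart_in_sheet[OF V]])
    have "sdist (0, 0) (chart 0 V) = cmod (1 - V)" unfolding o by (rule sdist_chart) (use V in auto)
    also have "1 - V = - (of_real (u0 / u) * (W - 1))" by (simp add: V_def)
    also have "cmod \<dots> = (u0 / u) * u" using q norm by (simp only: norm_minus_cancel norm_mult norm_of_real)
    finally show "sdist (0, 0) (chart 0 V) = u0" using u by simp
    have "sdist (chart 0 V) (z u) = cmod (V - W)" unfolding W(2) by (rule sdist_chart[OF V W(1)])
    also have "V - W = - (of_real (1 - u0 / u) * (W - 1))" by (simp add: V_def algebra_simps)
    also have "cmod \<dots> = (1 - u0 / u) * u" using q norm by (simp only: norm_minus_cancel norm_mult norm_of_real)
    also have "\<dots> = u - u0" using u by (simp add: algebra_simps)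
    finally show "sdist (chart 0 V) (z u) = u - u0" .
  qed (use u in simp)
  then show "lo (z u0) \<le> 0" "0 \<le> hi (z u0)" using lo_chart[OF V] hi_chart[OF V] by simp_all
  have P: "plane (z u0) - 1 = of_real (u0 / u) * (W - 1)"
    using plane_chart[OF V] \<open>z u0 = chart 0 V\<close> by (simp add: V_def)
  then have w: "(plane (z u0) - 1) / of_real u0 = (W - 1) / of_real u" using u by (simp add: field_simps)
  have "1 + of_real u * ((W - 1) / of_real u) = W" using u by simp
  then show "z u = chart 0 (1 + of_real u * ((plane (z u0) - 1) / of_real u0))"
    unfolding w by (simp only: W(2))
  show "cmod ((plane (z u0) - 1) / of_real u0) = 1" unfolding w using norm u by (simp add: norm_divide)
  show "0 \<le> Re ((plane (z u0) - 1) / of_real u0)" unfolding w using u W by simp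
qed

end

lemma sheet_ray_mirror: "sheet_ray z \<Longrightarrow> sheet_ray (\<lambda>u. mirror (z u))"
  unfolding sheet_ray_def by (auto simp: mirror_def[of "(0, 0)"])

lemma mirror_chart: "mirror (chart k w) = chart (- k) (cnj w)"
  by (simp add: mirror_def chart_def arctan_minus)

lemma sheet_ray_straight:
  assumes "sheet_ray z" and u0: "0 < u0" "0 < fst (z u0)"
  obtains k c w where "cmod w = 1" "0 \<le> Re w" "c \<le> u0"
    "\<And>u. u0 \<le> u \<Longrightarrow> z u = chart k (1 + of_real (u - c) * w)"
proof -
  interpret z: sheet_ray z by fact
  interpret m: sheet_ray "\<lambda>u. mirror (z u)" by (rule sheet_ray_mirror) fact
  note right = z.right[OF u0(1) _ u0(2)]
  have fm: "0 < fst (mirror (z u0))" using u0 by simp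
  note left = m.right[OF u0(1) _ fm, unfolded mirror_simps(4)]
  note centre = z.centre[OF u0(1)]
  have z0: "lo (z u0) \<le> hi (z u0)" using z.z_in u0 lo_le_hi by simp
  have tri: "0 < lo (z u) \<or> 0 < - hi (z u) \<or> lo (z u) \<le> 0 \<and> 0 \<le> hi (z u)" for u by linarith
  consider "0 < lo (z u0)" | "hi (z u0) < 0" | "lo (z u0) \<le> 0" "0 \<le> hi (z u0)" by linarith
  then show thesis
  proof cases
    case 1
    have pos: "0 < lo (z u)" if "u0 \<le> u" for u
      using tri[of u] left(1)[OF that] centre(1)[OF that] 1 z0 by linarith
    show thesis
    proof (rule that[of \<i> "lo (z u0)" "lo (z u0)"])
      show "z u = chart (lo (z u0)) (1 + of_real (u - lo (z u0)) * \<i>)" if "u0 \<le> u" for u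
        unfolding right(1)[OF that pos[OF that]] by (rule right(2)[OF that pos[OF that]])
      show "lo (z u0) \<le> u0" by (rule right(3)[OF order_refl 1])
    qed simp_all
  next
    case 2
    have pos: "0 < - hi (z u)" if "u0 \<le> u" for u
      using tri[of u] right(1)[OF that] centre(2)[OF that] 2 z0 by linarith
    show thesis
    proof (rule that[of "- \<i>" "- hi (z u0)" "hi (z u0)"])
      show "z u = chart (hi (z u0)) (1 + of_real (u - (- hi (z u0))) * - \<i>)" if "u0 \<le> u" for u
      proof -
        have "mirror (z u) = chart (- hi (z u0)) (1 + of_real (u - (- hi (z u0))) * \<i>)"
          unfolding left(1)[OF that pos[OF that]] by (rule left(2)[OF that pos[OF that]])
        then have "mirror (mirror (z u)) = mirror (chart (- hi (z u0)) (1 + of_real (u - (- hi (z u0))) * \<i>))"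
          by (rule arg_cong)
        then show ?thesis unfolding mirror_chart mirror_simps(1) by simp
      qed
      show "- hi (z u0) \<le> u0" by (rule left(3)[OF order_refl pos[OF order_refl]])
    qed simp_all
  next
    case 3
    have vis: "lo (z u) \<le> 0" "0 \<le> hi (z u)" if "u0 \<le> u" for u
      using tri[of u] right(1)[OF that] left(1)[OF that] 3 by linarith+
    show thesis
    proof (rule that[of "(plane (z u0) - 1) / of_real u0" 0 0])
      show "z u = chart 0 (1 + of_real (u - 0) * ((plane (z u0) - 1) / of_real u0))" if "u0 \<le> u" for u
        unfolding diff_zero by (rule centre(3)[OF that vis[OF that]])
      show "cmod ((plane (z u0) - 1) / of_real u0) = 1" "0 \<le> Re ((plane (z u0) - 1) / of_real u0)"
        by (rule centre(4,5)[OF order_refl 3])+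
    qed (use u0 in simp)
  qed
qed

section \<open>Properness\<close>

lemma (in developing_space) compactin_image:
  fixes f :: "'b :: metric_space \<Rightarrow> 'a"
  assumes "compact K" "\<And>x. x \<in> K \<Longrightarrow> f x \<in> M"
    and cont: "\<And>x e. x \<in> K \<Longrightarrow> 0 < e \<Longrightarrow> \<exists>\<delta>>0. \<forall>y\<in>K. dist x y < \<delta> \<longrightarrow> d (f x) (f y) < e"
  shows "compactin (mtopology_of X) (f ` K)"
proof (rule image_compactin)
  let ?m = "submetric euclidean_metric K"
  have "mtopology_of ?m = subtopology euclidean K"
    by (simp add: mtopology_of_submetric)
  then show "compactin (mtopology_of ?m) K"
    using assms(1) by (simp add: compactin_subtopology)
  show "continuous_map (mtopology_of ?m) (mtopology_of X) f"
    unfolding mtopology_of_def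
      Metric_space.metric_continuous_map[OF Metric_space_mspace_mdist Metric_space_mspace_mdist]
  proof (intro conjI ballI allI impI)
    show "f ` mspace ?m \<subseteq> mspace X" using assms(2) by auto
    fix x and e :: real assume x: "x \<in> mspace ?m" and e: "0 < e"
    have xK: "x \<in> K" using x by simp
    obtain \<delta> where \<delta>: "\<delta> > 0" "\<And>y. y \<in> K \<Longrightarrow> dist x y < \<delta> \<Longrightarrow> d (f x) (f y) < e"
      using cont[OF xK e] by auto
    show "\<exists>\<delta>>0. \<forall>y. y \<in> mspace ?m \<and> mdist ?m x y < \<delta> \<longrightarrow> mdist X (f x) (f y) < e"
    proof (intro exI[of _ \<delta>] conjI allI impI)
      fix y assume y: "y \<in> mspace ?m \<and> mdist ?m x y < \<delta>"
      then have "y \<in> K" "dist x y < \<delta>" by simp_all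
      then show "mdist X (f x) (f y) < e" using \<delta>(2) assms(2) xK by simp
    qed (rule \<delta>)
  qed
qed

definition org :: pt where "org = (0, 0, 0)"

definition rim :: "real \<Rightarrow> real \<Rightarrow> pt" where
  "rim c = restrict (\<lambda>u. (0, 0, c * u)) {0..}"

lemma rim_apply: "0 \<le> u \<Longrightarrow> rim c u = (0, 0, c * u)"
  by (simp add: rim_def)

locale hairy_sheet = hairy sheet sdist p for p +
  assumes fst_p: "fst (p n) = real (Suc n)"
begin

abbreviation XX :: "pt metric" where "XX \<equiv> hairs.X"

definition tip :: "nat \<Rightarrow> real \<Rightarrow> pt" where
  "tip n h = (if h > 0 then (Suc n, h, 0) else (0, p n))"

definition len :: "nat \<Rightarrow> real" where
  "len n = sdist (0, 0) (p n)"

lemma zero_in [simp]: "(0, a) \<in> sheet"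
  by (simp add: sheet_def)

lemma org_in [simp]: "org \<in> H"
  by (simp add: org_def)

lemma tip_in [simp]: "tip n h \<in> H"
  using p_in by (auto simp: tip_def)

lemma hdist_zero [simp]: "hdist (0, x) (0, y) = sdist x y"
  by (simp add: hdist_def)

lemma hdist_tip_tip: "0 \<le> h \<Longrightarrow> 0 \<le> k \<Longrightarrow> hdist (tip n h) (tip n k) = \<bar>h - k\<bar>"
  using sheet.zero[OF p_in p_in] by (auto simp: hdist_def tip_def)

lemma hdist_tip:
  assumes "x \<in> H" "fst x \<noteq> Suc n" "0 \<le> h"
  shows "hdist x (tip n h) = hdist x (tip n 0) + h"
  using assms by (auto simp: hdist_def tip_def)

lemma tip_cases: "x \<in> H \<Longrightarrow> fst x = Suc n \<Longrightarrow> \<exists>h>0. x = tip n h"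
  by (cases x) (auto simp: H_def tip_def)

lemma fst_org [simp]: "fst org \<noteq> Suc n"
  by (simp add: org_def)

lemma hdist_org_tip: "0 \<le> h \<Longrightarrow> hdist org (tip n h) = len n + h"
  using hdist_tip[of org n h] by (simp add: org_def len_def tip_def)

lemma len_ge: "real n \<le> len n"
  using sdist_ge_radius[of "(0, 0)" "p n"] le_radius[of "p n"] p_in fst_p[of n] by (simp add: len_def radius_def)

lemma proper: "proper_space XX"
  unfolding proper_space_def
proof (intro ballI allI)
  fix x r assume "x \<in> mspace XX"
  then have x: "x \<in> H" by simp
  define R where "R = hdist org x + r"
  define K where "K = Pair 0 ` cbox (0, - R) (R + 2, R) \<union> (\<Union>n\<in>{n. real n \<le> R}. tip n ` {0..R})"
  have in_sheet: "v \<in> sheet" if "v \<in> cbox (0, - R) (R + 2, R)" for v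
    using that by (cases v) (auto simp: sheet_def cbox_Pair_eq)
  have "finite {n. real n \<le> R}"
  proof (rule finite_subset)
    show "{n. real n \<le> R} \<subseteq> {..nat \<lceil>R\<rceil>}" by (auto simp: le_nat_iff) linarith
  qed simp
  moreover have "compactin (mtopology_of XX) (tip n ` {0..R})" for n
  proof (rule hairs.compactin_image)
    show "\<exists>\<delta>>0. \<forall>y\<in>{0..R}. dist x y < \<delta> \<longrightarrow> hdist (tip n x) (tip n y) < e" if "x \<in> {0..R}" "0 < e" for x e
      using that by (intro exI[of _ e]) (auto simp: hdist_tip_tip dist_real_def)
  qed auto
  moreover have "compactin (mtopology_of XX) (Pair 0 ` cbox (0, - R) (R + 2, R))"
  proof (rule hairs.compactin_image)
    show "\<exists>\<delta>>0. \<forall>y\<in>cbox (0, - R) (R + 2, R). dist x y < \<delta> \<longrightarrow> hdist (0, x) (0, y) < e"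
      if x: "x \<in> cbox (0, - R) (R + 2, R)" and e: "0 < e" for x e
    proof -
      have "continuous_on UNIV (\<lambda>y. \<bar>radius x - radius y\<bar> + radius x * \<bar>snd x - snd y\<bar>)"
        unfolding radius_def by (intro continuous_intros)
      then have "isCont (\<lambda>y. \<bar>radius x - radius y\<bar> + radius x * \<bar>snd x - snd y\<bar>) x"
        using continuous_on_eq_continuous_at[OF open_UNIV] by blast
      then obtain \<delta> where \<delta>: "\<delta> > 0" "\<And>y. dist y x < \<delta> \<Longrightarrow>
          dist (\<bar>radius x - radius y\<bar> + radius x * \<bar>snd x - snd y\<bar>) 0 < e"
        using e unfolding continuous_at_eps_delta by (metis abs_zero add.right_neutral diff_self mult_zero_right)
      have "sdist x y < e" if y: "y \<in> cbox (0, - R) (R + 2, R)" "dist x y < \<delta>" for y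
      proof -
        have "sdist x y \<le> \<bar>radius x - radius y\<bar> + min (radius x) (radius y) * \<bar>snd x - snd y\<bar>"
          using sdist_le_polar in_sheet x y by blast
        also have "\<dots> \<le> \<bar>radius x - radius y\<bar> + radius x * \<bar>snd x - snd y\<bar>"
          by (intro add_left_mono mult_right_mono) auto
        also have "\<dots> < e" using \<delta>(2)[of y] y(2) by (simp add: dist_commute)
        finally show ?thesis .
      qed
      then show ?thesis using \<delta>(1) by auto
    qed
  qed (use in_sheet in auto)
  ultimately have "compactin (mtopology_of XX) K"
    unfolding K_def by (intro compactin_Un compactin_Union) auto
  moreover have "mcball_of XX x r \<subseteq> K"
  proof
    fix y assume "y \<in> mcball_of XX x r"
    then have "y \<in> H" "mdist XX x y \<le> r" unfolding in_mcball_of hairs.mspace_X by blast+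
    then have y: "y \<in> H" "hdist x y \<le> r" using x by simp_all
    have R: "hdist org y \<le> R" using hairs.triangle[of org x y] x y by (simp add: R_def)
    show "y \<in> K"
    proof (cases "fst y")
      case 0
      then obtain v where v: "y = (0, v)" by (metis prod.collapse)
      then have vs: "v \<in> sheet" "sdist (0, 0) v \<le> R" using y R by (auto simp: org_def)
      have "0 \<le> fst v" "\<bar>snd v\<bar> + \<bar>fst v - arctan (fst v)\<bar> \<le> R"
        using sdist_ge_bus[of "(0, 0)" v] vs by (auto simp: sheet_def)
      moreover have "arctan (fst v) < 2" using arctan_ubound[of "fst v"] pi_less_4 by linarith
      ultimately have "v \<in> cbox (0, - R) (R + 2, R)" by (cases v) (auto simp: cbox_Pair_eq)
      then show ?thesis by (simp add: K_def v)
    next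
      case (Suc n)
      then obtain h where h: "h > 0" "y = tip n h" using tip_cases y by blast
      then have "len n + h \<le> R" using R hdist_org_tip[of h n] by simp
      then have "real n \<le> R" "h \<in> {0..R}" using len_ge[of n] h by auto
      then show ?thesis using h by (auto simp: K_def)
    qed
  qed
  moreover have "closedin (mtopology_of XX) (mcball_of XX x r)"
    unfolding mtopology_of_def mcball_of_def by (rule Metric_space.closedin_mcball[OF Metric_space_mspace_mdist])
  ultimately show "compactin (mtopology_of XX) (mcball_of XX x r)" by (rule closed_compactin)
qed

section \<open>The contracting rays\<close>

lemma ray_iff:
  "\<gamma> \<in> geodesic_rays XX org \<longleftrightarrow> \<gamma> \<in> extensional {0..} \<and> (\<forall>u\<ge>0. \<gamma> u \<in> H) \<and>
    (\<forall>u\<ge>0. \<forall>v\<ge>0. hdist (\<gamma> u) (\<gamma> v) = \<bar>u - v\<bar>) \<and> \<gamma> 0 = org"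
proof -
  have "isometric_on XX {0..} \<gamma> \<longleftrightarrow> (\<forall>u\<ge>0. \<gamma> u \<in> H) \<and> (\<forall>u\<ge>0. \<forall>v\<ge>0. hdist (\<gamma> u) (\<gamma> v) = \<bar>u - v\<bar>)"
    unfolding isometric_on_def Pi_iff Ball_def atLeast_iff hairs.mspace_X
    by (intro conj_cong refl all_cong1 imp_cong) (simp add: hairs.mdist_X)
  then show ?thesis unfolding geodesic_rays_def by blast
qed

context
  fixes \<gamma>
  assumes \<gamma>: "\<gamma> \<in> geodesic_rays XX org"
begin

lemma ray_ext: "\<gamma> \<in> extensional {0..}" and ray_in: "0 \<le> u \<Longrightarrow> \<gamma> u \<in> H"
  and ray_iso: "0 \<le> u \<Longrightarrow> 0 \<le> v \<Longrightarrow> hdist (\<gamma> u) (\<gamma> v) = \<bar>u - v\<bar>" and ray_0: "\<gamma> 0 = org"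
  using \<gamma>[unfolded ray_iff] by blast+

lemma ray_org: "0 \<le> u \<Longrightarrow> hdist org (\<gamma> u) = u"
  using ray_iso[of 0 u] ray_0 by simp

lemma ray_image_subset: "ray_image \<gamma> \<subseteq> H"
  unfolding ray_image_def using ray_in by auto

end

lemma ray_agree:
  assumes "\<gamma> \<in> geodesic_rays XX org" "\<gamma>' \<in> geodesic_rays XX org" "\<gamma> v = \<gamma>' v" "0 \<le> u" "u \<le> v"
  shows "\<gamma> u = \<gamma>' u"
proof (rule hairs.geodesic_unique[of org "\<gamma> v"])
  show "hdist org (\<gamma> u) = hdist org (\<gamma>' u)" using ray_org assms by simp
  show "hdist (\<gamma> u) (\<gamma> v) = hdist (\<gamma>' u) (\<gamma> v)"
    using ray_iso[OF assms(1), of u v] ray_iso[OF assms(2), of u v] assms(3-5) by simp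
  show "hdist org (\<gamma> u) + hdist (\<gamma> u) (\<gamma> v) = hdist org (\<gamma> v)"
    using ray_iso[OF assms(1), of u v] ray_org[OF assms(1)] assms(4,5) by simp
qed (use ray_in assms in auto)

lemma ray_eqI:
  assumes "\<gamma> \<in> geodesic_rays XX org" "\<gamma>' \<in> geodesic_rays XX org" "\<And>u. 0 \<le> u \<Longrightarrow> \<gamma> u = \<gamma>' u"
  shows "\<gamma> = \<gamma>'"
  using assms ray_ext by (intro extensionalityI[of \<gamma> "{0..}" \<gamma>']) auto

lemma rim_ray:
  assumes "\<bar>c\<bar> = 1"
  shows "rim c \<in> geodesic_rays XX org"
  unfolding ray_iff
proof (intro conjI allI impI)
  show "rim c \<in> extensional {0..}" by (simp add: rim_def)
  fix u v :: real assume "0 \<le> u" "0 \<le> v"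
  moreover have "\<bar>c * u - c * v\<bar> = \<bar>u - v\<bar>"
    using assms by (metis abs_mult mult_1 right_diff_distrib)
  ultimately show "hdist (rim c u) (rim c v) = \<bar>u - v\<bar>" by (simp add: rim_apply sdist_circle)
qed (auto simp: rim_apply org_def)

lemma spoke_exists: "\<exists>\<gamma>. \<gamma> \<in> geodesic_rays XX org \<and> (\<forall>h\<ge>0. \<gamma> (len n + h) = tip n h)"
proof -
  have L: "0 \<le> len n" using sdist_nonneg p_in by (simp add: len_def)
  have dl: "hdist org (tip n 0) = len n" using hdist_org_tip[of 0 n] by simp
  obtain S where "geodesic_segment XX org (tip n 0) S" using hairs.geodesic_segment_exists tip_in org_in by blast
  then obtain c where c: "isometric_on XX {0..len n} c" "c 0 = org" "c (len n) = tip n 0"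
    unfolding geodesic_segment_def by (auto simp: dl)
  have cH: "c u \<in> H" if "u \<in> {0..len n}" for u using c(1) that unfolding isometric_on_def by auto
  have ciso: "hdist (c u) (c v) = \<bar>u - v\<bar>" if "u \<in> {0..len n}" "v \<in> {0..len n}" for u v
  proof -
    have "mdist XX (c u) (c v) = \<bar>u - v\<bar>" using c(1) that unfolding isometric_on_def by blast
    then show ?thesis using cH that by simp
  qed
  define \<gamma> where "\<gamma> = restrict (\<lambda>u. if u \<le> len n then c u else tip n (u - len n)) {0..}"
  have lo: "\<gamma> u = c u" if "0 \<le> u" "u \<le> len n" for u using that by (simp add: \<gamma>_def)
  have hi: "\<gamma> (len n + h) = tip n h" if "0 \<le> h" for h
    using that L c(3) by (cases "h = 0") (auto simp: \<gamma>_def)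
  have not_hair: "fst (c u) \<noteq> Suc n" if u: "u \<in> {0..len n}" for u
  proof
    assume "fst (c u) = Suc n"
    then obtain h where h: "h > 0" "c u = tip n h" using tip_cases cH u by blast
    have "hdist org (c u) = u" using ciso[of 0 u] u c(2) L by simp
    then show False using hdist_org_tip[of h n] h u by simp
  qed
  have mixed: "hdist (\<gamma> u) (\<gamma> (len n + h)) = \<bar>u - (len n + h)\<bar>" if "0 \<le> u" "u \<le> len n" "0 \<le> h" for u h
    using hdist_tip[of "c u" n h] not_hair[of u] cH[of u] ciso[of u "len n"] that c(3) lo hi by simp
  have "hdist (\<gamma> u) (\<gamma> v) = \<bar>u - v\<bar>" if uv: "0 \<le> u" "0 \<le> v" for u v
  proof -
    have \<gamma>H: "\<gamma> w \<in> H" if "0 \<le> w" for w using that cH by (simp add: \<gamma>_def)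
    consider "u \<le> len n" "v \<le> len n" | "u \<le> len n" "len n \<le> v" | "len n \<le> u" "v \<le> len n" | "len n \<le> u" "len n \<le> v"
      by linarith
    then show ?thesis
    proof cases
      case 1
      then show ?thesis using lo ciso uv by simp
    next
      case 2
      then show ?thesis using mixed[of u "v - len n"] uv by simp
    next
      case 3
      then show ?thesis using mixed[of v "u - len n"] hairs.sym[OF \<gamma>H \<gamma>H, of u v] uv by simp
    next
      case 4
      then show ?thesis using hi[of "u - len n"] hi[of "v - len n"] hdist_tip_tip[of "u - len n" "v - len n" n] by simp
    qed
  qed
  then have "\<gamma> \<in> geodesic_rays XX org"
    unfolding ray_iff using lo[of 0] c(2) L cH by (auto simp: \<gamma>_def)
  then show ?thesis using hi by blast
qed

definition spoke :: "nat \<Rightarrow> real \<Rightarrow> pt" where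
  "spoke n = (SOME \<gamma>. \<gamma> \<in> geodesic_rays XX org \<and> (\<forall>h\<ge>0. \<gamma> (len n + h) = tip n h))"

lemma spoke_ray: "spoke n \<in> geodesic_rays XX org"
  and spoke_tip: "0 \<le> h \<Longrightarrow> spoke n (len n + h) = tip n h"
  using someI_ex[OF spoke_exists[of n]] unfolding spoke_def by blast+

lemma len_nonneg: "0 \<le> len n"
  using len_ge[of n] by linarith

lemma hdist_base_rim: "x \<in> H \<Longrightarrow> 0 \<le> u \<Longrightarrow> hdist x (rim c u) = height x + sdist (base x) (0, c * u)"
  by (simp add: rim_apply hdist_def)

lemma rim_proj_angle:
  assumes c: "\<bar>c\<bar> = 1" and x: "x \<in> H" and a: "a \<in> proj XX (ray_image (rim c)) x"
  obtains u where "0 \<le> u" "a = rim c u" "\<bar>u - max (c * snd (base x)) 0\<bar> \<le> pi / 2"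
proof -
  note sub = ray_image_subset[OF rim_ray[OF c]]
  obtain u where u: "0 \<le> u" "a = rim c u"
    using hairs.in_projD(1)[OF a sub x] unfolding ray_image_def by auto
  define \<phi> where "\<phi> = c * snd (base x)"
  have cc: "c * c = 1" using c by (metis abs_mult_self_eq mult_1)
  have ang: "\<bar>snd (base x) - c * v\<bar> = \<bar>\<phi> - v\<bar>" for v
  proof -
    have "\<bar>snd (base x) - c * v\<bar> = \<bar>c * (snd (base x) - c * v)\<bar>" using c by (simp only: abs_mult) simp
    also have "c * (snd (base x) - c * v) = \<phi> - v" using cc by (simp add: \<phi>_def right_diff_distrib flip: mult.assoc)
    finally show ?thesis .
  qed
  have b: "base x \<in> sheet" using base_in x by blast
  then have s: "0 \<le> fst (base x)" by (simp add: sheet_def)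
  have "hdist x a \<le> hdist x (rim c (max \<phi> 0))"
    by (rule hairs.in_projD(2)[OF a sub x]) (auto simp: ray_image_def)
  then have "sdist (base x) (0, c * u) \<le> sdist (base x) (0, c * max \<phi> 0)"
    using hdist_base_rim[OF x] u by simp
  moreover have "\<bar>\<phi> - u\<bar> + (fst (base x) - arctan (fst (base x))) \<le> sdist (base x) (0, c * u)"
    using sdist_ge_bus[of "base x" "(0, c * u)"] b ang[of u] by (simp add: sheet_def)
  moreover have "sdist (base x) (0, c * max \<phi> 0) \<le> fst (base x) + \<bar>\<phi> - max \<phi> 0\<bar>"
    using sdist_le_sum[of "base x" "(0, c * max \<phi> 0)"] b ang[of "max \<phi> 0"] by (simp add: sheet_def)
  ultimately have "\<bar>\<phi> - u\<bar> \<le> \<bar>\<phi> - max \<phi> 0\<bar> + pi / 2" using arctan_ubound[of "fst (base x)"] by linarith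
  then have "\<bar>u - max \<phi> 0\<bar> \<le> pi / 2"
  proof (cases "0 \<le> \<phi>")
    case True
    then show ?thesis using \<open>\<bar>\<phi> - u\<bar> \<le> _\<close> by (simp add: max_def abs_minus_commute)
  next
    case False
    then show ?thesis using \<open>\<bar>\<phi> - u\<bar> \<le> _\<close> u(1) by (simp add: max_def)
  qed
  then show thesis using that u by (simp add: \<phi>_def)
qed

lemma rim_contracting:
  assumes c: "\<bar>c\<bar> = 1"
  shows "contracting XX (rim c)"
proof (rule hairs.contractingI)
  note sub = ray_image_subset[OF rim_ray[OF c]]
  show "ray_image (rim c) \<subseteq> H" by (rule sub)
  fix x y a b
  assume xy: "x \<in> H" "y \<in> H" "hdist x y \<le> dist_to_set XX x (ray_image (rim c))"
    and a: "a \<in> proj XX (ray_image (rim c)) x \<union> proj XX (ray_image (rim c)) y"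
    and b: "b \<in> proj XX (ray_image (rim c)) x \<union> proj XX (ray_image (rim c)) y"
  define f where "f z = max (c * snd (base z)) 0" for z
  have xs: "base x \<in> sheet" "base y \<in> sheet" using base_in xy by blast+
  then have s: "0 \<le> fst (base x)" "0 \<le> fst (base y)" by (auto simp: sheet_def)
  have ang: "\<bar>c * snd (base x) - c * snd (base y)\<bar> = \<bar>snd (base x) - snd (base y)\<bar>"
    using c by (simp only: abs_mult right_diff_distrib[symmetric]) simp
  have "\<bar>f x - f y\<bar> \<le> pi"
  proof (cases "fst x = fst y \<and> fst x \<noteq> 0")
    case True
    then show ?thesis using same_base[of x y] by (simp add: f_def)
  next
    case False
    have cc: "c * c = 1" using c by (metis abs_mult_self_eq mult_1)
    have "hdist x y \<le> hdist x (rim c (f x))"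
      by (rule order_trans[OF xy(3) hairs.dist_to_set_le[OF sub xy(1)]]) (auto simp: ray_image_def f_def)
    also have "\<dots> = height x + sdist (base x) (0, c * f x)" using hdist_base_rim[OF xy(1)] by (simp add: f_def)
    finally have "hdist x y \<le> height x + sdist (base x) (0, c * f x)" .
    moreover have "hdist x y = height x + height y + sdist (base x) (base y)" using False by (auto simp: hdist_def)
    ultimately have "sdist (base x) (base y) \<le> sdist (base x) (0, c * f x)"
      using height_nonneg[OF xy(2)] by linarith
    also have "\<dots> \<le> fst (base x) + \<bar>snd (base x) - c * f x\<bar>"
      using sdist_le_sum[of "base x" "(0, c * f x)"] xs by (simp add: sheet_def)
    also have "\<bar>snd (base x) - c * f x\<bar> = \<bar>c * (snd (base x) - c * f x)\<bar>" using c by (simp only: abs_mult) simp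
    also have "c * (snd (base x) - c * f x) = c * snd (base x) - f x"
      using cc by (simp add: right_diff_distrib flip: mult.assoc)
    finally have d: "sdist (base x) (base y) \<le> fst (base x) + \<bar>c * snd (base x) - f x\<bar>" .
    have "\<bar>c * snd (base x) - c * snd (base y)\<bar> \<le> pi + \<bar>c * snd (base x) - f x\<bar>"
    proof (cases "visible (base x) (base y)")
      case True
      then show ?thesis using visible_iff_angle[OF xs] ang arctan_ubound[of "fst (base x)"] arctan_ubound[of "fst (base y)"]
        by linarith
    next
      case nv: False
      show ?thesis using sdist_not_visible[OF xs nv] d ang arctan_ubound[of "fst (base x)"]
          arctan_le_self[OF s(2)] pi_gt_zero by linarith
    qed
    then show ?thesis unfolding f_def by (auto simp: max_def split: if_splits)
  qed
  moreover have "\<exists>u\<ge>0. a = rim c u \<and> (\<bar>u - f x\<bar> \<le> pi / 2 \<or> \<bar>u - f y\<bar> \<le> pi / 2)"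
    if "a \<in> proj XX (ray_image (rim c)) x \<union> proj XX (ray_image (rim c)) y" for a
    using that rim_proj_angle[OF c xy(1), of a] rim_proj_angle[OF c xy(2), of a] unfolding f_def by blast
  then obtain u v where "0 \<le> u" "a = rim c u" "\<bar>u - f x\<bar> \<le> pi / 2 \<or> \<bar>u - f y\<bar> \<le> pi / 2"
    "0 \<le> v" "b = rim c v" "\<bar>v - f x\<bar> \<le> pi / 2 \<or> \<bar>v - f y\<bar> \<le> pi / 2" using a b by meson
  ultimately have "\<bar>u - v\<bar> \<le> 2 * pi" by (elim disjE) linarith+
  then show "hdist a b \<le> 2 * pi"
    using ray_iso[OF rim_ray[OF c], of u v] \<open>0 \<le> u\<close> \<open>0 \<le> v\<close> \<open>a = _\<close> \<open>b = _\<close> by simp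
qed

lemma spoke_contracting: "contracting XX (spoke n)"
proof (rule hairs.contractingI)
  note sub = ray_image_subset[OF spoke_ray[of n]]
  let ?A = "ray_image (spoke n)"
  show "?A \<subseteq> H" by (rule sub)
  have tip_A: "tip n h \<in> ?A" if "0 \<le> h" for h
    using spoke_tip[OF that, of n] that len_nonneg[of n] unfolding ray_image_def
    by (metis add_nonneg_nonneg atLeast_iff image_eqI)
  fix x y a b
  assume xy: "x \<in> H" "y \<in> H" "hdist x y \<le> dist_to_set XX x ?A"
    and ab: "a \<in> proj XX ?A x \<union> proj XX ?A y" "b \<in> proj XX ?A x \<union> proj XX ?A y"
  have near: "\<exists>u. 0 \<le> u \<and> u \<le> len n \<and> a = spoke n u" if z: "z \<in> H" "fst z \<noteq> Suc n" and a: "a \<in> proj XX ?A z" for a z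
  proof -
    obtain u where u: "0 \<le> u" "a = spoke n u" using hairs.in_projD(1)[OF a sub z(1)] unfolding ray_image_def by auto
    have "hdist z a \<le> hdist z (tip n 0)" by (rule hairs.in_projD(2)[OF a sub z(1) tip_A]) simp
    moreover have "hdist z a = hdist z (tip n 0) + (u - len n)" if "len n \<le> u"
      using hdist_tip[OF z, of "u - len n"] spoke_tip[of "u - len n" n] u that by simp
    ultimately have "u \<le> len n" by linarith
    then show ?thesis using u by blast
  qed
  show "hdist a b \<le> len n"
  proof (cases "fst x = Suc n")
    case True
    then obtain h where h: "0 < h" "x = tip n h" using tip_cases xy by blast
    then have "dist_to_set XX x ?A \<le> hdist x x" using hairs.dist_to_set_le[OF sub xy(1)] tip_A[of h] by simp
    then have "hdist x y = 0" "hdist x x = 0" using xy hairs.zero[of x x] hairs.nonneg[of x y] by simp_all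
    then have "y = x" using hairs.zero xy by blast
    then have ab': "a \<in> proj XX ?A x" "b \<in> proj XX ?A x" using ab by auto
    have "c = x" if c: "c \<in> proj XX ?A x" for c
    proof -
      have "c \<in> H" using hairs.in_projD(1)[OF c sub xy(1)] sub by blast
      moreover have "hdist x c \<le> 0"
        using hairs.in_projD(2)[OF c sub xy(1), of x] h tip_A[of h] \<open>hdist x x = 0\<close> by simp
      ultimately show ?thesis using hairs.zero[of x c] hairs.nonneg[of x c] xy(1) by auto
    qed
    then have "a = x" "b = x" using ab' by blast+
    then show ?thesis using \<open>hdist x x = 0\<close> len_nonneg by simp
  next
    case False
    have "fst y \<noteq> Suc n"
    proof
      assume "fst y = Suc n"
      then obtain h where h: "0 < h" "y = tip n h" using tip_cases xy by blast
      have "dist_to_set XX x ?A \<le> hdist x (tip n 0)" using hairs.dist_to_set_le[OF sub xy(1)] tip_A[of 0] by simp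
      then show False using xy(3) h hdist_tip[OF xy(1) False, of h] by simp
    qed
    then obtain u v where "0 \<le> u" "u \<le> len n" "a = spoke n u" "0 \<le> v" "v \<le> len n" "b = spoke n v"
      using near[OF xy(1) False] near[OF xy(2)] ab by blast
    then show ?thesis using ray_iso[OF spoke_ray, of u v n] by auto
  qed
qed

end

context hairy_sheet
begin

text \<open>A ray that ends in a straight line bounds a Euclidean half-plane, and the projection of a
  parallel line to it is an isometry.\<close>

lemma straight_not_contracting:
  assumes \<gamma>: "\<gamma> \<in> geodesic_rays XX org" and w: "cmod w = 1" "0 \<le> Re w" and c: "c \<le> u0" "0 \<le> u0"
    and straight: "\<And>u. u0 \<le> u \<Longrightarrow> \<gamma> u = (0, chart k (1 + of_real (u - c) * w))"
  shows "\<not> contracting XX \<gamma>"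
proof (rule hairs.not_contractingI)
  fix r :: real assume r: "0 < r"
  define \<epsilon> :: real where "\<epsilon> = (if Im w \<le> 0 then 1 else -1)"
  define n where "n = of_real \<epsilon> * \<i> * w"
  have n: "0 \<le> Re n" by (simp add: n_def \<epsilon>_def)
  have norm: "cmod (of_real a * w + of_real b * n) = sqrt (a\<^sup>2 + b\<^sup>2)" for a b :: real
  proof -
    have "of_real a * w + of_real b * n = Complex a (\<epsilon> * b) * w"
      by (simp add: n_def complex_eq_iff algebra_simps)
    moreover have "cmod (Complex a (\<epsilon> * b)) = sqrt (a\<^sup>2 + b\<^sup>2)" by (simp add: cmod_def \<epsilon>_def)
    ultimately show ?thesis using w by (simp add: norm_mult)
  qed
  define q where "q v b = chart k (1 + of_real (v - c) * w + of_real b * n)" for v b :: real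
  have Re: "Re (1 + of_real (v - c) * w + of_real b * n) \<ge> 1" if "u0 \<le> v" "0 \<le> b" for v b
    using that c w n by simp
  have q_in: "(0, q v b) \<in> H" if "u0 \<le> v" "0 \<le> b" for v b
    using chart_in_sheet[OF Re[OF that]] by (simp add: q_def)
  have q_dist: "hdist (0, q v b) (0, q v' b') = sqrt ((v - v')\<^sup>2 + (b - b')\<^sup>2)"
    if "u0 \<le> v" "0 \<le> b" "u0 \<le> v'" "0 \<le> b'" for v b v' b'
  proof -
    have "hdist (0, q v b) (0, q v' b') = cmod ((1 + of_real (v - c) * w + of_real b * n) - (1 + of_real (v' - c) * w + of_real b' * n))"
      unfolding q_def hdist_zero by (intro sdist_chart Re that)
    also have "(1 + of_real (v - c) * w + of_real b * n) - (1 + of_real (v' - c) * w + of_real b' * n) =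
        of_real (v - v') * w + of_real (b - b') * n" by (simp add: algebra_simps)
    finally show ?thesis unfolding norm .
  qed
  have \<gamma>q: "\<gamma> u = (0, q u 0)" if "u0 \<le> u" for u using straight[OF that] by (simp add: q_def)
  have proj: "proj XX (ray_image \<gamma>) (0, q T r) = {\<gamma> T}" "dist_to_set XX (0, q T r) (ray_image \<gamma>) = r"
    if T: "2 * u0 + r < T" for T
  proof -
    have T0: "u0 \<le> T" using T r c by linarith
    have dT: "hdist (0, q T r) (\<gamma> T) = r" using q_dist[of T r T 0] \<gamma>q[OF T0] T0 r by simp
    have far: "r < hdist (0, q T r) b" if b: "b \<in> ray_image \<gamma>" "b \<noteq> \<gamma> T" for b
    proof -
      obtain v where v: "0 \<le> v" "b = \<gamma> v" using b(1) unfolding ray_image_def by auto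
      show ?thesis
      proof (cases "u0 \<le> v")
        case True
        have "v \<noteq> T" using v b by blast
        then have "r\<^sup>2 < (T - v)\<^sup>2 + r\<^sup>2" by simp
        then have "r < sqrt ((T - v)\<^sup>2 + r\<^sup>2)" by (rule real_less_rsqrt)
        then show ?thesis using q_dist[of T r v 0] \<gamma>q[OF True] v T0 True r by simp
      next
        case False
        have "T - u0 \<le> sqrt ((T - u0)\<^sup>2 + r\<^sup>2)" by (rule real_le_rsqrt) simp
        also have "\<dots> = hdist (0, q T r) (\<gamma> u0)" using q_dist[of T r u0 0] \<gamma>q[of u0] T0 r by simp
        also have "\<dots> \<le> hdist (0, q T r) (\<gamma> v) + hdist (\<gamma> v) (\<gamma> u0)"
          using hairs.triangle[OF q_in[OF T0] ray_in[OF \<gamma>] ray_in[OF \<gamma>]] r v c by simp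
        also have "hdist (\<gamma> v) (\<gamma> u0) = u0 - v" using ray_iso[OF \<gamma> v(1) c(2)] False by simp
        finally show ?thesis using T v by simp
      qed
    qed
    have sub: "ray_image \<gamma> \<subseteq> H" by (rule ray_image_subset[OF \<gamma>])
    have qT: "(0, q T r) \<in> H" using q_in T0 r by simp
    have mem: "\<gamma> T \<in> ray_image \<gamma>" using T0 c by (auto simp: ray_image_def)
    note * = hairs.proj_eq_singleton[OF sub qT mem, unfolded dT, OF far]
    show "proj XX (ray_image \<gamma>) (0, q T r) = {\<gamma> T}" "dist_to_set XX (0, q T r) (ray_image \<gamma>) = r"
      by (rule *; assumption)+
  qed
  define T where "T = 2 * u0 + r + 1"
  have T: "2 * u0 + r < T" "2 * u0 + r < T + r" "u0 \<le> T" "u0 \<le> T + r" "0 \<le> T"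
    using r c by (simp_all add: T_def)
  show "\<exists>x y a b. x \<in> H \<and> y \<in> H \<and> a \<in> H \<and> b \<in> H \<and> hdist x y \<le> r \<and> dist_to_set XX x (ray_image \<gamma>) = r \<and>
      proj XX (ray_image \<gamma>) x = {a} \<and> proj XX (ray_image \<gamma>) y = {b} \<and> r \<le> hdist a b"
  proof (intro exI conjI)
    show "(0, q T r) \<in> H" "(0, q (T + r) r) \<in> H" "\<gamma> T \<in> H" "\<gamma> (T + r) \<in> H"
      using q_in ray_in[OF \<gamma>] T r by simp_all
    show "hdist (0, q T r) (0, q (T + r) r) \<le> r" using q_dist[of T r "T + r" r] T r by simp
    show "r \<le> hdist (\<gamma> T) (\<gamma> (T + r))" using ray_iso[OF \<gamma>, of T "T + r"] T r by simp
  qed (use proj T in auto)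
qed

lemma ray_through_hair:
  assumes \<gamma>: "\<gamma> \<in> geodesic_rays XX org" and v: "0 \<le> v" "fst (\<gamma> v) = Suc n"
  shows "\<gamma> = spoke n"
proof -
  obtain h where h: "h > 0" "\<gamma> v = tip n h" using tip_cases ray_in[OF \<gamma>] v by blast
  have vh: "v = len n + h" using ray_org[OF \<gamma> v(1)] hdist_org_tip[of h n] h by simp
  have above: "\<gamma> u = spoke n u" if u: "v \<le> u" for u
  proof -
    have u0: "0 \<le> u" using u v by simp
    have "fst (\<gamma> u) = Suc n"
    proof (rule ccontr)
      assume not: "fst (\<gamma> u) \<noteq> Suc n"
      have "hdist (\<gamma> u) (tip n h) = u - v" using ray_iso[OF \<gamma> u0 v(1)] u unfolding h(2) by simp
      moreover have "hdist (\<gamma> u) (tip n h) = hdist (\<gamma> u) (tip n 0) + h"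
        by (rule hdist_tip[OF ray_in[OF \<gamma> u0] not less_imp_le[OF h(1)]])
      moreover have "hdist org (\<gamma> u) \<le> hdist org (tip n 0) + hdist (tip n 0) (\<gamma> u)"
        by (rule hairs.triangle[OF org_in tip_in ray_in[OF \<gamma> u0]])
      moreover have "hdist (tip n 0) (\<gamma> u) = hdist (\<gamma> u) (tip n 0)"
        by (rule hairs.sym[OF tip_in ray_in[OF \<gamma> u0]])
      ultimately show False using ray_org[OF \<gamma> u0] hdist_org_tip[of 0 n] vh h(1) by linarith
    qed
    then obtain k where k: "k > 0" "\<gamma> u = tip n k" using tip_cases ray_in[OF \<gamma> u0] by blast
    then have "u = len n + k" using ray_org[OF \<gamma> u0] hdist_org_tip[of k n] by simp
    then show ?thesis using spoke_tip[of k n] k by simp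
  qed
  show ?thesis
  proof (rule ray_eqI[OF \<gamma> spoke_ray])
    fix u :: real assume "0 \<le> u"
    then show "\<gamma> u = spoke n u"
      using above[of u] ray_agree[OF \<gamma> spoke_ray above[OF order_refl], of u] by (cases "v \<le> u") auto
  qed
qed

lemma contracting_ray_cases:
  assumes "\<gamma> \<in> contracting_rays XX org"
  obtains "\<gamma> = rim 1" | "\<gamma> = rim (- 1)" | n where "\<gamma> = spoke n"
proof -
  have \<gamma>: "\<gamma> \<in> geodesic_rays XX org" and con: "contracting XX \<gamma>" using assms by (auto simp: contracting_rays_def)
  show thesis
  proof (cases "\<exists>v\<ge>0. fst (\<gamma> v) \<noteq> 0")
    case True
    then obtain v n where "0 \<le> v" "fst (\<gamma> v) = Suc n" using not0_implies_Suc by blast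
    then show thesis using ray_through_hair[OF \<gamma>] that by blast
  next
    case False
    define z where "z u = snd (\<gamma> u)" for u
    have z: "\<gamma> u = (0, z u)" if "0 \<le> u" for u using False that by (auto simp: z_def prod_eq_iff)
    interpret z: sheet_ray z
    proof
      show "0 \<le> u \<Longrightarrow> z u \<in> sheet" for u using ray_in[OF \<gamma>, of u] z[of u] by simp
      show "0 \<le> u \<Longrightarrow> 0 \<le> v \<Longrightarrow> sdist (z u) (z v) = \<bar>u - v\<bar>" for u v
        using ray_iso[OF \<gamma>, of u v] z[of u] z[of v] by simp
      show "z 0 = (0, 0)" using ray_0[OF \<gamma>] by (simp add: z_def org_def)
    qed
    show thesis
    proof (cases "\<exists>u>0. fst (z u) > 0")
      case True
      then obtain u0 where u0: "0 < u0" "0 < fst (z u0)" by blast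
      show thesis
      proof (rule sheet_ray_straight[OF z.sheet_ray_axioms u0])
        fix k c w
        assume kcw: "cmod w = 1" "0 \<le> Re w" "c \<le> u0"
          "\<And>u. u0 \<le> u \<Longrightarrow> z u = chart k (1 + of_real (u - c) * w)"
        have "\<gamma> u = (0, chart k (1 + of_real (u - c) * w))" if "u0 \<le> u" for u
          unfolding kcw(4)[OF that, symmetric] by (rule z) (use u0 that in linarith)
        from straight_not_contracting[OF \<gamma> kcw(1-3) less_imp_le[OF u0(1)] this] con show thesis
          by contradiction
      qed
    next
      case False
      define f where "f u = snd (z u)" for u
      have zf: "z u = (0, f u)" if "0 \<le> u" for u
      proof -
        have "fst (z u) = 0"
        proof (cases "u = 0")
          case nz: False
          then have "\<not> fst (z u) > 0" using False that by auto
          then show ?thesis using z.z_in[OF that] by (simp add: sheet_def)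
        qed (simp add: z.z_0)
        then show ?thesis by (simp add: f_def prod_eq_iff)
      qed
      have f: "\<bar>f u - f v\<bar> = \<bar>u - v\<bar>" if "0 \<le> u" "0 \<le> v" for u v
        using z.z_iso[OF that] zf[OF that(1)] zf[OF that(2)] by (simp add: sdist_circle)
      have f0: "f 0 = 0" using z.z_0 by (simp add: f_def)
      have rim: "\<gamma> = rim (f 1)"
      proof (rule ray_eqI[OF \<gamma> rim_ray])
        show f1: "\<bar>f 1\<bar> = 1" using f[of 1 0] f0 by simp
        fix u :: real assume u: "0 \<le> u"
        have "\<bar>f u\<bar> = u" "\<bar>f u - f 1\<bar> = \<bar>u - 1\<bar>" using f[of u 0] f[of u 1] f0 u by simp_all
        then have "f u = f 1 * u" using f1 u by (auto simp: abs_if split: if_splits)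
        then show "\<gamma> u = rim (f 1) u" using z[OF u] zf[OF u] u by (simp add: rim_apply)
      qed
      have "f 1 = 1 \<or> f 1 = - 1" using f[of 1 0] f0 by simp linarith
      then show thesis using rim that by auto
    qed
  qed
qed

lemma rim_contracting_ray [simp]: "\<bar>c\<bar> = 1 \<Longrightarrow> rim c \<in> contracting_rays XX org"
  and spoke_contracting_ray [simp]: "spoke n \<in> contracting_rays XX org"
  using rim_ray rim_contracting spoke_ray spoke_contracting by (auto simp: contracting_rays_def)

lemma contracting_ray_ray: "\<gamma> \<in> contracting_rays XX org \<Longrightarrow> \<gamma> \<in> geodesic_rays XX org"
  by (simp add: contracting_rays_def)

section \<open>The contracting boundary\<close>

lemma gromov_product_ray:
  assumes "\<gamma> \<in> geodesic_rays XX org" "\<gamma>' \<in> geodesic_rays XX org" "0 \<le> i" "0 \<le> j"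
  shows "gromov_product XX org (\<gamma> i) (\<gamma>' j) = (i + j - hdist (\<gamma> i) (\<gamma>' j)) / 2"
proof -
  have "hdist (\<gamma> i) org = i" "hdist (\<gamma>' j) org = j"
    using ray_org[OF assms(1,3)] ray_org[OF assms(2,4)] ray_in[OF assms(1,3)] ray_in[OF assms(2,4)]
      hairs.sym[of "\<gamma> i" org] hairs.sym[of "\<gamma>' j" org] by simp_all
  then show ?thesis using ray_in[OF assms(1,3)] ray_in[OF assms(2,4)] by (simp add: gromov_product_def)
qed

lemma gromov_product_spoke:
  assumes "\<gamma> \<in> geodesic_rays XX org" "\<gamma> \<noteq> spoke n" "0 \<le> i" "0 \<le> j"
  shows "gromov_product XX org (\<gamma> i) (spoke n j) \<le> len n"
proof -
  have eq: "gromov_product XX org (\<gamma> i) (spoke n j) = (i + j - hdist (\<gamma> i) (spoke n j)) / 2"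
    by (rule gromov_product_ray) (use assms spoke_ray in auto)
  have \<gamma>: "\<gamma> i \<in> H" "fst (\<gamma> i) \<noteq> Suc n" using ray_in ray_through_hair assms by blast+
  show ?thesis
  proof (cases "j \<le> len n")
    case True
    have "hdist org (\<gamma> i) \<le> hdist org (spoke n j) + hdist (spoke n j) (\<gamma> i)"
      by (rule hairs.triangle) (use \<gamma> ray_in[OF spoke_ray] assms in auto)
    then show ?thesis
      using eq True ray_org[OF assms(1,3)] ray_org[OF spoke_ray assms(4)]
        hairs.sym[OF \<gamma>(1) ray_in[OF spoke_ray assms(4)], of n] by simp
  next
    case False
    have "hdist (\<gamma> i) (spoke n j) = hdist (\<gamma> i) (tip n 0) + (j - len n)"
      using spoke_tip[of "j - len n" n] hdist_tip[OF \<gamma>, of "j - len n"] False by simp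
    moreover have "hdist org (\<gamma> i) \<le> hdist org (tip n 0) + hdist (tip n 0) (\<gamma> i)"
      by (rule hairs.triangle) (use \<gamma> in auto)
    ultimately show ?thesis
      using eq ray_org[OF assms(1,3)] hdist_org_tip[of 0 n] hairs.sym[OF \<gamma>(1) tip_in, of n 0] by simp
  qed
qed

lemma hdist_rims: "0 \<le> i \<Longrightarrow> 0 \<le> j \<Longrightarrow> hdist (rim c i) (rim c' j) = \<bar>c * i - c' * j\<bar>"
  by (simp add: rim_apply sdist_circle)

lemma gromov_product_rims:
  assumes "0 \<le> i" "0 \<le> j"
  shows "gromov_product XX org (rim 1 i) (rim (- 1) j) = 0"
  using gromov_product_ray[OF rim_ray rim_ray, of 1 "- 1" i j] hdist_rims[of i j 1 "-1"] assms by simp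

lemma gromov_product_commute: "gromov_product XX org x y = gromov_product XX org y x"
  by (simp add: gromov_product_def mdist_commute)

lemma gromov_product_bounded:
  assumes \<alpha>: "\<alpha> \<in> contracting_rays XX org" and \<beta>: "\<beta> \<in> contracting_rays XX org" and ne: "\<alpha> \<noteq> \<beta>"
  obtains C where "\<And>i j. 0 \<le> i \<Longrightarrow> 0 \<le> j \<Longrightarrow> gromov_product XX org (\<alpha> i) (\<beta> j) \<le> C"
proof -
  have "\<exists>C. \<forall>i j. 0 \<le> i \<longrightarrow> 0 \<le> j \<longrightarrow> gromov_product XX org (\<alpha> i) (\<beta> j) \<le> C"
  proof -
    consider n where "\<beta> = spoke n" | n where "\<alpha> = spoke n" | "\<alpha> = rim 1" "\<beta> = rim (- 1)" | "\<alpha> = rim (- 1)" "\<beta> = rim 1"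
      using contracting_ray_cases[OF \<alpha>] contracting_ray_cases[OF \<beta>] ne by metis
    then show ?thesis
    proof cases
      case 1
      then show ?thesis using gromov_product_spoke contracting_ray_ray[OF \<alpha>] ne by blast
    next
      case 2
      then show ?thesis using gromov_product_spoke[of \<beta>] contracting_ray_ray[OF \<beta>] ne gromov_product_commute by metis
    next
      case 3
      then show ?thesis using gromov_product_rims by (metis order_refl)
    next
      case 4
      then show ?thesis using gromov_product_rims gromov_product_commute by (metis order_refl)
    qed
  qed
  then show thesis using that by blast
qed

lemma eventually_quadrant: 
  "eventually (\<lambda>(i, j). a \<le> i \<and> b \<le> j) (at_top \<times>\<^sub>F at_top)" for a b :: real
  using eventually_prodI[OF eventually_ge_at_top[of a] eventually_ge_at_top[of b]]
  by (simp add: case_prod_unfold)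

lemma quadrant_nontrivial: "(at_top :: real filter) \<times>\<^sub>F (at_top :: real filter) \<noteq> bot"
  by (simp add: prod_filter_eq_bot)

lemma ray_equiv_eq: "ray_equiv XX org = Id_on (contracting_rays XX org)"
proof -
  have refl: "filterlim (\<lambda>(i, j). gromov_product XX org (\<alpha> i) (\<alpha> j)) at_top (at_top \<times>\<^sub>F at_top)"
    if "\<alpha> \<in> contracting_rays XX org" for \<alpha>
    unfolding filterlim_at_top
  proof
    fix Z :: real
    note \<alpha> = contracting_ray_ray[OF that]
    have "Z \<le> gromov_product XX org (\<alpha> i) (\<alpha> j)" if "max Z 0 \<le> i \<and> max Z 0 \<le> j" for i j
    proof -
      have "gromov_product XX org (\<alpha> i) (\<alpha> j) = (i + j - \<bar>i - j\<bar>) / 2"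
        using gromov_product_ray[OF \<alpha> \<alpha>, of i j] ray_iso[OF \<alpha>, of i j] that by simp
      also have "\<dots> = min i j" by (simp add: min_def)
      finally show ?thesis using that by simp
    qed
    then show "\<forall>\<^sub>F x in at_top \<times>\<^sub>F at_top. Z \<le> (case x of (i, j) \<Rightarrow> gromov_product XX org (\<alpha> i) (\<alpha> j))"
      by (intro eventually_mono[OF eventually_quadrant[of "max Z 0" "max Z 0"]]) auto
  qed
  have "\<alpha> = \<beta>" if \<alpha>: "\<alpha> \<in> contracting_rays XX org" and \<beta>: "\<beta> \<in> contracting_rays XX org"
    and lim: "filterlim (\<lambda>(i, j). gromov_product XX org (\<alpha> i) (\<beta> j)) at_top (at_top \<times>\<^sub>F at_top)" for \<alpha> \<beta>
  proof (rule ccontr)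
    assume ne: "\<alpha> \<noteq> \<beta>"
    obtain C where C: "\<And>i j. 0 \<le> i \<Longrightarrow> 0 \<le> j \<Longrightarrow> gromov_product XX org (\<alpha> i) (\<beta> j) \<le> C"
      using gromov_product_bounded[OF \<alpha> \<beta> ne] by blast
    have "\<forall>\<^sub>F x in at_top \<times>\<^sub>F at_top. C + 1 \<le> (case x of (i, j) \<Rightarrow> gromov_product XX org (\<alpha> i) (\<beta> j))"
      using lim unfolding filterlim_at_top by blast
    then have "\<forall>\<^sub>F x in (at_top :: real filter) \<times>\<^sub>F (at_top :: real filter). False"
    proof (rule eventually_elim2[OF _ eventually_quadrant[of 0 0]])
      fix x :: "real \<times> real"
      assume "C + 1 \<le> (case x of (i, j) \<Rightarrow> gromov_product XX org (\<alpha> i) (\<beta> j))" "case x of (i, j) \<Rightarrow> 0 \<le> i \<and> 0 \<le> j"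
      then show False using C[of "fst x" "snd x"] by (simp add: case_prod_unfold)
    qed
    then show False using quadrant_nontrivial by (simp add: eventually_False)
  qed
  then show ?thesis unfolding ray_equiv_def Id_on_def using refl by blast
qed

lemma contracting_boundary_eq: "contracting_boundary XX org = (\<lambda>\<gamma>. {\<gamma>}) ` contracting_rays XX org"
  unfolding contracting_boundary_def ray_equiv_eq quotient_def by auto

lemma boundary_product_singletons:
  "boundary_product XX org {\<alpha>} {\<beta>} =
    Liminf (at_top \<times>\<^sub>F at_top) (\<lambda>(i, j). ereal (gromov_product XX org (\<alpha> i) (\<beta> j)))"
  by (simp add: boundary_product_def)

lemma boundary_product_ge:
  assumes "\<And>i j. a \<le> i \<Longrightarrow> b \<le> j \<Longrightarrow> C \<le> gromov_product XX org (\<alpha> i) (\<beta> j)"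
  shows "ereal C \<le> boundary_product XX org {\<alpha>} {\<beta>}"
  unfolding boundary_product_singletons
  by (intro Liminf_bounded eventually_mono[OF eventually_quadrant[of a b]]) (use assms in auto)

lemma boundary_product_le:
  assumes "\<And>i j. a \<le> i \<Longrightarrow> b \<le> j \<Longrightarrow> gromov_product XX org (\<alpha> i) (\<beta> j) \<le> C"
  shows "boundary_product XX org {\<alpha>} {\<beta>} \<le> ereal C"
proof -
  have "Limsup (at_top \<times>\<^sub>F at_top) (\<lambda>(i, j). ereal (gromov_product XX org (\<alpha> i) (\<beta> j))) \<le> ereal C"
    by (intro Limsup_bounded eventually_mono[OF eventually_quadrant[of a b]]) (use assms in auto)
  then show ?thesis unfolding boundary_product_singletons
    using Liminf_le_Limsup[OF quadrant_nontrivial] order_trans by blast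
qed

lemma gromov_product_rim_spoke:
  assumes "max 0 (hi (p n)) \<le> i" "len n \<le> j"
  shows "gromov_product XX org (rim 1 i) (spoke n j) = (len n + hi (p n) - fst (p n)) / 2"
proof -
  have ij: "0 \<le> i" "0 \<le> j" using assms len_nonneg[of n] by linarith+
  have eq: "gromov_product XX org (rim 1 i) (spoke n j) = (i + j - hdist (rim 1 i) (spoke n j)) / 2"
    by (rule gromov_product_ray[OF rim_ray spoke_ray ij]) simp
  have "rim 1 i \<in> H" "fst (rim 1 i) \<noteq> Suc n" using ij by (simp_all add: rim_apply)
  then have "hdist (rim 1 i) (spoke n j) = hdist (rim 1 i) (tip n 0) + (j - len n)"
    using spoke_tip[of "j - len n" n] hdist_tip[of "rim 1 i" n "j - len n"] assms by simp
  also have "hdist (rim 1 i) (tip n 0) = sdist (p n) (0, i)"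
    using sdist_sym[OF p_in zero_in, of n i] by (simp add: tip_def rim_apply[OF ij(1)])
  also have "\<dots> = fst (p n) + (i - hi (p n))"
    using sdist_shadow[OF p_in zero_in, of n i] assms by (simp add: lo_def)
  finally show ?thesis using eq by simp
qed

section \<open>Isolating a boundary point\<close>

lemma isolated:
  assumes "\<And>n. snd (p n) = 0"
  shows "openin (Gp_topology XX org) {{rim 1}}"
    and "openin (contracting_visual_topology XX org) {{rim 1}}"
proof -
  have gp: "gromov_product XX org (rim 1 i) (spoke n j) \<le> 1" if "max 0 (hi (p n)) \<le> i" "len n \<le> j" for i j n
  proof -
    have "len n \<le> fst (p n)" using sdist_le_sum[OF zero_in p_in, of 0 n] assms by (simp add: len_def)
    moreover have "hi (p n) \<le> 2" using arctan_ubound[of "fst (p n)"] pi_less_4 assms[of n] unfolding hi_def by linarith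
    ultimately show ?thesis using gromov_product_rim_spoke[OF that] by simp
  qed
  have mem: "{{rim 1}} \<subseteq> contracting_boundary XX org" by (auto simp: contracting_boundary_eq)
  have "boundary_nbhd XX org {rim 1} 2 \<subseteq> {{rim 1}}"
  proof
    fix \<zeta> assume "\<zeta> \<in> boundary_nbhd XX org {rim 1} 2"
    then obtain \<beta> where \<beta>: "\<beta> \<in> contracting_rays XX org" "\<zeta> = {\<beta>}" "ereal 2 \<le> boundary_product XX org {rim 1} {\<beta>}"
      by (auto simp: boundary_nbhd_def contracting_boundary_eq)
    show "\<zeta> \<in> {{rim 1}}"
      using \<beta>(1)
    proof (cases rule: contracting_ray_cases)
      case 2
      have "boundary_product XX org {rim 1} {\<beta>} \<le> ereal 0"
        by (rule boundary_product_le[of 0 0]) (simp add: 2 gromov_product_rims)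
      then have "ereal 2 \<le> ereal 0" using \<beta>(3) order_trans by blast
      then show ?thesis by simp
    next
      case (3 n)
      have "boundary_product XX org {rim 1} {\<beta>} \<le> ereal 1"
        unfolding 3 by (rule boundary_product_le[OF gp])
      then have "ereal 2 \<le> ereal 1" using \<beta>(3) order_trans by blast
      then show ?thesis by simp
    qed (use \<beta> in simp)
  qed
  then show "openin (Gp_topology XX org) {{rim 1}}"
    unfolding openin_Gp_topology using mem by (auto intro!: exI[of _ 2])
  define U where "U = {\<beta> \<in> geodesic_rays XX org. mdist XX (rim 1 2) (\<beta> 2) < 1}"
  have rim2: "rim 1 2 \<in> H" by (simp add: rim_apply)
  have "openin (visual_topology XX org) U"
    unfolding openin_visual_topology
  proof (intro conjI ballI)
    show "U \<subseteq> geodesic_rays XX org" by (auto simp: U_def)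
    fix \<alpha> assume \<alpha>: "\<alpha> \<in> U"
    show "\<exists>K e. compact K \<and> K \<subseteq> {0..} \<and> e > 0 \<and>
          {\<beta> \<in> geodesic_rays XX org. \<forall>t\<in>K. mdist XX (\<alpha> t) (\<beta> t) < e} \<subseteq> U"
    proof (intro exI conjI)
      show "compact {2::real}" "{2::real} \<subseteq> {0..}" by auto
      show "1 - mdist XX (rim 1 2) (\<alpha> 2) > 0" using \<alpha> by (simp add: U_def)
      show "{\<beta> \<in> geodesic_rays XX org. \<forall>t\<in>{2}. mdist XX (\<alpha> t) (\<beta> t) < 1 - mdist XX (rim 1 2) (\<alpha> 2)} \<subseteq> U"
      proof
        fix \<beta> assume \<beta>: "\<beta> \<in> {\<beta> \<in> geodesic_rays XX org. \<forall>t\<in>{2}. mdist XX (\<alpha> t) (\<beta> t) < 1 - mdist XX (rim 1 2) (\<alpha> 2)}"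
        have "\<alpha> 2 \<in> H" "\<beta> 2 \<in> H" using \<alpha> \<beta> ray_in[of \<alpha> 2] ray_in[of \<beta> 2] by (auto simp: U_def)
        then show "\<beta> \<in> U" using \<alpha> \<beta> rim2 hairs.triangle[of "rim 1 2" "\<alpha> 2" "\<beta> 2"] by (auto simp: U_def)
      qed
    qed
  qed
  moreover have "{{rim 1}} = the_elem -` U \<inter> contracting_boundary XX org"
  proof (intro equalityI subsetI)
    fix \<zeta> assume "\<zeta> \<in> the_elem -` U \<inter> contracting_boundary XX org"
    then obtain \<beta> where \<beta>: "\<beta> \<in> contracting_rays XX org" "\<zeta> = {\<beta>}" "\<beta> \<in> U" by (auto simp: contracting_boundary_eq)
    have ray: "\<beta> \<in> geodesic_rays XX org" by (rule contracting_ray_ray[OF \<beta>(1)])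
    have lt: "hdist (rim 1 2) (\<beta> 2) < 1" using \<beta>(3) rim2 ray_in[OF ray, of 2] by (simp add: U_def)
    show "\<zeta> \<in> {{rim 1}}"
      using \<beta>(1)
    proof (cases rule: contracting_ray_cases)
      case 2
      then show ?thesis using lt hdist_rims[of 2 2 1 "- 1"] by simp
    next
      case (3 n)
      define i where "i = max 2 (hi (p n))"
      define j where "j = max 2 (len n)"
      have ij: "2 \<le> i" "2 \<le> j" "max 0 (hi (p n)) \<le> i" "len n \<le> j" by (auto simp: i_def j_def)
      note rim = rim_ray[of 1, simplified]
      have "hdist (rim 1 i) (\<beta> j) \<le> hdist (rim 1 i) (rim 1 2) + hdist (rim 1 2) (\<beta> j)"
        "hdist (rim 1 2) (\<beta> j) \<le> hdist (rim 1 2) (\<beta> 2) + hdist (\<beta> 2) (\<beta> j)"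
        using hairs.triangle ray_in[OF rim] ray_in[OF ray] ij by simp_all
      moreover have "hdist (rim 1 i) (rim 1 2) = i - 2" "hdist (\<beta> 2) (\<beta> j) = j - 2"
        using ray_iso[OF rim, of i 2] ray_iso[OF ray, of 2 j] ij by simp_all
      moreover have "(i + j - hdist (rim 1 i) (\<beta> j)) / 2 \<le> 1"
        using gp[OF ij(3,4)] gromov_product_ray[OF rim ray, of i j] ij 3 by simp
      ultimately show ?thesis using lt by simp
    qed (use \<beta> in simp)
  next
    fix \<zeta> assume "\<zeta> \<in> {{rim 1}}"
    then have "\<zeta> = {rim 1}" by simp
    moreover have "rim 1 \<in> U" using rim_ray[of 1] rim2 hairs.zero[of "rim 1 2" "rim 1 2"] by (simp add: U_def)
    ultimately show "\<zeta> \<in> the_elem -` U \<inter> contracting_boundary XX org"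
      by (auto simp: contracting_boundary_eq)
  qed
  ultimately show "openin (contracting_visual_topology XX org) {{rim 1}}"
    unfolding contracting_visual_topology_def openin_pullback_topology by blast
qed

lemma spoke_ne_rim: "spoke n \<noteq> rim c"
proof
  assume "spoke n = rim c"
  then have "spoke n (len n + 1) = rim c (len n + 1)" by simp
  then show False using spoke_tip[of 1 n] len_nonneg[of n] by (simp add: tip_def rim_apply)
qed

lemma not_isolated:
  assumes "filterlim (\<lambda>n. snd (p n)) at_top sequentially"
  shows "\<not> openin (Gp_topology XX org) {{rim 1}}"
    and "\<not> openin (contracting_visual_topology XX org) {{rim 1}}"
proof -
  have ex: "\<exists>n. r \<le> lo (p n)" for r
  proof -
    obtain n where "r + 2 \<le> snd (p n)" using assms unfolding filterlim_at_top eventually_sequentially by blast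
    then show ?thesis using arctan_ubound[of "fst (p n)"] pi_less_4 unfolding lo_def by (intro exI[of _ n]) linarith
  qed
  have len: "len n = fst (p n) + lo (p n)" if "0 \<le> lo (p n)" for n
    using sdist_shadow[OF zero_in p_in, of 0 n] that by (simp add: len_def hi_def)
  show "\<not> openin (Gp_topology XX org) {{rim 1}}"
  proof
    assume "openin (Gp_topology XX org) {{rim 1}}"
    then obtain r where r: "r > 0" "boundary_nbhd XX org {rim 1} r \<subseteq> {{rim 1}}"
      unfolding openin_Gp_topology by blast
    obtain n where n: "r \<le> lo (p n)" using ex by blast
    have "lo (p n) \<le> hi (p n)" using lo_le_hi p_in by blast
    then have "r \<le> gromov_product XX org (rim 1 i) (spoke n j)" if "max 0 (hi (p n)) \<le> i" "len n \<le> j" for i j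
      using gromov_product_rim_spoke[OF that] len[of n] n r by simp
    then have "ereal r \<le> boundary_product XX org {rim 1} {spoke n}" by (rule boundary_product_ge)
    then have "{spoke n} \<in> boundary_nbhd XX org {rim 1} r" by (simp add: boundary_nbhd_def contracting_boundary_eq)
    then show False using r(2) spoke_ne_rim by blast
  qed
  show "\<not> openin (contracting_visual_topology XX org) {{rim 1}}"
  proof
    assume "openin (contracting_visual_topology XX org) {{rim 1}}"
    then obtain U where U: "openin (visual_topology XX org) U" "{{rim 1}} = the_elem -` U \<inter> contracting_boundary XX org"
      unfolding contracting_visual_topology_def openin_pullback_topology by blast
    have "rim 1 \<in> U" using U(2) by (metis IntD1 insertI1 the_elem_eq vimage_eq)
    then obtain K e where K: "compact K" "K \<subseteq> {0..}" "0 < e"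
      "{\<beta> \<in> geodesic_rays XX org. \<forall>t\<in>K. mdist XX (rim 1 t) (\<beta> t) < e} \<subseteq> U"
      using U(1) unfolding openin_visual_topology by meson
    obtain B where B: "\<And>t. t \<in> K \<Longrightarrow> norm t \<le> B" using compact_imp_bounded[OF K(1)] unfolding bounded_iff by blast
    obtain n where n: "max B 0 \<le> lo (p n)" using ex by blast
    have "spoke n t = rim 1 t" if t: "t \<in> K" for t
    proof -
      have t0: "0 \<le> t" "t \<le> lo (p n)" using K(2) B[OF t] n t by auto
      have len_n: "len n = fst (p n) + lo (p n)" using len n by simp
      have tl: "t \<le> len n" using t0 len_n p_in[of n] by (simp add: sheet_def)
      note rim = rim_ray[of 1, simplified]
      have end_n: "spoke n (len n) = tip n 0" using spoke_tip[of 0 n] by simp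
      have "hdist (rim 1 t) (tip n 0) = len n - t"
        using sdist_shadow[OF zero_in p_in, of t n] t0 len_n by (simp add: rim_apply tip_def hi_def)
      moreover have "hdist (spoke n t) (tip n 0) = len n - t"
        using ray_iso[OF spoke_ray t0(1) len_nonneg, of n n] tl end_n by simp
      moreover have "hdist org (spoke n t) = t" "hdist org (rim 1 t) = t" "hdist org (tip n 0) = len n"
        using ray_org[OF spoke_ray t0(1), of n] ray_org[OF rim t0(1)] hdist_org_tip[of 0 n] by simp_all
      ultimately show ?thesis
        by (intro hairs.geodesic_unique[of org "tip n 0"]) (use ray_in[OF rim t0(1)] ray_in[OF spoke_ray t0(1)] in simp_all)
    qed
    then have "mdist XX (rim 1 t) (spoke n t) < e" if "t \<in> K" for t
    proof -
      have "rim 1 t \<in> H" using ray_in[OF rim_ray, of 1 t] K(2) that by auto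
      then have "mdist XX (rim 1 t) (rim 1 t) = 0" using hairs.zero by simp
      then show ?thesis using K(3) \<open>\<And>t. t \<in> K \<Longrightarrow> spoke n t = rim 1 t\<close>[OF that] by simp
    qed
    then have "spoke n \<in> U" using K(4) spoke_ray by blast
    then have "{spoke n} \<in> {{rim 1}}" unfolding U(2) by (simp add: contracting_boundary_eq)
    then show False using spoke_ne_rim by blast
  qed
qed

end

section \<open>The induced map of a shear\<close>

lemma (in developing_space) bounded_hausdorff_dist_trans:
  assumes M: "A \<subseteq> M" "B \<subseteq> M" "C \<subseteq> M"
    and "bounded_hausdorff_dist X A B" "bounded_hausdorff_dist X A C"
  shows "bounded_hausdorff_dist X B C"
proof -
  obtain r where r: "\<And>a. a \<in> A \<Longrightarrow> \<exists>b\<in>B. mdist X a b \<le> r" "\<And>b. b \<in> B \<Longrightarrow> \<exists>a\<in>A. mdist X a b \<le> r"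
    using assms(4) unfolding bounded_hausdorff_dist_def by blast
  obtain s where s: "\<And>a. a \<in> A \<Longrightarrow> \<exists>b\<in>C. mdist X a b \<le> s" "\<And>b. b \<in> C \<Longrightarrow> \<exists>a\<in>A. mdist X a b \<le> s"
    using assms(5) unfolding bounded_hausdorff_dist_def by blast
  have le: "mdist X b c \<le> r + s" if "a \<in> A" "b \<in> B" "c \<in> C" "mdist X a b \<le> r" "mdist X a c \<le> s" for a b c
  proof -
    have abc: "a \<in> M" "b \<in> M" "c \<in> M" using that M by blast+
    then show ?thesis using triangle[OF abc(2,1,3)] sym[OF abc(1,2)] that(4,5) by simp
  qed
  show ?thesis
    unfolding bounded_hausdorff_dist_def
  proof (intro exI[of _ "r + s"] conjI ballI)
    fix b assume b: "b \<in> B"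
    obtain a where a: "a \<in> A" "mdist X a b \<le> r" using r(2)[OF b] by blast
    obtain c where c: "c \<in> C" "mdist X a c \<le> s" using s(1)[OF a(1)] by blast
    show "\<exists>c\<in>C. mdist X b c \<le> r + s" using le[OF a(1) b c(1) a(2) c(2)] c(1) by blast
  next
    fix c assume c: "c \<in> C"
    obtain a where a: "a \<in> A" "mdist X a c \<le> s" using s(2)[OF c] by blast
    obtain b where b: "b \<in> B" "mdist X a b \<le> r" using r(1)[OF a(1)] by blast
    show "\<exists>b\<in>B. mdist X b c \<le> r + s" using le[OF a(1) b(1) c b(2) a(2)] b(1) by blast
  qed
qed

lemma (in hairy_sheet) contracting_ray_bounded_hausdorff:
  assumes \<alpha>: "\<alpha> \<in> contracting_rays XX org" and \<beta>: "\<beta> \<in> contracting_rays XX org"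
    and bh: "bounded_hausdorff_dist XX (ray_image \<alpha>) (ray_image \<beta>)"
  shows "\<alpha> = \<beta>"
proof (rule ccontr)
  note rays = contracting_ray_ray[OF \<alpha>] contracting_ray_ray[OF \<beta>]
  assume "\<alpha> \<noteq> \<beta>"
  then obtain C where C: "\<And>i j. 0 \<le> i \<Longrightarrow> 0 \<le> j \<Longrightarrow> gromov_product XX org (\<alpha> i) (\<beta> j) \<le> C"
    using gromov_product_bounded[OF \<alpha> \<beta>] by blast
  obtain r where r: "\<forall>a\<in>ray_image \<alpha>. \<exists>b\<in>ray_image \<beta>. mdist XX a b \<le> r"
    using bh unfolding bounded_hausdorff_dist_def by blast
  define i where "i = \<bar>C\<bar> + \<bar>r\<bar> + 1"
  have i: "0 \<le> i" by (simp add: i_def)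
  then have "\<alpha> i \<in> ray_image \<alpha>" by (simp add: ray_image_def)
  then obtain b where b: "b \<in> ray_image \<beta>" "mdist XX (\<alpha> i) b \<le> r" using r by blast
  then obtain j where j: "0 \<le> j" "mdist XX (\<alpha> i) (\<beta> j) \<le> r" unfolding ray_image_def by auto
  have H: "\<alpha> i \<in> H" "\<beta> j \<in> H" using ray_in rays i j by blast+
  have d: "hdist (\<alpha> i) (\<beta> j) \<le> r" using j(2) unfolding hairs.mdist_X[OF H] .
  have "i \<le> j + r"
    using hairs.triangle[OF org_in H(2,1)] hairs.sym[OF H] d ray_org[OF rays(1) i] ray_org[OF rays(2) j(1)] by linarith
  moreover have "i + j - hdist (\<alpha> i) (\<beta> j) \<le> 2 * C"
    using C[OF i j(1)] unfolding gromov_product_ray[OF rays i j(1)] by (simp add: field_simps)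
  ultimately show False using d by (simp add: i_def)
qed

definition shear_pt :: "real \<Rightarrow> pt \<Rightarrow> pt" where
  "shear_pt c x = (if fst x = 0 then (0, shear c (snd x)) else x)"

lemma shear_pt_inverse [simp]: "shear_pt (- c) (shear_pt c x) = x" "shear_pt c (shear_pt (- c) x) = x"
  by (simp_all add: shear_pt_def prod_eq_iff)

locale sheared = P: hairy_sheet p + Q: hairy_sheet q for p q +
  fixes c :: real
  assumes q_eq: "q n = shear c (p n)" and c_le: "\<bar>c\<bar> \<le> 1"
begin

lemma inverse: "sheared q p (- c)"
  by unfold_locales (use q_eq c_le in simp_all)

lemma shear_pt_in: "x \<in> P.H \<Longrightarrow> shear_pt c x \<in> P.H"
  by (auto simp: shear_pt_def P.H_def)

lemma lipschitz:
  assumes "x \<in> P.H" "y \<in> P.H"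
  shows "Q.hdist (shear_pt c x) (shear_pt c y) \<le> 4 * P.hdist x y"
proof -
  have h: "Q.height (shear_pt c z) = P.height z" for z by (simp add: shear_pt_def P.height_def)
  have b: "Q.base (shear_pt c z) = shear c (P.base z)" for z
    by (simp add: shear_pt_def P.base_def Q.base_def q_eq)
  have f: "fst (shear_pt c z) = fst z" for z by (simp add: shear_pt_def)
  have "sdist (shear c (P.base x)) (shear c (P.base y)) \<le> 4 * sdist (P.base x) (P.base y)"
    using shear_lipschitz P.base_in assms c_le by blast
  then show ?thesis
    using P.height_nonneg[OF assms(1)] P.height_nonneg[OF assms(2)]
    unfolding Q.hdist_def P.hdist_def h b f by simp
qed

lemma quasi_isometry: "quasi_isometry P.XX Q.XX (shear_pt c)"
proof -
  interpret inv: sheared q p "- c" by (rule inverse)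
  have "mdist P.XX x y / 4 - 0 \<le> mdist Q.XX (shear_pt c x) (shear_pt c y) \<and>
      mdist Q.XX (shear_pt c x) (shear_pt c y) \<le> 4 * mdist P.XX x y + 0"
    if "x \<in> mspace P.XX" "y \<in> mspace P.XX" for x y
  proof -
    have xy: "x \<in> P.H" "y \<in> P.H" using that by simp_all
    have im: "shear_pt c x \<in> P.H" "shear_pt c y \<in> P.H" using shear_pt_in xy by blast+
    show ?thesis using lipschitz[OF xy] inv.lipschitz[OF im] xy im by simp
  qed
  moreover have "\<exists>x\<in>mspace P.XX. mdist Q.XX (shear_pt c x) y \<le> 0" if "y \<in> mspace Q.XX" for y
  proof -
    have y: "y \<in> Q.H" using that by simp
    then show ?thesis
      using inv.shear_pt_in[OF y] Q.hairs.zero[OF y y] by (intro bexI[of _ "shear_pt (- c) y"]) simp_all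
  qed
  moreover have "shear_pt c \<in> mspace P.XX \<rightarrow> mspace Q.XX" using shear_pt_in by simp
  moreover have "(1::real) \<le> 4" "(0::real) \<le> 0" by simp_all
  ultimately show ?thesis unfolding quasi_isometry_def by blast
qed

lemma boundary_map_eq:
  assumes \<alpha>: "\<alpha> \<in> contracting_rays P.XX org" and \<beta>: "\<beta> \<in> contracting_rays Q.XX org"
    and bh: "bounded_hausdorff_dist Q.XX (shear_pt c ` ray_image \<alpha>) (ray_image \<beta>)"
  shows "boundary_map Q.XX org (shear_pt c) {\<alpha>} = {\<beta>}"
proof -
  have sub: "shear_pt c ` ray_image \<alpha> \<subseteq> Q.H"
    using P.ray_image_subset[OF P.contracting_ray_ray[OF \<alpha>]] shear_pt_in by blast
  have "\<beta>' = \<beta>" if \<beta>': "\<beta>' \<in> contracting_rays Q.XX org"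
    "bounded_hausdorff_dist Q.XX (shear_pt c ` ray_image \<alpha>) (ray_image \<beta>')" for \<beta>'
  proof (rule Q.contracting_ray_bounded_hausdorff[OF \<beta>'(1) \<beta>])
    show "bounded_hausdorff_dist Q.XX (ray_image \<beta>') (ray_image \<beta>)"
      by (rule Q.hairs.bounded_hausdorff_dist_trans[OF sub _ _ \<beta>'(2) bh];
          rule Q.ray_image_subset[OF Q.contracting_ray_ray]; fact)
  qed
  then show ?thesis unfolding boundary_map_def using \<beta> bh by blast
qed

lemma boundary_map_rim:
  assumes "\<bar>e\<bar> = 1"
  shows "boundary_map Q.XX org (shear_pt c) {rim e} = {rim e}"
proof (rule boundary_map_eq)
  have "shear_pt c (rim e u) = rim e u" if "0 \<le> u" for u
    using that by (simp add: rim_apply shear_pt_def shear_def radius_def)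
  then have "shear_pt c ` ray_image (rim e) = ray_image (rim e)"
    unfolding ray_image_def image_image by (intro image_cong) auto
  moreover have "mdist Q.XX a a \<le> 0" if "a \<in> ray_image (rim e)" for a
  proof -
    have "a \<in> Q.H" using Q.ray_image_subset[OF Q.rim_ray[OF assms]] that by blast
    then show ?thesis using Q.hairs.zero[of a a] by simp
  qed
  then have "bounded_hausdorff_dist Q.XX (ray_image (rim e)) (ray_image (rim e))"
    unfolding bounded_hausdorff_dist_def by blast
  ultimately show "bounded_hausdorff_dist Q.XX (shear_pt c ` ray_image (rim e)) (ray_image (rim e))" by simp
qed (use assms in simp_all)

lemma boundary_map_spoke: "boundary_map Q.XX org (shear_pt c) {P.spoke n} = {Q.spoke n}"
proof (rule boundary_map_eq)
  have tip: "shear_pt c (P.tip n h) = Q.tip n h" for h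
    by (simp add: shear_pt_def P.tip_def Q.tip_def q_eq)
  have tip_in: "Q.tip n h \<in> ray_image (Q.spoke n)" "P.tip n h \<in> ray_image (P.spoke n)" if "0 \<le> h" for h
    using Q.spoke_tip[OF that, of n] P.spoke_tip[OF that, of n] that Q.len_nonneg[of n] P.len_nonneg[of n]
    unfolding ray_image_def by (metis add_nonneg_nonneg atLeast_iff image_eqI)+
  have QH: "Q.spoke n u \<in> Q.H" "P.spoke n u \<in> P.H" if "0 \<le> u" for u
    using Q.ray_in[OF Q.spoke_ray] P.ray_in[OF P.spoke_ray] that by blast+
  have same: "mdist Q.XX (Q.tip n h) (Q.tip n h) \<le> 4 * P.len n + Q.len n" for h
  proof -
    have "Q.hdist (Q.tip n h) (Q.tip n h) = 0" using Q.hairs.zero by simp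
    then show ?thesis using P.len_nonneg[of n] Q.len_nonneg[of n] by simp
  qed
  show "bounded_hausdorff_dist Q.XX (shear_pt c ` ray_image (P.spoke n)) (ray_image (Q.spoke n))"
    unfolding bounded_hausdorff_dist_def
  proof (intro exI[of _ "4 * P.len n + Q.len n"] conjI ballI)
    fix a assume "a \<in> shear_pt c ` ray_image (P.spoke n)"
    then obtain u where u: "0 \<le> u" "a = shear_pt c (P.spoke n u)" unfolding ray_image_def by auto
    show "\<exists>b\<in>ray_image (Q.spoke n). mdist Q.XX a b \<le> 4 * P.len n + Q.len n"
    proof (cases "u \<le> P.len n")
      case True
      have "P.hdist (P.spoke n u) (P.tip n 0) = P.len n - u"
        using P.ray_iso[OF P.spoke_ray u(1) P.len_nonneg, of n n] P.spoke_tip[of 0 n] True by simp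
      then have "Q.hdist a (Q.tip n 0) \<le> 4 * (P.len n - u)"
        using lipschitz[OF QH(2)[OF u(1)] P.tip_in, of n 0] u(2) tip[of 0] by simp
      moreover have "a \<in> Q.H" using u shear_pt_in[OF QH(2)[OF u(1)]] by simp
      ultimately have "mdist Q.XX a (Q.tip n 0) \<le> 4 * P.len n + Q.len n"
        using u(1) Q.len_nonneg[of n] by simp
      then show ?thesis using tip_in(1)[of 0] by auto
    next
      case False
      then have "a = Q.tip n (u - P.len n)" using u(2) P.spoke_tip[of "u - P.len n" n] tip by simp
      moreover have "0 \<le> u - P.len n" using False by simp
      ultimately show ?thesis using tip_in(1) same by blast
    qed
  next
    fix b assume "b \<in> ray_image (Q.spoke n)"
    then obtain u where u: "0 \<le> u" "b = Q.spoke n u" unfolding ray_image_def by auto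
    have im: "Q.tip n h \<in> shear_pt c ` ray_image (P.spoke n)" if "0 \<le> h" for h
      using tip_in(2)[OF that] tip[of h] by (metis image_eqI)
    show "\<exists>a\<in>shear_pt c ` ray_image (P.spoke n). mdist Q.XX a b \<le> 4 * P.len n + Q.len n"
    proof (cases "u \<le> Q.len n")
      case True
      have "Q.hdist (Q.tip n 0) b = Q.len n - u"
        using Q.ray_iso[OF Q.spoke_ray Q.len_nonneg u(1), of n n] Q.spoke_tip[of 0 n] True u(2) by simp
      then have "mdist Q.XX (Q.tip n 0) b \<le> 4 * P.len n + Q.len n"
        using QH(1)[OF u(1)] u P.len_nonneg[of n] by simp
      then show ?thesis using im[of 0] by auto
    next
      case False
      then have "b = Q.tip n (u - Q.len n)" using u(2) Q.spoke_tip[of "u - Q.len n" n] by simp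
      moreover have "0 \<le> u - Q.len n" using False by simp
      ultimately show ?thesis using im same by blast
    qed
  qed
qed simp_all

lemma boundary_map_inverse:
  assumes "\<eta> \<in> contracting_boundary P.XX org"
  shows "boundary_map Q.XX org (shear_pt c) \<eta> \<in> contracting_boundary Q.XX org"
    and "boundary_map P.XX org (shear_pt (- c)) (boundary_map Q.XX org (shear_pt c) \<eta>) = \<eta>"
proof -
  interpret inv: sheared q p "- c" by (rule inverse)
  obtain \<alpha> where \<alpha>: "\<alpha> \<in> contracting_rays P.XX org" "\<eta> = {\<alpha>}"
    using assms unfolding P.contracting_boundary_eq by blast
  have "boundary_map Q.XX org (shear_pt c) \<eta> \<in> contracting_boundary Q.XX org \<and>
    boundary_map P.XX org (shear_pt (- c)) (boundary_map Q.XX org (shear_pt c) \<eta>) = \<eta>"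
    using \<alpha>(1)
  proof (cases rule: P.contracting_ray_cases)
    case 1
    then show ?thesis using \<alpha>(2) by (simp add: boundary_map_rim inv.boundary_map_rim Q.contracting_boundary_eq)
  next
    case 2
    then show ?thesis using \<alpha>(2) by (simp add: boundary_map_rim inv.boundary_map_rim Q.contracting_boundary_eq)
  next
    case (3 n)
    then show ?thesis using \<alpha>(2)
      by (simp add: boundary_map_spoke inv.boundary_map_spoke Q.contracting_boundary_eq)
  qed
  then show "boundary_map Q.XX org (shear_pt c) \<eta> \<in> contracting_boundary Q.XX org"
    "boundary_map P.XX org (shear_pt (- c)) (boundary_map Q.XX org (shear_pt c) \<eta>) = \<eta>" by blast+
qed

lemma boundary_map_bij:
  "bij_betw (boundary_map Q.XX org (shear_pt c)) (contracting_boundary P.XX org) (contracting_boundary Q.XX org)"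
proof -
  interpret inv: sheared q p "- c" by (rule inverse)
  show ?thesis
    by (rule bij_betw_byWitness[of _ "boundary_map P.XX org (shear_pt (- c))"])
      (use boundary_map_inverse inv.boundary_map_inverse in auto)
qed

lemma boundary_map_preimage:
  assumes "A \<subseteq> contracting_boundary P.XX org" "{rim 1} \<in> A"
  shows "{\<eta> \<in> A. boundary_map Q.XX org (shear_pt c) \<eta> \<in> {{rim 1}}} = {{rim 1}}"
proof -
  interpret inv: sheared q p "- c" by (rule inverse)
  have "\<eta> = {rim 1}" if "\<eta> \<in> A" "boundary_map Q.XX org (shear_pt c) \<eta> = {rim 1}" for \<eta>
    using boundary_map_inverse(2)[of \<eta>] assms(1) that inv.boundary_map_rim[of 1] by auto
  then show ?thesis using assms(2) boundary_map_rim[of 1] by auto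
qed

end

theorem mainTheorem1:
  shows "\<exists>(X :: pt metric) (Y :: pt metric) oX oY \<phi>.
    proper_space X \<and> cat0_space X \<and> oX \<in> mspace X \<and>
    proper_space Y \<and> cat0_space Y \<and> oY \<in> mspace Y \<and>
    quasi_isometry X Y \<phi> \<and>
    bij_betw (boundary_map Y oY \<phi>) (contracting_boundary X oX) (contracting_boundary Y oY) \<and>
    \<not> continuous_map (Gp_topology X oX) (Gp_topology Y oY) (boundary_map Y oY \<phi>) \<and>
    \<not> homeomorphic_map (contracting_visual_topology X oX) (contracting_visual_topology Y oY)
        (boundary_map Y oY \<phi>)"
proof -
  define q where "q n = (real (Suc n), 0 :: real)" for n
  define p where "p n = shear 1 (q n)" for n
  interpret sheared p q "- 1"
    by unfold_locales (simp_all add: p_def q_def sheet_def)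
  let ?f = "boundary_map Q.XX org (shear_pt (- 1))"
  have q0: "snd (q n) = 0" for n by (simp add: q_def)
  have "filterlim (\<lambda>n. ln (real (Suc n))) at_top sequentially"
    by (intro filterlim_compose[OF ln_at_top] filterlim_compose[OF filterlim_real_sequentially filterlim_Suc])
  then have lim: "filterlim (\<lambda>n. snd (p n)) at_top sequentially"
  proof (rule filterlim_at_top_mono, intro always_eventually allI)
    show "ln (real (Suc n)) \<le> snd (p n)" for n
      using le_radius[of "q n"] by (simp add: p_def q_def shear_def)
  qed
  have "\<not> continuous_map (Gp_topology P.XX org) (Gp_topology Q.XX org) ?f"
  proof
    assume "continuous_map (Gp_topology P.XX org) (Gp_topology Q.XX org) ?f"
    then have "openin (Gp_topology P.XX org) {\<eta> \<in> topspace (Gp_topology P.XX org). ?f \<eta> \<in> {{rim 1}}}"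
      using Q.isolated(1)[OF q0] by (rule openin_continuous_map_preimage)
    moreover have "{\<eta> \<in> topspace (Gp_topology P.XX org). ?f \<eta> \<in> {{rim 1}}} = {{rim 1}}"
      by (rule boundary_map_preimage) (simp_all add: topspace_Gp_topology P.contracting_boundary_eq)
    ultimately show False using P.not_isolated(1)[OF lim] by simp
  qed
  moreover have "\<not> homeomorphic_map (contracting_visual_topology P.XX org) (contracting_visual_topology Q.XX org) ?f"
  proof
    let ?T = "contracting_visual_topology P.XX org"
    assume "homeomorphic_map ?T (contracting_visual_topology Q.XX org) ?f"
    then have "continuous_map ?T (contracting_visual_topology Q.XX org) ?f"
      by (rule homeomorphic_imp_continuous_map)
    then have "openin ?T {\<eta> \<in> topspace ?T. ?f \<eta> \<in> {{rim 1}}}"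
      using Q.isolated(2)[OF q0] by (rule openin_continuous_map_preimage)
    moreover have "{\<eta> \<in> topspace ?T. ?f \<eta> \<in> {{rim 1}}} = {{rim 1}}"
      by (rule boundary_map_preimage)
        (auto simp: contracting_visual_topology_def topspace_pullback_topology topspace_visual_topology
          P.contracting_boundary_eq P.rim_ray)
    ultimately show False using P.not_isolated(2)[OF lim] by simp
  qed
  moreover have "org \<in> mspace P.XX" "org \<in> mspace Q.XX" by simp_all
  ultimately show ?thesis
    using P.proper Q.proper P.hairs.cat0_space_X Q.hairs.cat0_space_X quasi_isometry boundary_map_bij
    by blast
qed

end
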